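(* Let $n\ge1$, let $r\le n+2$, and let $d_1\le d_2\le\cdots\le d_r$ be positive integers. Let $I=(f_1,\dots,f_r)$ be a generic homogeneous ideal of type $(n;d_1,\dots,d_r)$ in $R=K[x_1,\dots,x_n]$. For $1\le i\le r$ put $\delta_i=d_1+\cdots+d_i-i$, and for $2\le i\le r$ put $\sigma_i=\min\{\delta_{i-1},\lfloor\delta_i/2\rfloor\}$. If either $r\le 3$, or $r\ge 4$ and $d_i\ge\sigma_{i-1}$ for every $4\le i\le r$, then the Hilbert series of $R/I$ is $$HS_{R/I}(z)=\left\lceil \frac{\prod_{i=1}^r(1-z^{d_i})}{(1-z)^n}\right\rceil .$$
   Context: $K$ is an infinite field (of any characteristic) that is an extension of a base field $F$. A form of degree $d$ in $K[x_1,\dots,x_n]$ is generic over $F$ if it is a linear combination of all monomials of degree $d$ with coefficients algebraically independent over $F$. A homogeneous ideal $(f_1,\dots,f_r)$ is a generic homogeneous ideal of type $(n;d_1,\dots,d_r)$ if $f_1,\dots,f_r\in K[x_1,\dots,x_n]$ are generic forms of degrees $d_1,\dots,d_r$ such that all the coefficients of all the $f_i$ taken together are algebraically independent over $F$. The Hilbert series of $A=R/I$ is $HS_A(z)=\sum_{t\ge0}\dim_K(R_t/I_t)\,z^t$. For a power series $\sum a_iz^i$ with integer coefficients, $\lceil\sum a_iz^i\rceil:=\sum b_iz^i$, where $b_i=a_i$ if $a_j>0$ for all $j\le i$, and $b_i=0$ otherwise. *)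

theory Defs
  imports
    "HOL-Library.Poly_Mapping"
    "HOL-Computational_Algebra.Formal_Power_Series"
begin

section \<open>Dimension of a quotient space\<close>

text \<open>
  For subspaces \<open>U \<subseteq> W\<close>, a quotient basis is a finite set \<open>B\<close> of representatives whose cosets
  \<open>b + U\<close> form a basis of \<open>W / U\<close>; the zero vector of \<open>W / U\<close> is the coset \<open>U\<close>.
\<close>

definition quotient_basis ::
    "('k::field \<Rightarrow> 'v::ab_group_add \<Rightarrow> 'v) \<Rightarrow> 'v set \<Rightarrow> 'v set \<Rightarrow> 'v set \<Rightarrow> bool" where
  "quotient_basis scale U W B \<longleftrightarrow>
     finite B \<and> B \<subseteq> W \<and>
     (\<forall>c. (\<Sum>b\<in>B. scale (c b) b) \<in> U \<longrightarrow> (\<forall>b\<in>B. c b = 0)) \<and>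
     (\<forall>w\<in>W. \<exists>c. w - (\<Sum>b\<in>B. scale (c b) b) \<in> U)"

definition quotient_dim :: "('k::field \<Rightarrow> 'v::ab_group_add \<Rightarrow> 'v) \<Rightarrow> 'v set \<Rightarrow> 'v set \<Rightarrow> nat" where
  "quotient_dim scale U W = (THE k. \<exists>B. quotient_basis scale U W B \<and> card B = k)"

context vector_space
begin

lemma quotient_basis_card:
  assumes U: "subspace U" and W: "subspace W" and UW: "U \<subseteq> W"
    and S: "finite S" "W \<subseteq> span S" and B: "quotient_basis scale U W B"
  shows "card B + dim U = dim W"
proof -
  have fB: "finite B" and BW: "B \<subseteq> W"
    and ind: "\<And>c. (\<Sum>b\<in>B. scale (c b) b) \<in> U \<Longrightarrow> \<forall>b\<in>B. c b = 0"
    and spn: "\<And>w. w \<in> W \<Longrightarrow> \<exists>c. w - (\<Sum>b\<in>B. scale (c b) b) \<in> U"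
    using B by (auto simp: quotient_basis_def)
  obtain A where A: "A \<subseteq> U" "independent A" "U \<subseteq> span A" "card A = dim U"
    by (rule basis_exists[of U])
  have spA: "span A = U"
    using A U span_minimal by blast
  have fA: "finite A"
    using independent_span_bound[OF S(1) A(2)] A(1) UW S(2) by blast
  have disj: "A \<inter> B = {}"
  proof (rule ccontr)
    assume "A \<inter> B \<noteq> {}"
    then obtain x where x: "x \<in> A" "x \<in> B" by blast
    have "(\<Sum>b\<in>B. scale (if b = x then 1 else 0) b) = x"
      using fB x by (simp add: if_distrib[of "\<lambda>t. scale t _"] cong: if_cong)
    then have "(if x = x then 1 else 0) = (0::'a)"
      using ind[of "\<lambda>b. if b = x then 1 else 0"] x(2) subsetD[OF A(1) x(1)] by metis
    then show False by simp
  qed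
  have indAB: "independent (A \<union> B)"
  proof (subst independent_explicit_finite_subsets, intro allI impI ballI)
    fix C c v
    assume C: "C \<subseteq> A \<union> B" "finite C" and s: "(\<Sum>v\<in>C. scale (c v) v) = 0" and v: "v \<in> C"
    define e where "e v = (if v \<in> C then c v else 0)" for v
    have "(\<Sum>v\<in>A \<union> B. scale (e v) v) = (\<Sum>v\<in>C. scale (c v) v)"
      by (rule sum.mono_neutral_cong_right) (use C fA fB in \<open>auto simp: e_def\<close>)
    then have z: "(\<Sum>v\<in>A. scale (e v) v) + (\<Sum>v\<in>B. scale (e v) v) = 0"
      using s fA fB disj by (simp add: sum.union_disjoint)
    have inA: "(\<Sum>v\<in>A. scale (e v) v) \<in> U"
      using A(1) U by (auto intro!: subspace_sum subspace_scale)
    have "(\<Sum>v\<in>B. scale (e v) v) = - (\<Sum>v\<in>A. scale (e v) v)"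
      using z by (simp add: add_eq_0_iff)
    then have eB: "\<forall>b\<in>B. e b = 0"
      using ind[of e] inA U by (simp add: subspace_neg)
    then have "(\<Sum>v\<in>A. scale (e v) v) = 0"
      using z by simp
    then have "\<forall>a\<in>A. e a = 0"
      using A(2) fA independent_explicit_finite_subsets[of A] by blast
    with eB have "e v = 0" using v C by auto
    then show "c v = 0" using v by (simp add: e_def)
  qed
  have "W \<subseteq> span (A \<union> B)"
  proof
    fix w assume "w \<in> W"
    then obtain c where c: "w - (\<Sum>b\<in>B. scale (c b) b) \<in> U"
      using spn by blast
    then have "w - (\<Sum>b\<in>B. scale (c b) b) \<in> span (A \<union> B)"
      using spA span_mono[of A "A \<union> B"] by blast
    moreover have "(\<Sum>b\<in>B. scale (c b) b) \<in> span (A \<union> B)"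
      by (intro span_sum span_scale span_base) simp
    ultimately have "w - (\<Sum>b\<in>B. scale (c b) b) + (\<Sum>b\<in>B. scale (c b) b) \<in> span (A \<union> B)"
      by (rule span_add)
    then show "w \<in> span (A \<union> B)" by simp
  qed
  then have "dim W = card (A \<union> B)"
    using indAB A(1) UW BW by (intro dim_unique) auto
  then show ?thesis
    using fA fB disj A(4) by (simp add: card_Un_disjoint)
qed

lemma quotient_basis_exists:
  assumes U: "subspace U" and W: "subspace W" and UW: "U \<subseteq> W"
    and S: "finite S" "W \<subseteq> span S"
  shows "\<exists>B. quotient_basis scale U W B"
proof -
  obtain A where A: "A \<subseteq> U" "independent A" "U \<subseteq> span A" "card A = dim U"
    by (rule basis_exists[of U])
  have spA: "span A = U"
    using A U span_minimal by blast
  obtain C where C: "A \<subseteq> C" "C \<subseteq> W" "independent C" "W \<subseteq> span C"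
    using maximal_independent_subset_extend[of A W] A UW by blast
  have fC: "finite C"
    using independent_span_bound[OF S(1) C(3)] C(2) S(2) by blast
  have fA: "finite A" using fC C(1) finite_subset by blast
  have "quotient_basis scale U W (C - A)"
    unfolding quotient_basis_def
  proof (intro conjI allI impI ballI)
    show "finite (C - A)" "C - A \<subseteq> W" using fC C by auto
  next
    fix c b assume "(\<Sum>b\<in>C - A. scale (c b) b) \<in> U" and b: "b \<in> C - A"
    then have "(\<Sum>b\<in>C - A. scale (c b) b) \<in> span A" by (simp add: spA)
    then obtain a where a: "(\<Sum>b\<in>C - A. scale (c b) b) = (\<Sum>v\<in>A. scale (a v) v)"
      using span_finite[OF fA] by auto
    define e where "e v = (if v \<in> A then - a v else c v)" for v
    have "(\<Sum>v\<in>C. scale (e v) v)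
        = (\<Sum>v\<in>C - A. scale (e v) v) + (\<Sum>v\<in>A. scale (e v) v)"
      by (rule sum.subset_diff[OF C(1) fC])
    also have "(\<Sum>v\<in>C - A. scale (e v) v) = (\<Sum>v\<in>C - A. scale (c v) v)"
      by (rule sum.cong) (auto simp: e_def)
    also have "(\<Sum>v\<in>A. scale (e v) v) = - (\<Sum>v\<in>A. scale (a v) v)"
      by (simp add: e_def sum_negf)
    finally have "(\<Sum>v\<in>C. scale (e v) v) = 0" using a by simp
    then have "e b = 0"
      using C(3) fC b independent_explicit_finite_subsets[of C] by blast
    then show "c b = 0" using b by (simp add: e_def)
  next
    fix w assume "w \<in> W"
    then obtain a where a: "w = (\<Sum>v\<in>C. scale (a v) v)"
      using C(4) span_finite[OF fC] by auto
    have "w = (\<Sum>v\<in>C - A. scale (a v) v) + (\<Sum>v\<in>A. scale (a v) v)"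
      unfolding a by (rule sum.subset_diff[OF C(1) fC])
    moreover have "(\<Sum>v\<in>A. scale (a v) v) \<in> U"
      using A(1) U by (auto intro!: subspace_sum subspace_scale)
    ultimately show "\<exists>c. w - (\<Sum>b\<in>C - A. scale (c b) b) \<in> U"
      by (intro exI[of _ a]) simp
  qed
  then show ?thesis by blast
qed

lemma quotient_dim_add_dim:
  assumes "subspace U" "subspace W" "U \<subseteq> W" "finite S" "W \<subseteq> span S"
  shows "quotient_dim scale U W + dim U = dim W"
proof -
  obtain B where B: "quotient_basis scale U W B"
    using quotient_basis_exists[OF assms] by blast
  have "quotient_dim scale U W = card B"
    unfolding quotient_dim_def
  proof (rule the_equality)
    show "\<exists>B'. quotient_basis scale U W B' \<and> card B' = card B" using B by blast
  next
    fix k assume "\<exists>B'. quotient_basis scale U W B' \<and> card B' = k"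
    then show "k = card B"
      using quotient_basis_card[OF assms] B by (metis add_right_cancel)
  qed
  then show ?thesis using quotient_basis_card[OF assms B] by simp
qed

end


section \<open>Polynomials in finitely many variables\<close>

text \<open>
  A monomial is a finitely supported exponent function, a polynomial a finitely supported
  coefficient function on monomials, with the convolution product of
  \<^theory>\<open>HOL-Library.Poly_Mapping\<close>. The type allows infinitely many variables;
  \<open>K[x\<^sub>1,\<dots>,x\<^sub>n]\<close> is the subring \<open>polys n\<close> of polynomials involving only the variables
  with index in \<open>{1..n}\<close>.
\<close>

type_synonym 'i monomial = "'i \<Rightarrow>\<^sub>0 nat"
type_synonym ('i, 'k) mpoly = "'i monomial \<Rightarrow>\<^sub>0 'k"

definition smult_poly :: "'k::field \<Rightarrow> ('i, 'k) mpoly \<Rightarrow> ('i, 'k) mpoly" where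
  "smult_poly c p = Poly_Mapping.map ((*) c) p"

global_interpretation poly_vs: vector_space "smult_poly :: 'k::field \<Rightarrow> ('i, 'k) mpoly \<Rightarrow> _"
  unfolding smult_poly_def mult_map_scale_conv_mult
  by unfold_locales
    (simp_all add: distrib_left distrib_right single_add mult_single flip: mult.assoc)

definition mon_deg :: "'i monomial \<Rightarrow> nat" where
  "mon_deg m = (\<Sum>i\<in>Poly_Mapping.keys m. Poly_Mapping.lookup m i)"

definition monomials :: "nat \<Rightarrow> nat \<Rightarrow> nat monomial set" where
  "monomials n t = {m. Poly_Mapping.keys m \<subseteq> {1..n} \<and> mon_deg m = t}"

definition polys :: "nat \<Rightarrow> (nat, 'k::field) mpoly set" where
  "polys n = {p. \<forall>m\<in>Poly_Mapping.keys p. Poly_Mapping.keys m \<subseteq> {1..n}}"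

text \<open>The graded component of degree \<open>t\<close>; it contains the zero polynomial.\<close>

definition forms :: "nat \<Rightarrow> nat \<Rightarrow> (nat, 'k::field) mpoly set" where
  "forms n t = {p. Poly_Mapping.keys p \<subseteq> monomials n t}"

definition ideal_gen :: "nat \<Rightarrow> nat \<Rightarrow> (nat \<Rightarrow> (nat, 'k::field) mpoly) \<Rightarrow> (nat, 'k) mpoly set" where
  "ideal_gen n r f = {\<Sum>i=1..r. g i * f i | g. \<forall>i\<in>{1..r}. g i \<in> polys n}"


section \<open>Algebraic independence and generic ideals\<close>

definition is_subfield :: "'k::field set \<Rightarrow> bool" where
  "is_subfield F \<longleftrightarrow>
     0 \<in> F \<and> 1 \<in> F \<and>
     (\<forall>x\<in>F. \<forall>y\<in>F. x + y \<in> F \<and> x * y \<in> F) \<and>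
     (\<forall>x\<in>F. - x \<in> F \<and> inverse x \<in> F)"

definition eval_poly :: "('i \<Rightarrow> 'k::field) \<Rightarrow> ('i, 'k) mpoly \<Rightarrow> 'k" where
  "eval_poly c P =
     (\<Sum>m\<in>Poly_Mapping.keys P.
        Poly_Mapping.lookup P m * (\<Prod>i\<in>Poly_Mapping.keys m. c i ^ Poly_Mapping.lookup m i))"

text \<open>
  Algebraic independence over \<open>F\<close> of the family \<open>(c i)\<close>, \<open>i \<in> S\<close>: as a family, so in
  particular without repetitions. \<open>Poly_Mapping.range P\<close> is the set of nonzero
  coefficients of \<open>P\<close>.
\<close>

definition alg_independent :: "'k::field set \<Rightarrow> 'i set \<Rightarrow> ('i \<Rightarrow> 'k) \<Rightarrow> bool" where
  "alg_independent F S c \<longleftrightarrow>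
     (\<forall>P. Poly_Mapping.range P \<subseteq> F \<and> (\<forall>m\<in>Poly_Mapping.keys P. Poly_Mapping.keys m \<subseteq> S) \<and>
         eval_poly c P = 0
         \<longrightarrow> P = 0)"

definition generic_form :: "'k::field set \<Rightarrow> nat \<Rightarrow> nat \<Rightarrow> (nat, 'k) mpoly \<Rightarrow> bool" where
  "generic_form F n d f \<longleftrightarrow>
     f \<in> forms n d \<and> alg_independent F (monomials n d) (Poly_Mapping.lookup f)"

definition generic_homogeneous_ideal ::
    "'k::field set \<Rightarrow> nat \<Rightarrow> nat \<Rightarrow> (nat \<Rightarrow> nat) \<Rightarrow> (nat, 'k) mpoly set \<Rightarrow> bool" where
  "generic_homogeneous_ideal F n r d I \<longleftrightarrow>
     (\<exists>f. (\<forall>i\<in>{1..r}. generic_form F n (d i) (f i)) \<and>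
          alg_independent F (SIGMA i:{1..r}. monomials n (d i))
            (\<lambda>(i, m). Poly_Mapping.lookup (f i) m) \<and>
          I = ideal_gen n r f)"


section \<open>Hilbert series\<close>

definition hilbert_function :: "nat \<Rightarrow> (nat, 'k::field) mpoly set \<Rightarrow> nat \<Rightarrow> nat" where
  "hilbert_function n I t = quotient_dim smult_poly (I \<inter> forms n t) (forms n t)"

text \<open>
  The integer power series are embedded into \<open>rat fps\<close>, where division by \<open>(1 - z)\<^sup>n\<close> is available.
\<close>

definition hilbert_series :: "nat \<Rightarrow> (nat, 'k::field) mpoly set \<Rightarrow> rat fps" where
  "hilbert_series n I = Abs_fps (\<lambda>t. of_nat (hilbert_function n I t))"

definition fps_ceil :: "'a::linordered_idom fps \<Rightarrow> 'a fps" where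
  "fps_ceil a = Abs_fps (\<lambda>i. if \<forall>j\<le>i. fps_nth a j > 0 then fps_nth a i else 0)"

text \<open>
  For positive \<open>d j\<close> the subtraction below does not truncate.
\<close>

definition delta :: "(nat \<Rightarrow> nat) \<Rightarrow> nat \<Rightarrow> nat" where
  "delta d i = (\<Sum>j=1..i. d j) - i"

definition sigma :: "(nat \<Rightarrow> nat) \<Rightarrow> nat \<Rightarrow> nat" where
  "sigma d i = min (delta d (i - 1)) (delta d i div 2)"

lemma finite_monomials: "finite (monomials n t)"
proof -
  have "monomials n t \<subseteq> {m. Poly_Mapping.keys m \<subseteq> {1..n} \<and> (\<forall>i. Poly_Mapping.lookup m i \<le> t)}"
  proof
    fix m assume m: "m \<in> monomials n t"
    have "Poly_Mapping.lookup m i \<le> t" for i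
    proof (cases "i \<in> Poly_Mapping.keys m")
      case True
      then have "Poly_Mapping.lookup m i \<le> mon_deg m"
        unfolding mon_deg_def by (intro member_le_sum) auto
      then show ?thesis using m by (simp add: monomials_def)
    qed (simp add: in_keys_iff)
    with m show "m \<in> {m. Poly_Mapping.keys m \<subseteq> {1..n} \<and> (\<forall>i. Poly_Mapping.lookup m i \<le> t)}"
      by (auto simp: monomials_def)
  qed
  moreover have "finite {m :: nat monomial. Poly_Mapping.keys m \<subseteq> {1..n} \<and> (\<forall>i. Poly_Mapping.lookup m i \<le> t)}"
  proof (rule finite_imageD)
    let ?M = "{m :: nat monomial. Poly_Mapping.keys m \<subseteq> {1..n} \<and> (\<forall>i. Poly_Mapping.lookup m i \<le> t)}"
    have "Poly_Mapping.lookup ` ?M \<subseteq> {h. \<forall>i. (i \<in> {1..n} \<longrightarrow> h i \<in> {..t}) \<and> (i \<notin> {1..n} \<longrightarrow> h i = 0)}"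
      by (auto simp: in_keys_iff subset_iff)
    then show "finite (Poly_Mapping.lookup ` ?M)"
      by (rule finite_subset) (rule finite_set_of_finite_funs; simp)
    show "inj_on Poly_Mapping.lookup ?M"
      by (rule inj_onI) (simp only: poly_mapping_eq_iff)
  qed
  ultimately show ?thesis by (rule finite_subset)
qed

lemma lookup_smult_poly: "Poly_Mapping.lookup (smult_poly c p) m = c * Poly_Mapping.lookup p m"
  by (simp add: smult_poly_def map.rep_eq when_def)

lemma subspace_forms: "poly_vs.subspace (forms n t)"
  unfolding poly_vs.subspace_def
proof (intro conjI ballI allI)
  fix p q :: "(nat, 'k::field) mpoly" and c
  assume p: "p \<in> forms n t" and q: "q \<in> forms n t"
  show "p + q \<in> forms n t"
    using p q Poly_Mapping.keys_add[of p q] by (auto simp: forms_def)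
  show "smult_poly c p \<in> forms n t"
    using p by (auto simp: forms_def in_keys_iff lookup_smult_poly)
qed (simp add: forms_def)

lemma forms_span: "forms n t \<subseteq> poly_vs.span ((\<lambda>m. Poly_Mapping.single m 1) ` monomials n t)"
proof
  fix p :: "(nat, 'a) mpoly" assume p: "p \<in> forms n t"
  have "p = (\<Sum>m\<in>Poly_Mapping.keys p. smult_poly (Poly_Mapping.lookup p m) (Poly_Mapping.single m 1))"
    by (rule poly_mapping_eqI)
      (auto simp: lookup_sum lookup_smult_poly lookup_single when_def if_distrib in_keys_iff
        cong: if_cong)
  moreover have "\<dots> \<in> poly_vs.span ((\<lambda>m. Poly_Mapping.single m 1) ` monomials n t)"
    using p by (intro poly_vs.span_sum poly_vs.span_scale poly_vs.span_base) (auto simp: forms_def)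
  ultimately show "p \<in> poly_vs.span ((\<lambda>m. Poly_Mapping.single m 1) ` monomials n t)" by simp
qed

lemma hilbert_function_add_dim:
  fixes I :: "(nat, 'k::field) mpoly set"
  assumes "poly_vs.subspace I"
  shows "hilbert_function n I t + poly_vs.dim (I \<inter> forms n t)
    = poly_vs.dim (forms n t :: (nat, 'k) mpoly set)"
  unfolding hilbert_function_def
proof (rule poly_vs.quotient_dim_add_dim)
  show "poly_vs.subspace (I \<inter> forms n t)"
    by (intro poly_vs.subspace_inter assms subspace_forms)
  show "poly_vs.subspace (forms n t)"
    by (rule subspace_forms)
  show "forms n t \<subseteq> poly_vs.span ((\<lambda>m. Poly_Mapping.single m 1) ` monomials n t)"
    by (rule forms_span)
qed (auto intro: finite_monomials)

end

theory Submission
  imports Defs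
begin

text \<open>
  The dimension of a graded component of the ideal is semicontinuous in the coefficients, so the Hilbert function of
  generic forms is at most that of any forms of the same degrees over \<open>K\<close>; conversely, adding
  one form of degree \<open>e\<close> lowers the Hilbert function in degree \<open>t\<close> by at most its value in degree \<open>t - e\<close>.
  By induction on \<open>r\<close> it therefore suffices to find, for every single degree, a special example
  that attains the expected value.

  For \<open>r \<le> n\<close> powers of variables do. For \<open>r = n + 1\<close> take
  \<open>\<Prod>j<d\<^sub>k. (x\<^sub>k - c\<^sub>j x\<^sub>n)\<close> for \<open>k < n\<close>, whose common zeros form a grid; modulo these forms a polynomial is a
  function on the grid. Take further \<open>x\<^sub>n\<close> to the power \<open>d\<^sub>n\<^sub>+\<^sub>1\<close>, and a form \<open>\<phi>\<close> of
  degree \<open>d\<^sub>n\<close> that vanishes exactly at the grid points of degree below a suitable \<open>q\<close>. Polynomials of degree below \<open>q\<close>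
  interpolate on those points, and multiples of \<open>\<phi>\<close> interpolate on the complementary ones, whose reflection is again a
  set of points of bounded degree. This works in every characteristic and only needs
  \<open>d\<^sub>n + d\<^sub>n\<^sub>+\<^sub>1 \<ge> \<delta>\<^sub>n\<^sub>-\<^sub>1\<close>, which the hypotheses imply.
  For \<open>r = n + 2\<close> the last form has degree at least the largest degree in which the quotient
  by the first \<open>n + 1\<close> forms is nonzero, so it only has to avoid an ideal.
\<close>

section \<open>Monomials, forms and evaluation\<close>

text \<open>For \<open>r = n + 1\<close> the usual example, powers of the variables together with a
  power of their sum, relies on the strong Lefschetz property, which can fail in positive
  characteristic. On the grid a count replaces it. Let a and b be the degrees of \<phi> and of the
  power of x_n, and let s = \<open>delta d (n - 1)\<close> be the top degree of the grid. The box
  monomials of degree at most s - q, as multipliers of \<phi>, and those of degree below q, as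
  multipliers of the power of x_n, are together exactly as many as the grid points. As they give all
  functions on the grid, they give a basis of them. In degree t the multiples are therefore
  independent if t - a \<le> s - q and t - b \<le> q - 1, and they give everything if both
  inequalities are reversed. For each t one of these pairs can be met by a choice of q; the change
  occurs at 2t + 1 = s + a + b. A form that vanishes on all points of degree below q is built from
  products of q linear factors, so q \<le> a is required, and this is where s \<le> a + b
  enters.\<close>

lemma mon_deg_superset:
  assumes "finite A" "Poly_Mapping.keys m \<subseteq> A"
  shows "mon_deg m = (\<Sum>i\<in>A. Poly_Mapping.lookup m i)"
  unfolding mon_deg_def
  by (rule sum.mono_neutral_left) (use assms in \<open>auto simp: in_keys_iff\<close>)

lemma mon_deg_zero [simp]: "mon_deg 0 = 0"
  by (simp add: mon_deg_def)

lemma mon_deg_single [simp]: "mon_deg (Poly_Mapping.single k e) = e"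
  by (simp add: mon_deg_def)

lemma mon_deg_add [simp]: "mon_deg (m + m') = mon_deg m + mon_deg m'"
proof -
  let ?A = "Poly_Mapping.keys m \<union> Poly_Mapping.keys m'"
  have "mon_deg (m + m') = (\<Sum>i\<in>?A. Poly_Mapping.lookup (m + m') i)"
    using Poly_Mapping.keys_add[of m m'] by (intro mon_deg_superset) auto
  also have "\<dots> = mon_deg m + mon_deg m'"
    by (simp add: lookup_add sum.distrib mon_deg_superset[of ?A])
  finally show ?thesis .
qed

text \<open>Natural exponents cannot cancel, so the general inclusion of supports becomes an
  equality.\<close>

lemma keys_add_nat:
  fixes m m' :: "'i \<Rightarrow>\<^sub>0 nat"
  shows "Poly_Mapping.keys (m + m') = Poly_Mapping.keys m \<union> Poly_Mapping.keys m'"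
  by (auto simp: in_keys_iff lookup_add)

lemma monomials_add: "m \<in> monomials n s \<Longrightarrow> m' \<in> monomials n t \<Longrightarrow> m + m' \<in> monomials n (s + t)"
  by (auto simp: monomials_def keys_add_nat)

lemma poly_mapping_decompose:
  "p = (\<Sum>m\<in>Poly_Mapping.keys p. Poly_Mapping.single m (Poly_Mapping.lookup p m))"
  by (rule poly_mapping_eqI)
    (auto simp: lookup_sum lookup_single when_def in_keys_iff cong: if_cong)

lemma smult_poly_times: "smult_poly c p = Poly_Mapping.single 0 c * p"
  by (simp add: smult_poly_def mult_map_scale_conv_mult)

lemma smult_poly_single [simp]: "smult_poly c (Poly_Mapping.single m a) = Poly_Mapping.single m (c * a)"
  by (simp add: smult_poly_times mult_single)

lemma smult_poly_mult_right: "p * smult_poly c q = smult_poly c (p * q)"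
  by (simp add: smult_poly_times algebra_simps)

lemma smult_poly_mult_left: "smult_poly c p * q = smult_poly c (p * q)"
  by (simp add: smult_poly_times algebra_simps)

lemma forms_0 [simp]: "0 \<in> forms n t"
  by (simp add: forms_def)

lemma forms_add: "p \<in> forms n t \<Longrightarrow> q \<in> forms n t \<Longrightarrow> p + q \<in> forms n t"
  using poly_vs.subspace_add[OF subspace_forms] .

lemma forms_smult: "p \<in> forms n t \<Longrightarrow> smult_poly c p \<in> forms n t"
  using poly_vs.subspace_scale[OF subspace_forms] .

lemma forms_diff: "p \<in> forms n t \<Longrightarrow> q \<in> forms n t \<Longrightarrow> p - q \<in> forms n t"
  using poly_vs.subspace_diff[OF subspace_forms] .

lemma forms_single: "m \<in> monomials n t \<Longrightarrow> Poly_Mapping.single m c \<in> forms n t"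
  by (auto simp: forms_def)

lemma forms_mult:
  assumes "p \<in> forms n s" "q \<in> forms n t"
  shows "p * q \<in> forms n (s + t)"
proof -
  have "Poly_Mapping.keys (p * q) \<subseteq> {a + b |a b. a \<in> Poly_Mapping.keys p \<and> b \<in> Poly_Mapping.keys q}"
    by (rule keys_mult)
  then show ?thesis
    using assms unfolding forms_def by (blast intro: monomials_add)
qed

lemma forms_1 [simp]: "1 \<in> forms n 0"
  by (simp add: forms_def monomials_def)

lemma forms_power: "p \<in> forms n s \<Longrightarrow> p ^ k \<in> forms n (k * s)"
  by (induction k) (auto intro: forms_mult)

lemma forms_mult_monomial:
  "m \<in> monomials n s \<Longrightarrow> q \<in> forms n t \<Longrightarrow> Poly_Mapping.single m c * q \<in> forms n (s + t)"
  by (intro forms_mult forms_single)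

lemma forms_subset_polys: "forms n t \<subseteq> polys n"
  by (auto simp: forms_def polys_def monomials_def)

lemma polys_add: "p \<in> polys n \<Longrightarrow> q \<in> polys n \<Longrightarrow> p + q \<in> polys n"
  using Poly_Mapping.keys_add[of p q] by (auto simp: polys_def)

lemma polys_smult: "p \<in> polys n \<Longrightarrow> smult_poly c p \<in> polys n"
  by (auto simp: polys_def in_keys_iff lookup_smult_poly)

lemma polys_0: "0 \<in> polys n"
  by (simp add: polys_def)

section \<open>Variables and evaluation at a point\<close>

definition var :: "nat \<Rightarrow> (nat, 'k::field) mpoly" where
  "var k = Poly_Mapping.single (Poly_Mapping.single k 1) 1"

lemma var_in_forms: "k \<in> {1..n} \<Longrightarrow> var k \<in> forms n 1"
  unfolding var_def by (intro forms_single) (simp add: monomials_def)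

lemma var_power: "var k ^ e = Poly_Mapping.single (Poly_Mapping.single k e) 1"
  by (induction e) (simp_all add: var_def mult_single flip: single_add)

definition mon_val :: "('i \<Rightarrow> 'k::field) \<Rightarrow> 'i monomial \<Rightarrow> 'k" where
  "mon_val c m = (\<Prod>i\<in>Poly_Mapping.keys m. c i ^ Poly_Mapping.lookup m i)"

lemma mon_val_superset:
  assumes "finite A" "Poly_Mapping.keys m \<subseteq> A"
  shows "mon_val c m = (\<Prod>i\<in>A. c i ^ Poly_Mapping.lookup m i)"
  unfolding mon_val_def
  by (rule prod.mono_neutral_left) (use assms in \<open>auto simp: in_keys_iff\<close>)

lemma mon_val_add: "mon_val c (m + m') = mon_val c m * mon_val c m'"
proof -
  let ?A = "Poly_Mapping.keys m \<union> Poly_Mapping.keys m'"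
  have "mon_val c (m + m') = (\<Prod>i\<in>?A. c i ^ Poly_Mapping.lookup (m + m') i)"
    by (intro mon_val_superset) (auto simp: keys_add_nat)
  also have "\<dots> = mon_val c m * mon_val c m'"
    by (simp add: lookup_add power_add prod.distrib mon_val_superset[of ?A])
  finally show ?thesis .
qed

lemma eval_poly_superset:
  assumes "finite A" "Poly_Mapping.keys p \<subseteq> A"
  shows "eval_poly c p = (\<Sum>m\<in>A. Poly_Mapping.lookup p m * mon_val c m)"
  unfolding eval_poly_def mon_val_def
  by (rule sum.mono_neutral_left) (use assms in \<open>auto simp: in_keys_iff\<close>)

lemma eval_poly_single [simp]: "eval_poly c (Poly_Mapping.single m a) = a * mon_val c m"
  by (cases "a = 0") (simp_all add: eval_poly_def mon_val_def)

lemma eval_poly_add: "eval_poly c (p + q) = eval_poly c p + eval_poly c q"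
proof -
  let ?A = "Poly_Mapping.keys p \<union> Poly_Mapping.keys q"
  have "eval_poly c (p + q) = (\<Sum>m\<in>?A. Poly_Mapping.lookup (p + q) m * mon_val c m)"
    using Poly_Mapping.keys_add[of p q] by (intro eval_poly_superset) auto
  also have "\<dots> = eval_poly c p + eval_poly c q"
    by (simp add: lookup_add distrib_right sum.distrib eval_poly_superset[of ?A])
  finally show ?thesis .
qed

lemma eval_poly_0 [simp]: "eval_poly c 0 = 0"
  by (simp add: eval_poly_def)

lemma eval_poly_1 [simp]: "eval_poly c 1 = 1"
  by (simp add: eval_poly_def)

lemma eval_poly_sum: "eval_poly c (sum f A) = (\<Sum>x\<in>A. eval_poly c (f x))"
  by (induction A rule: infinite_finite_induct) (simp_all add: eval_poly_add)

lemma eval_poly_mult: "eval_poly c (p * q) = eval_poly c p * eval_poly c q"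
proof -
  let ?t = "\<lambda>p m. Poly_Mapping.single m (Poly_Mapping.lookup p m)"
  have "p * q = (\<Sum>m\<in>Poly_Mapping.keys p. ?t p m) * (\<Sum>m\<in>Poly_Mapping.keys q. ?t q m)"
    by (simp flip: poly_mapping_decompose)
  also have "\<dots> = (\<Sum>m\<in>Poly_Mapping.keys p. \<Sum>m'\<in>Poly_Mapping.keys q. ?t p m * ?t q m')"
    by (simp add: sum_product)
  finally have "eval_poly c (p * q) =
      (\<Sum>m\<in>Poly_Mapping.keys p. \<Sum>m'\<in>Poly_Mapping.keys q. eval_poly c (?t p m) * eval_poly c (?t q m'))"
    by (simp add: eval_poly_sum mult_single mon_val_add mult_ac)
  also have "\<dots> = (\<Sum>m\<in>Poly_Mapping.keys p. eval_poly c (?t p m)) * (\<Sum>m\<in>Poly_Mapping.keys q. eval_poly c (?t q m))"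
    by (simp only: sum_product)
  also have "\<dots> = eval_poly c p * eval_poly c q"
    by (simp only: flip: eval_poly_sum poly_mapping_decompose)
  finally show ?thesis .
qed

lemma eval_poly_smult: "eval_poly c (smult_poly a p) = a * eval_poly c p"
  by (simp add: smult_poly_times eval_poly_mult mon_val_def)

lemma eval_poly_uminus: "eval_poly c (- p) = - eval_poly c p"
  using eval_poly_add[of c p "- p"] by (simp add: eq_neg_iff_add_eq_0 add.commute)

lemma eval_poly_diff: "eval_poly c (p - q) = eval_poly c p - eval_poly c q"
  using eval_poly_add[of c p "- q"] by (simp add: eval_poly_uminus)

lemma eval_poly_prod: "eval_poly c (prod f A) = (\<Prod>x\<in>A. eval_poly c (f x))"
  by (induction A rule: infinite_finite_induct) (simp_all add: eval_poly_mult)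

lemma eval_poly_power: "eval_poly c (p ^ k) = eval_poly c p ^ k"
  by (induction k) (simp_all add: eval_poly_mult)

lemma eval_poly_var [simp]: "eval_poly c (var k) = c k"
  by (simp add: var_def mon_val_def)

text \<open>With \<open>lookup_single_times_not_add\<close> this shows that a coefficient of a
  monomial multiple of \<open>f\<close> is, up to the scalar \<open>c\<close>, a coefficient of
  \<open>f\<close> or zero. Semicontinuity needs these coefficients to be polynomial in those of the
  generators.\<close>

lemma lookup_single_times_add:
  fixes f :: "('i, 'k::field) mpoly"
  shows "Poly_Mapping.lookup (Poly_Mapping.single a c * f) (a + y) = c * Poly_Mapping.lookup f y"
proof -
  have "Poly_Mapping.single a c * f
      = (\<Sum>m\<in>Poly_Mapping.keys f. Poly_Mapping.single (a + m) (c * Poly_Mapping.lookup f m))"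
    by (subst (1) poly_mapping_decompose[of f]) (simp add: sum_distrib_left mult_single)
  then show ?thesis
    by (auto simp: lookup_sum lookup_single when_def in_keys_iff cong: if_cong)
qed

lemma lookup_single_times_not_add:
  fixes f :: "('i, 'k::field) mpoly"
  assumes "\<And>y. x \<noteq> a + y"
  shows "Poly_Mapping.lookup (Poly_Mapping.single a c * f) x = 0"
proof -
  have "Poly_Mapping.keys (Poly_Mapping.single a c * f) \<subseteq> {u + v |u v. u \<in> Poly_Mapping.keys (Poly_Mapping.single a c) \<and> v \<in> Poly_Mapping.keys f}"
    by (rule keys_mult)
  then have "x \<notin> Poly_Mapping.keys (Poly_Mapping.single a c * f)"
    using assms by (auto split: if_splits)
  then show ?thesis by (simp add: in_keys_iff)
qed

section \<open>Specialization of generic coefficients\<close>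

context vector_space
begin

text \<open>Families replace sets because the products to be counted are not known to be distinct. A
  repeated vector would give a relation with coefficients 1 and -1, so independence of the family
  makes the indexing injective.\<close>

lemma family_card_le_dim:
  assumes J: "finite J" and S: "finite S" "V \<subseteq> span S"
    and v: "\<And>j. j \<in> J \<Longrightarrow> v j \<in> V"
    and ind: "\<And>a. (\<Sum>j\<in>J. scale (a j) (v j)) = 0 \<Longrightarrow> \<forall>j\<in>J. a j = 0"
  shows "card J \<le> dim V"
proof -
  have inj: "inj_on v J"
  proof (rule inj_onI, rule ccontr)
    fix i j assume ij: "i \<in> J" "j \<in> J" "v i = v j" "i \<noteq> j"
    define a where "a k = (if k = i then 1 else if k = j then -1 else 0 :: 'a)" for k
    have "(\<Sum>k\<in>J. scale (a k) (v k)) = (\<Sum>k\<in>{i, j}. scale (a k) (v k))"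
      by (rule sum.mono_neutral_right) (use J ij in \<open>auto simp: a_def\<close>)
    also have "\<dots> = 0" using ij by (simp add: a_def)
    finally have "a i = 0" using ind ij by blast
    then show False by (simp add: a_def)
  qed
  have "independent (v ` J)"
  proof (rule independent_if_scalars_zero)
    fix f x assume s: "(\<Sum>x\<in>v ` J. scale (f x) x) = 0" and x: "x \<in> v ` J"
    have "(\<Sum>j\<in>J. scale (f (v j)) (v j)) = 0"
      using s by (simp add: sum.reindex[OF inj])
    then show "f x = 0" using ind[of "\<lambda>j. f (v j)"] x by auto
  qed (use J in simp)
  moreover obtain B where B: "B \<subseteq> V" "independent B" "V \<subseteq> span B" "card B = dim V"
    by (rule basis_exists[of V])
  moreover have "finite B"
    using independent_span_bound[OF S(1) B(2)] B(1) S(2) by blast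
  ultimately have "card (v ` J) \<le> dim V"
    using independent_span_bound[of B "v ` J"] v by (metis image_subset_iff subset_trans)
  then show ?thesis by (simp add: card_image[OF inj])
qed

text \<open>Keeping the indices of a basis, rather than the basis, allows the same selection to be
  used after the generators have been exchanged.\<close>

lemma independent_subfamily_exists:
  assumes J: "finite J" and V: "V = span (v ` J)"
  obtains J0 where "J0 \<subseteq> J" "card J0 = dim V"
    "\<forall>a. (\<Sum>j\<in>J0. scale (a j) (v j)) = 0 \<longrightarrow> (\<forall>j\<in>J0. a j = 0)"
proof -
  obtain B where B: "B \<subseteq> v ` J" "independent B" "v ` J \<subseteq> span B"
    using maximal_independent_subset[of "v ` J"] by blast
  obtain J0 where J0: "J0 \<subseteq> J" "inj_on v J0" "B = v ` J0"
    using B(1) by (meson subset_image_inj)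
  have fin: "finite J0" using J0(1) J finite_subset by blast
  have "V \<subseteq> span B" using span_minimal[OF B(3) subspace_span] V by simp
  moreover have "B \<subseteq> V" using B(1) V span_superset by blast
  ultimately have "card B = dim V" using B(2) basis_card_eq_dim by blast
  then have c: "card J0 = dim V" using J0 by (simp add: card_image)
  have "\<forall>j\<in>J0. a j = 0" if s: "(\<Sum>j\<in>J0. scale (a j) (v j)) = 0" for a
  proof -
    have "(\<Sum>x\<in>B. scale (a (the_inv_into J0 v x)) x) = 0"
      using s unfolding J0(3) by (simp add: sum.reindex[OF J0(2)] the_inv_into_f_f[OF J0(2)])
    moreover have "finite B" using fin J0(3) by simp
    ultimately have "\<forall>x\<in>B. a (the_inv_into J0 v x) = 0"
      using B(2)[unfolded independent_explicit_finite_subsets] by (metis order_refl)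
    then show ?thesis using J0 by (auto simp: the_inv_into_f_f)
  qed
  with J0(1) c show thesis using that by blast
qed

lemma finite_spanned_subset_basis:
  assumes "finite S" "V \<subseteq> span S"
  obtains B where "finite B" "B \<subseteq> V" "independent B" "V \<subseteq> span B" "card B = dim V"
proof -
  obtain B where B: "B \<subseteq> V" "independent B" "V \<subseteq> span B" "card B = dim V"
    by (rule basis_exists[of V])
  moreover have "finite B"
    using independent_span_bound[OF assms(1) B(2)] B(1) assms(2) by blast
  ultimately show thesis using that by blast
qed

end

text \<open>
  Gaussian elimination without division: every pivot is again an admissible function of the
  parameter, so pivots that are nonzero at \<open>c\<^sub>0\<close> stay nonzero at \<open>c\<^sub>1\<close>.
\<close>

lemma independent_transfer:
  fixes v :: "'j \<Rightarrow> 'x \<Rightarrow> 'c \<Rightarrow> 'k::field"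
  assumes "finite J"
    and mult: "\<And>p q. p \<in> P \<Longrightarrow> q \<in> P \<Longrightarrow> (\<lambda>c. p c * q c) \<in> P"
    and diff: "\<And>p q. p \<in> P \<Longrightarrow> q \<in> P \<Longrightarrow> (\<lambda>c. p c - q c) \<in> P"
    and nz: "\<And>p. p \<in> P \<Longrightarrow> p c\<^sub>0 \<noteq> 0 \<Longrightarrow> p c\<^sub>1 \<noteq> 0"
    and "\<And>j x. j \<in> J \<Longrightarrow> v j x \<in> P"
    and "\<And>a. (\<forall>x. (\<Sum>j\<in>J. a j * v j x c\<^sub>0) = 0) \<Longrightarrow> \<forall>j\<in>J. a j = 0"
    and "\<forall>x. (\<Sum>j\<in>J. a j * v j x c\<^sub>1) = 0"
  shows "\<forall>j\<in>J. a j = 0"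
  using assms(1,5-)
proof (induction J arbitrary: v a rule: finite_induct)
  case (insert i J v a)
  have "\<exists>x\<^sub>0. v i x\<^sub>0 c\<^sub>0 \<noteq> 0"
  proof (rule ccontr)
    assume "\<not> ?thesis"
    then have "\<forall>x. (\<Sum>j\<in>insert i J. (if j = i then 1 else 0) * v j x c\<^sub>0) = 0"
      using insert.hyps by (simp add: if_distrib[of "\<lambda>t. t * _"] cong: if_cong)
    then have "(if i = i then 1 else 0) = (0::'k)"
      using insert.prems(2)[of "\<lambda>j. if j = i then 1 else 0"] by blast
    then show False by simp
  qed
  then obtain x\<^sub>0 where x0: "v i x\<^sub>0 c\<^sub>0 \<noteq> 0" by blast
  \<comment> \<open>Cross-multiplication with the pivot \<open>v i x\<^sub>0\<close> clears the
    coordinate \<open>x\<^sub>0\<close> from every remaining vector; without division the entries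
    stay in \<open>P\<close>.\<close>
  define w where "w j x c = v i x\<^sub>0 c * v j x c - v j x\<^sub>0 c * v i x c" for j x c
  have wP: "w j x \<in> P" if "j \<in> J" for j x
    unfolding w_def using that by (intro diff mult insert.prems(1)) auto
  have w_sum: "(\<Sum>j\<in>J. b j * w j x c) =
      v i x\<^sub>0 c * (\<Sum>j\<in>J. b j * v j x c) - (\<Sum>j\<in>J. b j * v j x\<^sub>0 c) * v i x c" for b x c
    by (simp add: w_def sum_subtractf sum_distrib_left sum_distrib_right algebra_simps)
  have aJ: "\<forall>j\<in>J. a j = 0"
  proof (rule insert.IH)
    show "w j x \<in> P" if "j \<in> J" for j x using wP that .
  next
    fix b assume b: "\<forall>x. (\<Sum>j\<in>J. b j * w j x c\<^sub>0) = 0"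
    \<comment> \<open>Rewrites a relation among the \<open>w j\<close> at \<open>c\<^sub>0\<close>
      as one among the \<open>v j\<close>; the coefficient at \<open>i\<close> collects the terms
      subtracted in \<open>w\<close>. As the pivot is nonzero, \<open>e = 0\<close> gives
      \<open>b = 0\<close>.\<close>
    define e where "e j = (if j = i then - (\<Sum>j\<in>J. b j * v j x\<^sub>0 c\<^sub>0) else v i x\<^sub>0 c\<^sub>0 * b j)" for j
    have "(\<Sum>j\<in>insert i J. e j * v j x c\<^sub>0) = (\<Sum>j\<in>J. b j * w j x c\<^sub>0)" for x
    proof -
      have "(\<Sum>j\<in>J. e j * v j x c\<^sub>0) = v i x\<^sub>0 c\<^sub>0 * (\<Sum>j\<in>J. b j * v j x c\<^sub>0)"
        unfolding sum_distrib_left by (rule sum.cong) (use insert.hyps in \<open>auto simp: e_def\<close>)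
      then show ?thesis using insert.hyps by (simp add: w_sum e_def)
    qed
    then have "\<forall>j\<in>insert i J. e j = 0" using insert.prems(2) b by simp
    then show "\<forall>j\<in>J. b j = 0"
      using x0 insert.hyps by (auto simp: e_def split: if_splits)
  next
    have s: "(\<Sum>j\<in>J. a j * v j x c\<^sub>1) = - a i * v i x c\<^sub>1" for x
      using insert.prems(3) insert.hyps by (simp add: eq_neg_iff_add_eq_0 add.commute)
    show "\<forall>x. (\<Sum>j\<in>J. a j * w j x c\<^sub>1) = 0"
      by (simp add: w_sum s)
  qed
  have "v i x\<^sub>0 c\<^sub>1 \<noteq> 0" using nz[OF insert.prems(1) x0] by simp
  moreover have "a i * v i x\<^sub>0 c\<^sub>1 = 0"
    using insert.prems(3)[rule_format, of x\<^sub>0] aJ insert.hyps by simp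
  ultimately show ?case using aJ by simp
qed simp

text \<open>The polynomials over which \<open>alg_independent\<close> quantifies. For a subfield
  \<open>F\<close> they are closed under differences and products, as the elimination
  requires.\<close>

definition polynomials_over :: "'k::field set \<Rightarrow> 'i set \<Rightarrow> ('i, 'k) mpoly set" where
  "polynomials_over F S =
     {P. Poly_Mapping.range P \<subseteq> F \<and> (\<forall>m\<in>Poly_Mapping.keys P. Poly_Mapping.keys m \<subseteq> S)}"

context
  fixes F :: "'k::field set"
  assumes F: "is_subfield F"
begin

lemma subfield_closed:
  "0 \<in> F" "1 \<in> F" "x \<in> F \<Longrightarrow> y \<in> F \<Longrightarrow> x + y \<in> F" "x \<in> F \<Longrightarrow> y \<in> F \<Longrightarrow> x * y \<in> F" "x \<in> F \<Longrightarrow> - x \<in> F"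
  using F unfolding is_subfield_def by (elim conjE; assumption | blast)+

lemma polynomials_over_iff:
  "P \<in> polynomials_over F S \<longleftrightarrow>
     (\<forall>m. Poly_Mapping.lookup P m \<in> F) \<and> (\<forall>m\<in>Poly_Mapping.keys P. Poly_Mapping.keys m \<subseteq> S)"
proof -
  have "Poly_Mapping.range P \<subseteq> F \<longleftrightarrow> (\<forall>m. Poly_Mapping.lookup P m \<in> F)"
  proof
    assume a: "Poly_Mapping.range P \<subseteq> F"
    show "\<forall>m. Poly_Mapping.lookup P m \<in> F"
    proof
      fix m show "Poly_Mapping.lookup P m \<in> F"
      proof (cases "m \<in> Poly_Mapping.keys P")
        case True
        show ?thesis by (rule subsetD[OF a in_keys_lookup_in_range[OF True]])
      next
        case False then show ?thesis by (simp add: in_keys_iff subfield_closed)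
      qed
    qed
  next
    assume "\<forall>m. Poly_Mapping.lookup P m \<in> F"
    then show "Poly_Mapping.range P \<subseteq> F"
      by (auto simp: range.rep_eq)
  qed
  then show ?thesis unfolding polynomials_over_def by simp
qed

lemma polynomials_over_0: "0 \<in> polynomials_over F S"
  by (simp add: polynomials_over_iff subfield_closed)

lemma polynomials_over_add:
  assumes "P \<in> polynomials_over F S" "Q \<in> polynomials_over F S"
  shows "P + Q \<in> polynomials_over F S"
proof -
  have "\<forall>m. Poly_Mapping.lookup (P + Q) m \<in> F"
    using assms by (simp add: polynomials_over_iff subfield_closed lookup_add)
  moreover have "\<forall>m\<in>Poly_Mapping.keys (P + Q). Poly_Mapping.keys m \<subseteq> S"
    using assms Poly_Mapping.keys_add[of P Q] unfolding polynomials_over_iff by blast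
  ultimately show ?thesis by (simp add: polynomials_over_iff)
qed

lemma polynomials_over_diff:
  assumes "P \<in> polynomials_over F S" "Q \<in> polynomials_over F S"
  shows "P - Q \<in> polynomials_over F S"
proof -
  have "- Q \<in> polynomials_over F S"
    using assms by (simp add: polynomials_over_iff subfield_closed in_keys_iff)
  then show ?thesis using polynomials_over_add[OF assms(1)] by fastforce
qed

lemma polynomials_over_sum:
  "(\<And>x. x \<in> A \<Longrightarrow> f x \<in> polynomials_over F S) \<Longrightarrow> sum f A \<in> polynomials_over F S"
  by (induction A rule: infinite_finite_induct) (auto intro: polynomials_over_0 polynomials_over_add)

lemma polynomials_over_single:
  "c \<in> F \<Longrightarrow> Poly_Mapping.keys m \<subseteq> S \<Longrightarrow> Poly_Mapping.single m c \<in> polynomials_over F S"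
  by (auto simp: polynomials_over_iff subfield_closed lookup_single when_def)

lemma polynomials_over_mult:
  assumes "P \<in> polynomials_over F S" "Q \<in> polynomials_over F S"
  shows "P * Q \<in> polynomials_over F S"
proof -
  let ?t = "\<lambda>p m. Poly_Mapping.single m (Poly_Mapping.lookup p m)"
  have "P * Q = (\<Sum>m\<in>Poly_Mapping.keys P. ?t P m) * (\<Sum>m\<in>Poly_Mapping.keys Q. ?t Q m)"
    by (simp flip: poly_mapping_decompose)
  also have "\<dots> = (\<Sum>m\<in>Poly_Mapping.keys P. \<Sum>m'\<in>Poly_Mapping.keys Q. 
      Poly_Mapping.single (m + m') (Poly_Mapping.lookup P m * Poly_Mapping.lookup Q m'))"
    by (simp add: sum_product mult_single)
  also have "\<dots> \<in> polynomials_over F S"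
  proof (intro polynomials_over_sum polynomials_over_single subfield_closed(4))
    fix m m' assume "m \<in> Poly_Mapping.keys P" "m' \<in> Poly_Mapping.keys Q"
    then show "Poly_Mapping.keys (m + m') \<subseteq> S"
      using assms Poly_Mapping.keys_add[of m m'] unfolding polynomials_over_iff by blast
  qed (use assms in \<open>simp_all add: polynomials_over_iff\<close>)
  finally show ?thesis .
qed

text \<open>A polynomial over \<open>F\<close> with a nonzero value somewhere is nonzero, so it
  cannot vanish at the algebraically independent \<open>c\<^sub>1\<close>; this is the pivot
  condition of \<open>independent_transfer\<close>. The special point \<open>c\<^sub>0\<close> may
  take any values in the field, not just in \<open>F\<close>.\<close>

lemma independent_at_generic_point:
  fixes v :: "'j \<Rightarrow> 'x \<Rightarrow> ('i, 'k) mpoly"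
  assumes "finite J" and c1: "alg_independent F S c\<^sub>1"
    and v: "\<And>j x. j \<in> J \<Longrightarrow> v j x \<in> polynomials_over F S"
    and ind: "\<And>a. (\<forall>x. (\<Sum>j\<in>J. a j * eval_poly c\<^sub>0 (v j x)) = 0) \<Longrightarrow> \<forall>j\<in>J. a j = 0"
    and zero: "\<forall>x. (\<Sum>j\<in>J. a j * eval_poly c\<^sub>1 (v j x)) = 0"
  shows "\<forall>j\<in>J. a j = 0"
proof (rule independent_transfer[where v = "\<lambda>j x c. eval_poly c (v j x)" and c\<^sub>0 = c\<^sub>0 and c\<^sub>1 = c\<^sub>1
      and P = "{\<lambda>c. eval_poly c P |P. P \<in> polynomials_over F S}"])
  fix p q assume "p \<in> {\<lambda>c. eval_poly c P |P. P \<in> polynomials_over F S}"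
    "q \<in> {\<lambda>c. eval_poly c P |P. P \<in> polynomials_over F S}"
  then obtain P Q where PQ: "p = (\<lambda>c. eval_poly c P)" "q = (\<lambda>c. eval_poly c Q)"
    "P \<in> polynomials_over F S" "Q \<in> polynomials_over F S" by blast
  show "(\<lambda>c. p c * q c) \<in> {\<lambda>c. eval_poly c P |P. P \<in> polynomials_over F S}"
    using PQ polynomials_over_mult[of P S Q] by (auto simp flip: eval_poly_mult)
  show "(\<lambda>c. p c - q c) \<in> {\<lambda>c. eval_poly c P |P. P \<in> polynomials_over F S}"
    using PQ polynomials_over_diff[of P S Q] by (auto simp flip: eval_poly_diff)
next
  fix p assume "p \<in> {\<lambda>c. eval_poly c P |P. P \<in> polynomials_over F S}" "p c\<^sub>0 \<noteq> 0"
  then show "p c\<^sub>1 \<noteq> 0"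
    using c1 unfolding alg_independent_def polynomials_over_def by auto
qed (use assms in auto)

end

section \<open>Graded components of ideals\<close>

lemma ideal_gen_subspace: "poly_vs.subspace (ideal_gen n r f)"
  unfolding poly_vs.subspace_def
proof (intro conjI ballI allI)
  show "0 \<in> ideal_gen n r f"
    unfolding ideal_gen_def by (rule CollectI, rule exI[of _ "\<lambda>_. 0"]) (simp add: polys_0)
next
  fix p q assume "p \<in> ideal_gen n r f" "q \<in> ideal_gen n r f"
  then obtain g h where g: "p = (\<Sum>i=1..r. g i * f i)" "\<forall>i\<in>{1..r}. g i \<in> polys n"
    and h: "q = (\<Sum>i=1..r. h i * f i)" "\<forall>i\<in>{1..r}. h i \<in> polys n"
    unfolding ideal_gen_def by blast
  show "p + q \<in> ideal_gen n r f"
    unfolding ideal_gen_def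
    by (rule CollectI, rule exI[of _ "\<lambda>i. g i + h i"])
      (use g h in \<open>auto simp: sum.distrib distrib_right intro: polys_add\<close>)
next
  fix c p assume "p \<in> ideal_gen n r f"
  then obtain g where g: "p = (\<Sum>i=1..r. g i * f i)" "\<forall>i\<in>{1..r}. g i \<in> polys n"
    unfolding ideal_gen_def by blast
  show "smult_poly c p \<in> ideal_gen n r f"
    unfolding ideal_gen_def
    by (rule CollectI, rule exI[of _ "\<lambda>i. smult_poly c (g i)"])
      (use g in \<open>auto simp: poly_vs.scale_sum_right smult_poly_mult_left intro: polys_smult\<close>)
qed

lemma ideal_gen_mult:
  assumes "g \<in> polys n" "i \<in> {1..r}"
  shows "g * f i \<in> ideal_gen n r f"
proof -
  have "(\<Sum>j=1..r. (if j = i then g else 0) * f j) = g * f i"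
    using assms by (simp add: if_distrib[of "\<lambda>t. t * _"] cong: if_cong)
  then show ?thesis
    unfolding ideal_gen_def using assms polys_0
    by (intro CollectI exI[of _ "\<lambda>j. if j = i then g else 0"]) auto
qed

lemma ideal_gen_mono:
  assumes "r \<le> r'"
  shows "ideal_gen n r f \<subseteq> ideal_gen n r' f"
proof
  fix p assume "p \<in> ideal_gen n r f"
  then obtain g where g: "p = (\<Sum>i=1..r. g i * f i)" "\<forall>i\<in>{1..r}. g i \<in> polys n"
    unfolding ideal_gen_def by blast
  show "p \<in> ideal_gen n r' f" unfolding g(1)
    by (rule poly_vs.subspace_sum[OF ideal_gen_subspace]) (use g assms in \<open>auto intro: ideal_gen_mult\<close>)
qed

lemma ideal_gen_cong: "(\<And>i. i \<in> {1..r} \<Longrightarrow> f i = g i) \<Longrightarrow> ideal_gen n r f = ideal_gen n r g"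
  unfolding ideal_gen_def by (intro Collect_cong ex_cong1 conj_cong) (auto intro: sum.cong)

definition hom_comp :: "nat \<Rightarrow> ('i, 'k::field) mpoly \<Rightarrow> ('i, 'k) mpoly" where
  "hom_comp t p = Poly_Mapping.mapp (\<lambda>m c. c when mon_deg m = t) p"

lemma lookup_hom_comp: "Poly_Mapping.lookup (hom_comp t p) m = (if mon_deg m = t then Poly_Mapping.lookup p m else 0)"
  by (auto simp: hom_comp_def lookup_mapp when_def in_keys_iff)

lemma hom_comp_forms: "p \<in> forms n s \<Longrightarrow> hom_comp t p = (if s = t then p else 0)"
  by (rule poly_mapping_eqI) (auto simp: lookup_hom_comp forms_def monomials_def in_keys_iff)

lemma hom_comp_sum: "hom_comp t (sum f A) = (\<Sum>x\<in>A. hom_comp t (f x))"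
  by (rule poly_mapping_eqI) (simp add: lookup_hom_comp lookup_sum)

text \<open>Indices of the monomial multiples of the generators in degree \<open>t\<close>. The
  bound \<open>d i \<le> t\<close> keeps the natural subtraction from admitting constant multiples
  of generators of too large degree.\<close>

definition gen_index :: "nat \<Rightarrow> nat \<Rightarrow> (nat \<Rightarrow> nat) \<Rightarrow> nat \<Rightarrow> (nat \<times> nat monomial) set" where
  "gen_index n r d t = (SIGMA i:{i\<in>{1..r}. d i \<le> t}. monomials n (t - d i))"

definition gen_product :: "(nat \<Rightarrow> (nat, 'k::field) mpoly) \<Rightarrow> nat \<times> nat monomial \<Rightarrow> (nat, 'k) mpoly" where
  "gen_product f = (\<lambda>(i, m). Poly_Mapping.single m 1 * f i)"

lemma finite_gen_index: "finite (gen_index n r d t)"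
  unfolding gen_index_def by (intro finite_SigmaI finite_monomials) auto

text \<open>The multipliers in \<open>ideal_gen\<close> need not be homogeneous. Splitting them into
  monomials makes every summand homogeneous, and only the summands of degree \<open>t\<close>
  survive when the form is projected to its own degree.\<close>

lemma ideal_forms_eq_span:
  assumes f: "\<And>i. i \<in> {1..r} \<Longrightarrow> f i \<in> forms n (d i)"
  shows "ideal_gen n r f \<inter> forms n t = poly_vs.span (gen_product f ` gen_index n r d t)"
proof
  show "poly_vs.span (gen_product f ` gen_index n r d t) \<subseteq> ideal_gen n r f \<inter> forms n t"
  proof (rule poly_vs.span_minimal)
    show "poly_vs.subspace (ideal_gen n r f \<inter> forms n t)"
      by (intro poly_vs.subspace_inter ideal_gen_subspace subspace_forms)
    show "gen_product f ` gen_index n r d t \<subseteq> ideal_gen n r f \<inter> forms n t"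
    proof
      fix p assume "p \<in> gen_product f ` gen_index n r d t"
      then obtain i m where im: "i \<in> {1..r}" "d i \<le> t" "m \<in> monomials n (t - d i)"
        "p = Poly_Mapping.single m 1 * f i"
        unfolding gen_index_def gen_product_def by auto
      have "p \<in> forms n (t - d i + d i)"
        unfolding im(4) by (intro forms_mult_monomial im f)
      moreover have "p \<in> ideal_gen n r f"
        unfolding im(4) using forms_single[OF im(3)] forms_subset_polys
        by (intro ideal_gen_mult im) blast
      ultimately show "p \<in> ideal_gen n r f \<inter> forms n t" using im(2) by simp
    qed
  qed
next
  show "ideal_gen n r f \<inter> forms n t \<subseteq> poly_vs.span (gen_product f ` gen_index n r d t)"
  proof
    fix p assume p: "p \<in> ideal_gen n r f \<inter> forms n t"
    then obtain g where g: "p = (\<Sum>i=1..r. g i * f i)" "\<forall>i\<in>{1..r}. g i \<in> polys n"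
      unfolding ideal_gen_def by blast
    let ?q = "\<lambda>i m. Poly_Mapping.single m (Poly_Mapping.lookup (g i) m) * f i"
    have "p = (\<Sum>i=1..r. \<Sum>m\<in>Poly_Mapping.keys (g i). ?q i m)"
      unfolding g(1) by (simp flip: poly_mapping_decompose sum_distrib_right)
    then have "hom_comp t p = (\<Sum>i=1..r. \<Sum>m\<in>Poly_Mapping.keys (g i). hom_comp t (?q i m))"
      by (simp only: hom_comp_sum)
    moreover have "hom_comp t p = p" using p hom_comp_forms[of p n t t] by simp
    ultimately have p_eq: "p = (\<Sum>i=1..r. \<Sum>m\<in>Poly_Mapping.keys (g i). hom_comp t (?q i m))"
      by simp
    have "hom_comp t (?q i m) \<in> poly_vs.span (gen_product f ` gen_index n r d t)"
      if i: "i \<in> {1..r}" and m: "m \<in> Poly_Mapping.keys (g i)" for i m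
    proof -
      have mm: "m \<in> monomials n (mon_deg m)"
        using g(2) i m by (auto simp: polys_def monomials_def)
      then have q: "?q i m \<in> forms n (mon_deg m + d i)"
        by (intro forms_mult_monomial f i)
      show ?thesis
      proof (cases "mon_deg m + d i = t")
        case True
        then have "(i, m) \<in> gen_index n r d t"
          using mm i by (auto simp: gen_index_def)
        moreover have "?q i m = smult_poly (Poly_Mapping.lookup (g i) m) (gen_product f (i, m))"
          by (simp add: gen_product_def flip: smult_poly_mult_left)
        ultimately have "?q i m \<in> poly_vs.span (gen_product f ` gen_index n r d t)"
          by (metis imageI poly_vs.span_base poly_vs.span_scale)
        then show ?thesis
          using hom_comp_forms[OF q, of t] True by simp
      next
        case False
        then show ?thesis using hom_comp_forms[OF q, of t] by (simp add: poly_vs.span_zero)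
      qed
    qed
    then show "p \<in> poly_vs.span (gen_product f ` gen_index n r d t)"
      unfolding p_eq by (intro poly_vs.span_sum)
  qed
qed

lemma ideal_forms_finite_span:
  obtains S :: "(nat, 'k::field) mpoly set" where "finite S" "V \<inter> forms n t \<subseteq> poly_vs.span S"
proof
  show "finite ((\<lambda>m. Poly_Mapping.single m (1::'k)) ` monomials n t)"
    using finite_monomials by blast
qed (use forms_span in blast)

lemma hilbert_function_le_iff:
  fixes f g :: "nat \<Rightarrow> (nat, 'k::field) mpoly"
  shows
  "hilbert_function n (ideal_gen n r f) t \<le> hilbert_function n (ideal_gen n s g) t \<longleftrightarrow>
   poly_vs.dim (ideal_gen n s g \<inter> forms n t) \<le> poly_vs.dim (ideal_gen n r f \<inter> forms n t)"
  using hilbert_function_add_dim[OF ideal_gen_subspace[of n r f], of n t]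
    hilbert_function_add_dim[OF ideal_gen_subspace[of n s g], of n t] by linarith

text \<open>In degree \<open>t\<close> the ideal of \<open>g\<close> has a basis among the monomial
  multiples of its generators. The multiples of \<open>f\<close> with the same indices are
  independent, by transfer from the coefficients of \<open>g\<close> to the generic ones of
  \<open>f\<close>, so the ideal of \<open>f\<close> is at least as large.\<close>

lemma hilbert_function_generic_le:
  fixes f g :: "nat \<Rightarrow> (nat, 'k::field) mpoly"
  assumes F: "is_subfield F"
    and f: "\<And>i. i \<in> {1..r} \<Longrightarrow> f i \<in> forms n (d i)"
    and indep: "alg_independent F (SIGMA i:{1..r}. monomials n (d i)) (\<lambda>(i, m). Poly_Mapping.lookup (f i) m)"
    and g: "\<And>i. i \<in> {1..r} \<Longrightarrow> g i \<in> forms n (d i)"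
  shows "hilbert_function n (ideal_gen n r f) t \<le> hilbert_function n (ideal_gen n r g) t"
proof -
  let ?S = "SIGMA i:{1..r}. monomials n (d i)"
  let ?c = "\<lambda>h (i, m). Poly_Mapping.lookup (h i) m :: 'k"
  \<comment> \<open>\<open>v (i, m) x\<close> is the coefficient at \<open>x\<close> of
    \<open>m\<close> times the i-th generator, as a polynomial in the indeterminate coefficients: a
    single variable if \<open>m\<close> divides \<open>x\<close> and the quotient is a monomial of
    degree \<open>d i\<close>, and zero otherwise.\<close>
  define v :: "nat \<times> nat monomial \<Rightarrow> nat monomial \<Rightarrow> (nat \<times> nat monomial, 'k) mpoly"
    where "v = (\<lambda>(i, m) x. if \<exists>y. x = m + y \<and> (i, y) \<in> ?S
      then Poly_Mapping.single (Poly_Mapping.single (i, x - m) 1) 1 else 0)"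
  have v_eval: "eval_poly (?c h) (v j x) = Poly_Mapping.lookup (gen_product h j) x"
    if h: "\<And>i. i \<in> {1..r} \<Longrightarrow> h i \<in> forms n (d i)" and j: "j \<in> gen_index n r d t" for h j x
  proof -
    obtain i m where im: "j = (i, m)" "i \<in> {1..r}"
      using j by (auto simp: gen_index_def)
    show ?thesis
    proof (cases "\<exists>y. x = m + y")
      case True
      then obtain y where y: "x = m + y" by blast
      have "Poly_Mapping.lookup (gen_product h j) x = Poly_Mapping.lookup (h i) y"
        by (simp add: im gen_product_def y lookup_single_times_add)
      moreover have "Poly_Mapping.lookup (h i) y = 0" if "y \<notin> monomials n (d i)"
        using h[OF im(2)] that by (auto simp: forms_def in_keys_iff)
      ultimately show ?thesis using im by (auto simp: v_def y mon_val_def)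
    next
      case False
      then show ?thesis by (auto simp: v_def im gen_product_def lookup_single_times_not_add)
    qed
  qed
  have sum_eval: "Poly_Mapping.lookup (\<Sum>j\<in>J. smult_poly (a j) (gen_product h j)) x
      = (\<Sum>j\<in>J. a j * eval_poly (?c h) (v j x))"
    if "\<And>i. i \<in> {1..r} \<Longrightarrow> h i \<in> forms n (d i)" "J \<subseteq> gen_index n r d t" for h J a x
    unfolding lookup_sum lookup_smult_poly using v_eval[OF that(1)] that(2)
    by (intro sum.cong refl arg_cong[where f = "\<lambda>z. _ * z"]) (metis subsetD)
  have vP: "v j x \<in> polynomials_over F ?S" for j x
    by (auto simp: v_def subfield_closed[OF F] split: prod.splits
        intro!: polynomials_over_single[OF F] polynomials_over_0[OF F])
  have span_g: "ideal_gen n r g \<inter> forms n t = poly_vs.span (gen_product g ` gen_index n r d t)"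
    using g by (rule ideal_forms_eq_span)
  obtain J where J: "J \<subseteq> gen_index n r d t" "card J = poly_vs.dim (ideal_gen n r g \<inter> forms n t)"
    and ind: "\<forall>a. (\<Sum>j\<in>J. smult_poly (a j) (gen_product g j)) = 0 \<longrightarrow> (\<forall>j\<in>J. a j = 0)"
    by (rule poly_vs.independent_subfamily_exists[OF finite_gen_index span_g])
  have fJ: "finite J" using J(1) finite_gen_index finite_subset by blast
  obtain S :: "(nat, 'k) mpoly set" where S: "finite S" "ideal_gen n r f \<inter> forms n t \<subseteq> poly_vs.span S"
    by (rule ideal_forms_finite_span)
  have "card J \<le> poly_vs.dim (ideal_gen n r f \<inter> forms n t)"
  proof (rule poly_vs.family_card_le_dim[OF fJ S])
    fix j assume "j \<in> J"
    then show "gen_product f j \<in> ideal_gen n r f \<inter> forms n t"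
      using ideal_forms_eq_span[of r f n d t, OF f] J(1) by (metis imageI poly_vs.span_base subsetD)
  next
    fix a assume a: "(\<Sum>j\<in>J. smult_poly (a j) (gen_product f j)) = 0"
    show "\<forall>j\<in>J. a j = 0"
    proof (rule independent_at_generic_point[OF F fJ indep vP])
      fix b assume "\<forall>x. (\<Sum>j\<in>J. b j * eval_poly (?c g) (v j x)) = 0"
      then have "(\<Sum>j\<in>J. smult_poly (b j) (gen_product g j)) = 0"
        by (intro poly_mapping_eqI) (subst sum_eval[OF g J(1)]; simp)
      then show "\<forall>j\<in>J. b j = 0" by (rule ind[THEN spec, THEN mp])
    next
      show "\<forall>x. (\<Sum>j\<in>J. a j * eval_poly (?c f) (v j x)) = 0"
        by (subst sum_eval[OF f J(1), symmetric]) (simp_all add: a)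
    qed
  qed
  then show ?thesis by (simp add: hilbert_function_le_iff J(2))
qed

section \<open>Bounds for the Hilbert function\<close>

context vector_space
begin

lemma dim_Suc_le:
  assumes U: "subspace U" "U \<subseteq> V" and S: "finite S" "V \<subseteq> span S" and p: "p \<in> V" "p \<notin> U"
  shows "dim U + 1 \<le> dim V"
proof -
  obtain B where B: "finite B" "B \<subseteq> U" "independent B" "U \<subseteq> span B" "card B = dim U"
    using finite_spanned_subset_basis[of S U] U(2) S by blast
  obtain C where C: "finite C" "C \<subseteq> V" "independent C" "V \<subseteq> span C" "card C = dim V"
    using finite_spanned_subset_basis[OF S] .
  have "span B = U" using B U(1) span_minimal by blast
  then have "independent (insert p B)"
    using p B(3) by (intro independent_insertI) auto
  then have "card (insert p B) \<le> card C"
    using independent_span_bound[OF C(1), of "insert p B"] C(4) p(1) B(2) U(2) by blast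
  moreover have "p \<notin> B" using p(2) B(2) by blast
  ultimately show ?thesis using B(1,5) C(5) by simp
qed

end

lemma hilbert_function_le_card:
  fixes f :: "nat \<Rightarrow> (nat, 'k::field) mpoly"
  assumes "finite T" "forms n t \<subseteq> poly_vs.span (T \<union> (ideal_gen n r f \<inter> forms n t))"
  shows "hilbert_function n (ideal_gen n r f) t \<le> card T"
proof -
  let ?I = "ideal_gen n r f \<inter> forms n t"
  obtain S :: "(nat, 'k) mpoly set" where S: "finite S" "?I \<subseteq> poly_vs.span S"
    by (rule ideal_forms_finite_span)
  obtain B where B: "finite B" "?I \<subseteq> poly_vs.span B" "card B = poly_vs.dim ?I"
    by (rule poly_vs.finite_spanned_subset_basis[OF S])
  have "T \<union> ?I \<subseteq> poly_vs.span (T \<union> B)"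
    using B(2) poly_vs.span_superset[of "T \<union> B"] poly_vs.span_mono[of B "T \<union> B"] by blast
  then have "forms n t \<subseteq> poly_vs.span (T \<union> B)"
    using assms(2) poly_vs.span_minimal[of "T \<union> ?I" "poly_vs.span (T \<union> B)"] by simp
  then have "poly_vs.dim (forms n t :: (nat, 'k) mpoly set) \<le> card (T \<union> B)"
    using assms(1) B(1) by (intro poly_vs.dim_le_card) auto
  also have "\<dots> \<le> card T + poly_vs.dim ?I"
    using B(3) card_Un_le[of T B] by simp
  finally show ?thesis
    using hilbert_function_add_dim[OF ideal_gen_subspace[of n r f], of n t] by linarith
qed

lemma hilbert_function_eq_0_iff:
  fixes f :: "nat \<Rightarrow> (nat, 'k::field) mpoly"
  shows "hilbert_function n (ideal_gen n r f) t = 0 \<longleftrightarrow> forms n t \<subseteq> ideal_gen n r f"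
proof
  assume h: "hilbert_function n (ideal_gen n r f) t = 0"
  show "forms n t \<subseteq> ideal_gen n r f"
  proof (rule ccontr)
    assume "\<not> ?thesis"
    then obtain p where p: "p \<in> forms n t" "p \<notin> ideal_gen n r f" by blast
    obtain S :: "(nat, 'k) mpoly set" where S: "finite S" "UNIV \<inter> forms n t \<subseteq> poly_vs.span S"
      by (rule ideal_forms_finite_span)
    have "poly_vs.dim (ideal_gen n r f \<inter> forms n t) + 1 \<le> poly_vs.dim (forms n t :: (nat, 'k) mpoly set)"
      by (rule poly_vs.dim_Suc_le[OF _ _ S(1), where p = p])
        (use S p in \<open>auto intro!: poly_vs.subspace_inter ideal_gen_subspace subspace_forms\<close>)
    then show False
      using hilbert_function_add_dim[OF ideal_gen_subspace[of n r f], of n t] h by linarith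
  qed
next
  assume "forms n t \<subseteq> ideal_gen n r f"
  then have "ideal_gen n r f \<inter> forms n t = forms n t" by blast
  then show "hilbert_function n (ideal_gen n r f) t = 0"
    using hilbert_function_add_dim[OF ideal_gen_subspace[of n r f], of n t] by simp
qed

lemma forms_subset_spanI:
  assumes "\<And>m. m \<in> monomials n t \<Longrightarrow> Poly_Mapping.single m 1 \<in> poly_vs.span A"
  shows "forms n t \<subseteq> poly_vs.span A"
  using assms by (intro subset_trans[OF forms_span] poly_vs.span_minimal) auto

lemma forms_subset_subspaceI:
  assumes "poly_vs.subspace V" "\<And>m. m \<in> monomials n t \<Longrightarrow> Poly_Mapping.single m 1 \<in> V"
  shows "forms n t \<subseteq> V"
  using assms by (intro subset_trans[OF forms_span] poly_vs.span_minimal) auto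

lemma polys_mult:
  assumes "p \<in> polys n" "q \<in> polys n"
  shows "p * q \<in> polys n"
proof -
  have "Poly_Mapping.keys m \<subseteq> {1..n}" if m: "m \<in> Poly_Mapping.keys (p * q)" for m
  proof -
    obtain a b where "m = a + b" "a \<in> Poly_Mapping.keys p" "b \<in> Poly_Mapping.keys q"
      using keys_mult[of p q] m by blast
    then show ?thesis using assms by (auto simp: polys_def keys_add_nat)
  qed
  then show ?thesis by (simp add: polys_def)
qed

lemma ideal_gen_mult_closed:
  assumes "q \<in> polys n" "p \<in> ideal_gen n r f"
  shows "q * p \<in> ideal_gen n r f"
proof -
  obtain g where g: "p = (\<Sum>i=1..r. g i * f i)" "\<forall>i\<in>{1..r}. g i \<in> polys n"
    using assms(2) unfolding ideal_gen_def by blast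
  have "q * p = (\<Sum>i=1..r. (q * g i) * f i)"
    by (simp add: g(1) sum_distrib_left mult.assoc)
  moreover have "\<forall>i\<in>{1..r}. q * g i \<in> polys n"
    using g(2) assms(1) by (simp add: polys_mult)
  ultimately show ?thesis
    unfolding ideal_gen_def by (intro CollectI exI[of _ "\<lambda>i. q * g i"]) simp
qed

lemma ideal_gen_mult_form: "g \<in> forms n s \<Longrightarrow> i \<in> {1..r} \<Longrightarrow> g * f i \<in> ideal_gen n r f"
  using forms_subset_polys by (intro ideal_gen_mult) auto

lemma monomials_shift:
  assumes "k \<in> {1..n}" "m \<in> monomials n t" "e \<le> Poly_Mapping.lookup m k"
  obtains m' where "m = m' + Poly_Mapping.single k e" "m' \<in> monomials n (t - e)" "e \<le> t"
proof -
  define m' where "m' = m - Poly_Mapping.single k e"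
  have m: "m = m' + Poly_Mapping.single k e"
    by (rule poly_mapping_eqI) (use assms(3) in \<open>auto simp: m'_def lookup_add lookup_minus lookup_single when_def\<close>)
  then have "m' \<in> monomials n (t - e)" "e \<le> t"
    using assms(2) by (auto simp: monomials_def keys_add_nat)
  with m show thesis using that by blast
qed

text \<open>A monomial of positive degree is a variable times a monomial of degree one less.\<close>

lemma hilbert_function_eq_0_Suc:
  fixes f :: "nat \<Rightarrow> (nat, 'k::field) mpoly"
  assumes "hilbert_function n (ideal_gen n r f) t = 0"
  shows "hilbert_function n (ideal_gen n r f) (Suc t) = 0"
  unfolding hilbert_function_eq_0_iff
proof (rule forms_subset_subspaceI[OF ideal_gen_subspace])
  fix m assume m: "m \<in> monomials n (Suc t)"
  then have "Poly_Mapping.keys m \<noteq> {}"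
    by (auto simp: monomials_def mon_deg_def)
  then obtain k where k: "k \<in> Poly_Mapping.keys m" by blast
  then have kn: "k \<in> {1..n}" using m by (auto simp: monomials_def)
  obtain m' where m': "m = m' + Poly_Mapping.single k 1" "m' \<in> monomials n (Suc t - 1)"
    by (rule monomials_shift[OF kn m, of 1]) (use k in \<open>auto simp: in_keys_iff\<close>)
  have "Poly_Mapping.single m' 1 \<in> ideal_gen n r f"
    using assms forms_single[OF m'(2)] unfolding hilbert_function_eq_0_iff by auto
  moreover have "(var k :: (nat, 'k) mpoly) \<in> polys n"
    using var_in_forms[OF kn] forms_subset_polys by blast
  moreover have "Poly_Mapping.single m 1 = (var k :: (nat, 'k) mpoly) * Poly_Mapping.single m' 1"
    by (simp add: m'(1) var_def mult_single add.commute)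
  ultimately show "Poly_Mapping.single m 1 \<in> ideal_gen n r f"
    by (simp add: ideal_gen_mult_closed)
qed

lemma hilbert_function_eq_0_mono:
  assumes "hilbert_function n (ideal_gen n r f) s = 0" "s \<le> t"
  shows "hilbert_function n (ideal_gen n r f) t = 0"
  using assms(2,1) by (induction rule: dec_induct) (simp_all add: hilbert_function_eq_0_Suc)

text \<open>A generator of degree above \<open>t\<close> has no monomial multiples in degree
  \<open>t\<close>.\<close>

lemma hilbert_function_Suc_low_degree:
  fixes f :: "nat \<Rightarrow> (nat, 'k::field) mpoly"
  assumes f: "\<And>i. i \<in> {1..Suc r} \<Longrightarrow> f i \<in> forms n (d i)" and t: "t < d (Suc r)"
  shows "hilbert_function n (ideal_gen n (Suc r) f) t = hilbert_function n (ideal_gen n r f) t"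
proof -
  have "gen_index n (Suc r) d t = gen_index n r d t"
    using t by (auto simp: gen_index_def le_Suc_eq)
  then have "ideal_gen n (Suc r) f \<inter> forms n t = ideal_gen n r f \<inter> forms n t"
    using ideal_forms_eq_span[of "Suc r" f n d t] ideal_forms_eq_span[of r f n d t] f by simp
  then show ?thesis
    unfolding hilbert_function_def by simp
qed

text \<open>Multiplication by the last generator maps degree \<open>t - d (Suc r)\<close> of the
  quotient by the first \<open>r\<close> generators onto the degree \<open>t\<close> part of the new
  ideal modulo the old one.\<close>

lemma hilbert_function_Suc_ge:
  fixes f :: "nat \<Rightarrow> (nat, 'k::field) mpoly"
  assumes f: "\<And>i. i \<in> {1..Suc r} \<Longrightarrow> f i \<in> forms n (d i)" and t: "d (Suc r) \<le> t"
  shows "hilbert_function n (ideal_gen n r f) t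
    \<le> hilbert_function n (ideal_gen n (Suc r) f) t + hilbert_function n (ideal_gen n r f) (t - d (Suc r))"
proof -
  let ?I = "\<lambda>r t. ideal_gen n r f \<inter> forms n t" and ?s = "t - d (Suc r)" and ?g = "f (Suc r)"
  have sub: "poly_vs.subspace (?I r t)" for r t
    by (intro poly_vs.subspace_inter ideal_gen_subspace subspace_forms)
  obtain S :: "(nat, 'k) mpoly set" where S: "finite S" "UNIV \<inter> forms n ?s \<subseteq> poly_vs.span S"
    by (rule ideal_forms_finite_span)
  have S': "?I r ?s \<subseteq> forms n ?s" "forms n ?s \<subseteq> poly_vs.span S" using S(2) by auto
  obtain B where B: "quotient_basis smult_poly (?I r ?s) (forms n ?s) B"
    using poly_vs.quotient_basis_exists[OF sub subspace_forms S'(1) S(1) S'(2)] by blast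
  have "card B + poly_vs.dim (?I r ?s) = poly_vs.dim (forms n ?s :: (nat, 'k) mpoly set)"
    by (rule poly_vs.quotient_basis_card[OF sub subspace_forms S'(1) S(1) S'(2) B])
  then have card_B: "card B = hilbert_function n (ideal_gen n r f) ?s"
    using hilbert_function_add_dim[OF ideal_gen_subspace[of n r f], of n ?s] by linarith
  obtain S1 where S1: "finite S1" "?I r t \<subseteq> poly_vs.span S1"
    by (rule ideal_forms_finite_span)
  obtain C where C: "finite C" "?I r t \<subseteq> poly_vs.span C" "card C = poly_vs.dim (?I r t)"
    by (rule poly_vs.finite_spanned_subset_basis[OF S1])
  let ?T = "C \<union> (\<lambda>b. b * ?g) ` B"
  have fB: "finite B" using B by (simp add: quotient_basis_def)
  have It: "?I r t \<subseteq> poly_vs.span ?T"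
    using C(2) poly_vs.span_mono[of C ?T] by blast
  have "gen_product f ` gen_index n (Suc r) d t \<subseteq> poly_vs.span ?T"
  proof
    fix p assume "p \<in> gen_product f ` gen_index n (Suc r) d t"
    then obtain i m where im: "(i, m) \<in> gen_index n (Suc r) d t" "p = gen_product f (i, m)"
      by auto
    show "p \<in> poly_vs.span ?T"
    proof (cases "i = Suc r")
      case False
      then have "(i, m) \<in> gen_index n r d t" using im(1) by (auto simp: gen_index_def)
      then have "p \<in> ?I r t"
        using ideal_forms_eq_span[of r f n d t] f im(2) by (simp add: poly_vs.span_base)
      then show ?thesis using It by blast
    next
      case True
      then have m: "m \<in> monomials n ?s" using im(1) by (auto simp: gen_index_def)
      \<comment> \<open>Modulo the old ideal the multiplier \<open>m\<close> is replaced by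
        representatives from \<open>B\<close>; the error times the last generator stays in the old
        ideal.\<close>
      then obtain c where c: "Poly_Mapping.single m 1 - (\<Sum>b\<in>B. smult_poly (c b) b) \<in> ?I r ?s"
        using B forms_single[OF m] unfolding quotient_basis_def by blast
      let ?u = "Poly_Mapping.single m 1 - (\<Sum>b\<in>B. smult_poly (c b) b)"
      have "?g \<in> forms n (d (Suc r))" using f by simp
      then have "?g * ?u \<in> ideal_gen n r f" "?u * ?g \<in> forms n (?s + d (Suc r))"
        using c forms_subset_polys by (blast intro: ideal_gen_mult_closed forms_mult)+
      then have "?u * ?g \<in> ?I r t" using t by (simp add: mult.commute)
      then have 1: "?u * ?g \<in> poly_vs.span ?T" using It by blast
      have 2: "(\<Sum>b\<in>B. smult_poly (c b) (b * ?g)) \<in> poly_vs.span ?T"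
        by (intro poly_vs.span_sum poly_vs.span_scale poly_vs.span_base) blast
      have "p = ?u * ?g + (\<Sum>b\<in>B. smult_poly (c b) (b * ?g))"
        using im(2) True by (simp add: gen_product_def left_diff_distrib sum_distrib_right smult_poly_mult_left)
      then show ?thesis using poly_vs.span_add[OF 1 2] by simp
    qed
  qed
  then have "?I (Suc r) t \<subseteq> poly_vs.span ?T"
    using ideal_forms_eq_span[of "Suc r" f n d t, OF f] poly_vs.span_minimal by blast
  then have "poly_vs.dim (?I (Suc r) t) \<le> card ?T"
    using C(1) fB by (intro poly_vs.dim_le_card) auto
  also have "\<dots> \<le> poly_vs.dim (?I r t) + card B"
    using card_Un_le[of C "(\<lambda>b. b * ?g) ` B"] card_image_le[OF fB, of "\<lambda>b. b * ?g"] C(3) by linarith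
  finally show ?thesis
    using hilbert_function_add_dim[OF ideal_gen_subspace[of n r f], of n t]
      hilbert_function_add_dim[OF ideal_gen_subspace[of n "Suc r" f], of n t] card_B by linarith
qed

section \<open>Counting reduced monomials\<close>

text \<open>The monomials outside the ideal of the powers x_k^(d k), k \<le> r.\<close>

definition reduced_monomials :: "nat \<Rightarrow> nat \<Rightarrow> (nat \<Rightarrow> nat) \<Rightarrow> nat \<Rightarrow> nat monomial set" where
  "reduced_monomials n r d t = {m \<in> monomials n t. \<forall>k\<in>{1..r}. Poly_Mapping.lookup m k < d k}"

lemma finite_reduced_monomials: "finite (reduced_monomials n r d t)"
  unfolding reduced_monomials_def using finite_monomials by simp

text \<open>Monomials with exponent at least \<open>d (Suc r)\<close> at the next variable are
  divided by that power. This is multiplication of the generating series by 1 - z^(d (Suc r)), read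
  off in degree \<open>t\<close>.\<close>

lemma reduced_monomials_split:
  assumes "Suc r \<le> n"
  shows "card (reduced_monomials n r d t) = card (reduced_monomials n (Suc r) d t)
    + (if d (Suc r) \<le> t then card (reduced_monomials n r d (t - d (Suc r))) else 0)"
proof -
  let ?k = "Suc r" and ?e = "d (Suc r)"
  let ?big = "{m \<in> reduced_monomials n r d t. ?e \<le> Poly_Mapping.lookup m ?k}"
  have "reduced_monomials n r d t = reduced_monomials n (Suc r) d t \<union> ?big"
    by (auto simp: reduced_monomials_def le_Suc_eq not_less)
  moreover have "reduced_monomials n (Suc r) d t \<inter> ?big = {}"
    by (auto simp: reduced_monomials_def dest!: bspec[of _ _ "Suc r"])
  ultimately have "card (reduced_monomials n r d t) = card (reduced_monomials n (Suc r) d t) + card ?big"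
    using finite_reduced_monomials[of n "Suc r" d t] finite_reduced_monomials[of n r d t]
    by (metis (lifting) card_Un_disjoint finite_Un)
  moreover have "card ?big = (if ?e \<le> t then card (reduced_monomials n r d (t - ?e)) else 0)"
  proof (cases "?e \<le> t")
    case True
    have "?big = (\<lambda>m. m + Poly_Mapping.single ?k ?e) ` reduced_monomials n r d (t - ?e)"
    proof (intro subset_antisym subsetI)
      fix m assume m: "m \<in> ?big"
      obtain m' where m': "m = m' + Poly_Mapping.single ?k ?e" "m' \<in> monomials n (t - ?e)"
        by (rule monomials_shift[of ?k n m t ?e]) (use assms m in \<open>auto simp: reduced_monomials_def\<close>)
      then show "m \<in> (\<lambda>m. m + Poly_Mapping.single ?k ?e) ` reduced_monomials n r d (t - ?e)"
        using m by (auto simp: reduced_monomials_def lookup_add lookup_single when_def)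
    next
      fix m assume "m \<in> (\<lambda>m. m + Poly_Mapping.single ?k ?e) ` reduced_monomials n r d (t - ?e)"
      then obtain m' where m': "m = m' + Poly_Mapping.single ?k ?e" "m' \<in> reduced_monomials n r d (t - ?e)"
        by blast
      then show "m \<in> ?big"
        using assms True by (auto simp: reduced_monomials_def monomials_def keys_add_nat lookup_add lookup_single when_def)
    qed
    then show ?thesis using True by (simp add: card_image)
  next
    case False
    have "?e \<le> t" if "m \<in> ?big" for m
      by (rule monomials_shift[of ?k n m t ?e]) (use assms that in \<open>auto simp: reduced_monomials_def\<close>)
    then have "?big = {}" using False by blast
    then show ?thesis using False by (metis (lifting) card.empty)
  qed
  ultimately show ?thesis by simp
qed

lemma monomials_Suc_split:
  "card (monomials (Suc n) t) = card (monomials n t) + (if 1 \<le> t then card (monomials (Suc n) (t - 1)) else 0)"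
proof -
  let ?k = "Suc n"
  let ?big = "{m \<in> monomials (Suc n) t. 1 \<le> Poly_Mapping.lookup m ?k}"
  have "monomials (Suc n) t = monomials n t \<union> ?big"
    by (auto simp: monomials_def subset_iff in_keys_iff le_Suc_eq not_less_eq_eq)
      (metis less_numeral_extra(3))
  moreover have "monomials n t \<inter> ?big = {}"
    by (auto simp: monomials_def subset_iff in_keys_iff) (metis Suc_le_eq Suc_n_not_le_n)
  ultimately have "card (monomials (Suc n) t) = card (monomials n t) + card ?big"
    using finite_monomials[of n t] finite_monomials[of "Suc n" t]
    by (metis (lifting) card_Un_disjoint finite_Un)
  moreover have "card ?big = (if 1 \<le> t then card (monomials (Suc n) (t - 1)) else 0)"
  proof (cases "1 \<le> t")
    case True
    have "?big = (\<lambda>m. m + Poly_Mapping.single ?k 1) ` monomials (Suc n) (t - 1)"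
    proof (intro subset_antisym subsetI)
      fix m assume m: "m \<in> ?big"
      obtain m' where "m = m' + Poly_Mapping.single ?k 1" "m' \<in> monomials (Suc n) (t - 1)"
        by (rule monomials_shift[of ?k "Suc n" m t 1]) (use m in auto)
      then show "m \<in> (\<lambda>m. m + Poly_Mapping.single ?k 1) ` monomials (Suc n) (t - 1)"
        by blast
    next
      fix m assume "m \<in> (\<lambda>m. m + Poly_Mapping.single ?k 1) ` monomials (Suc n) (t - 1)"
      then show "m \<in> ?big"
        using True by (auto simp: monomials_def keys_add_nat lookup_add)
    qed
    then show ?thesis using True by (simp add: card_image)
  next
    case False
    have "1 \<le> t" if "m \<in> ?big" for m
      by (rule monomials_shift[of ?k "Suc n" m t 1]) (use that in auto)
    then have "?big = {}" using False by blast
    then show ?thesis using False by (metis (lifting) card.empty)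
  qed
  ultimately show ?thesis by simp
qed

lemma fps_nth_mult_one_minus_X_power:
  fixes a :: "'a::comm_ring_1 fps"
  shows "fps_nth (a * (1 - fps_X ^ e)) t = fps_nth a t - (if e \<le> t then fps_nth a (t - e) else 0)"
  by (simp add: right_diff_distrib fps_X_power_mult_right_nth not_le)

lemma monomials_fps:
  "Abs_fps (\<lambda>t. of_nat (card (monomials n t)) :: rat) * (1 - fps_X) ^ n = 1"
proof (induction n)
  case 0
  have "monomials 0 t = (if t = 0 then {0} else {})" for t
    by (auto simp: monomials_def mon_deg_def)
  then have "Abs_fps (\<lambda>t. of_nat (card (monomials 0 t)) :: rat) = 1"
    by (intro fps_ext) (simp add: fps_one_nth)
  then show ?case by simp
next
  case (Suc n)
  have "Abs_fps (\<lambda>t. of_nat (card (monomials (Suc n) t)) :: rat) * (1 - fps_X ^ 1)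
      = Abs_fps (\<lambda>t. of_nat (card (monomials n t)))"
    by (rule fps_ext, subst fps_nth_mult_one_minus_X_power)
      (use monomials_Suc_split[of n] in auto)
  then show ?case using Suc by (simp flip: mult.assoc)
qed

definition froberg_series :: "nat \<Rightarrow> nat \<Rightarrow> (nat \<Rightarrow> nat) \<Rightarrow> rat fps" where
  "froberg_series n r d = (\<Prod>i=1..r. 1 - fps_X ^ d i) / (1 - fps_X) ^ n"

text \<open>In product form a further generator acts on the coefficients by a shift and a
  subtraction, without division of series.\<close>

lemma froberg_series_eq:
  "froberg_series n r d = Abs_fps (\<lambda>t. of_nat (card (monomials n t))) * (\<Prod>i=1..r. 1 - fps_X ^ d i)"
proof -
  let ?M = "Abs_fps (\<lambda>t. of_nat (card (monomials n t)) :: rat)" and ?D = "(1 - fps_X) ^ n :: rat fps"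
  have D: "?D \<noteq> 0" using monomials_fps[of n] by auto
  have "froberg_series n r d = ((\<Prod>i=1..r. 1 - fps_X ^ d i) * ?M) * ?D / ?D"
    using monomials_fps[of n] by (simp add: froberg_series_def mult.assoc)
  also have "\<dots> = (\<Prod>i=1..r. 1 - fps_X ^ d i) * ?M"
    using D by simp
  finally show ?thesis by (simp add: mult.commute)
qed

lemma froberg_series_Suc: "froberg_series n (Suc r) d = froberg_series n r d * (1 - fps_X ^ d (Suc r))"
  by (simp add: froberg_series_eq mult.assoc)

lemma froberg_series_nth_Suc:
  "fps_nth (froberg_series n (Suc r) d) t =
   fps_nth (froberg_series n r d) t - (if d (Suc r) \<le> t then fps_nth (froberg_series n r d) (t - d (Suc r)) else 0)"
  unfolding froberg_series_Suc by (rule fps_nth_mult_one_minus_X_power)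

lemma card_reduced_monomials:
  assumes "r \<le> n"
  shows "of_nat (card (reduced_monomials n r d t)) = fps_nth (froberg_series n r d) t"
  using assms
proof (induction r arbitrary: t)
  case 0
  then show ?case by (simp add: froberg_series_eq reduced_monomials_def)
next
  case (Suc r)
  then show ?case
    using reduced_monomials_split[of r n d t] by (auto simp: froberg_series_nth_Suc simp flip: Suc.IH)
qed

section \<open>Interpolation on finite sets\<close>

text \<open>A member that is nonzero at \<open>y\<close> is used to make the others vanish at
  \<open>y\<close>; after dropping it, the others still span the functions on the remaining
  points.\<close>

lemma spanning_functions_card:
  fixes v :: "'j \<Rightarrow> 'x \<Rightarrow> 'k::field"
  assumes "finite G" "finite J" and "\<And>h. \<exists>a. \<forall>x\<in>G. h x = (\<Sum>j\<in>J. a j * v j x)"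
  shows "card G \<le> card J"
  using assms
proof (induction G arbitrary: J v rule: finite_induct)
  case (insert y G)
  obtain a where a: "\<forall>x\<in>insert y G. (if x = y then 1 else 0) = (\<Sum>j\<in>J. a j * v j x)"
    using insert.prems(2)[of "\<lambda>x. if x = y then 1 else 0"] by blast
  then have "(\<Sum>j\<in>J. a j * v j y) \<noteq> 0" by force
  then obtain i where i: "i \<in> J" "v i y \<noteq> 0"
    by (rule sum.not_neutral_contains_not_neutral) auto
  define w where "w j x = v j x - v j y / v i y * v i x" for j x
  have "\<exists>a. \<forall>x\<in>G. h x = (\<Sum>j\<in>J - {i}. a j * w j x)" for h
  proof -
    obtain a where a: "\<forall>x\<in>insert y G. (if x = y then 0 else h x) = (\<Sum>j\<in>J. a j * v j x)"
      using insert.prems(2)[of "\<lambda>x. if x = y then 0 else h x"] by blast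
    have "h x = (\<Sum>j\<in>J - {i}. a j * w j x)" if x: "x \<in> G" for x
    proof -
      have "(\<Sum>j\<in>J - {i}. a j * w j x) = (\<Sum>j\<in>J. a j * w j x)"
        using insert.prems(1) i by (simp add: sum.remove[of J i] w_def)
      also have "\<dots> = (\<Sum>j\<in>J. a j * v j x) - (\<Sum>j\<in>J. a j * v j y) / v i y * v i x"
        by (simp add: w_def right_diff_distrib sum_subtractf sum_distrib_right sum_divide_distrib mult.assoc)
      also have "(\<Sum>j\<in>J. a j * v j y) = 0" using bspec[OF a, of y] by simp
      also have "(\<Sum>j\<in>J. a j * v j x) = h x" using bspec[OF a, of x] x insert.hyps(2) by (auto split: if_splits)
      finally show ?thesis by simp
    qed
    then show ?thesis by blast
  qed
  then have "card G \<le> card (J - {i})"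
    by (intro insert.IH[of "J - {i}" w]) (use insert.prems(1) in auto)
  moreover have "card J = Suc (card (J - {i}))"
    using insert.prems(1) i(1) by (metis card.remove)
  ultimately show ?case using insert.hyps by simp
qed simp

text \<open>A nontrivial relation would express one member by the others, leaving a spanning family
  with fewer members than \<open>G\<close> has points. On the grid, spanning comes from
  interpolation and independence from this count.\<close>

lemma spanning_functions_independent:
  fixes v :: "'j \<Rightarrow> 'x \<Rightarrow> 'k::field"
  assumes G: "finite G" and J: "finite J" and card: "card J \<le> card G"
    and span: "\<And>h. \<exists>a. \<forall>x\<in>G. h x = (\<Sum>j\<in>J. a j * v j x)"
    and zero: "\<forall>x\<in>G. (\<Sum>j\<in>J. b j * v j x) = 0"
  shows "\<forall>j\<in>J. b j = 0"
proof (rule ccontr)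
  assume "\<not> ?thesis"
  then obtain i where i: "i \<in> J" "b i \<noteq> 0" by blast
  have "\<exists>a. \<forall>x\<in>G. h x = (\<Sum>j\<in>J - {i}. a j * v j x)" for h
  proof -
    obtain a where a: "\<forall>x\<in>G. h x = (\<Sum>j\<in>J. a j * v j x)" using span by blast
    have "h x = (\<Sum>j\<in>J - {i}. (a j - a i / b i * b j) * v j x)" if "x \<in> G" for x
    proof -
      have "(\<Sum>j\<in>J - {i}. (a j - a i / b i * b j) * v j x) = (\<Sum>j\<in>J. (a j - a i / b i * b j) * v j x)"
        using J i by (simp add: sum.remove[of J i])
      also have "\<dots> = (\<Sum>j\<in>J. a j * v j x) - a i / b i * (\<Sum>j\<in>J. b j * v j x)"
        by (simp add: left_diff_distrib sum_subtractf sum_distrib_left mult.assoc)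
      finally show ?thesis using a zero that by simp
    qed
    then show ?thesis by (intro exI[of _ "\<lambda>j. a j - a i / b i * b j"]) simp
  qed
  then have "card G \<le> card (J - {i})"
    by (intro spanning_functions_card[OF G]) (use J in auto)
  moreover have "card (J - {i}) < card J" using J i(1) by (rule card_Diff1_less)
  ultimately show False using card by simp
qed

text \<open>Newton interpolation: points are added in order of increasing rank, and the function
  belonging to the new point corrects the value there without touching the earlier ones. It vanishes
  at other points of equal rank too, so ties do no harm.\<close>

lemma triangular_interpolation:
  fixes W :: "('x \<Rightarrow> 'k::field) set" and rank :: "'x \<Rightarrow> nat"
  assumes zero: "(\<lambda>_. 0) \<in> W"
    and lin: "\<And>u w c. u \<in> W \<Longrightarrow> w \<in> W \<Longrightarrow> (\<lambda>x. u x + c * w x) \<in> W"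
    and "finite T"
    and "\<And>y. y \<in> T \<Longrightarrow> \<exists>u\<in>W. u y \<noteq> 0 \<and> (\<forall>z\<in>T. rank z \<le> rank y \<and> z \<noteq> y \<longrightarrow> u z = 0)"
  shows "\<exists>u\<in>W. \<forall>x\<in>T. u x = h x"
  using assms(3,4)
proof (induction T rule: finite_ranking_induct[where f = rank])
  case empty
  then show ?case using zero by blast
next
  case (insert y T)
  obtain u where u: "u \<in> W" "\<forall>x\<in>T. u x = h x"
  proof -
    have "\<exists>u\<in>W. \<forall>x\<in>T. u x = h x"
      by (rule insert.IH) (use insert.prems in blast)
    then show thesis using that by blast
  qed
  obtain w where w: "w \<in> W" "w y \<noteq> 0" "\<forall>z\<in>insert y T. rank z \<le> rank y \<and> z \<noteq> y \<longrightarrow> w z = 0"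
    using insert.prems[of y] by blast
  let ?u = "\<lambda>x. u x + ((h y - u y) / w y) * w x"
  have "?u \<in> W" by (rule lin[OF u(1) w(1)])
  moreover have "\<forall>x\<in>insert y T. ?u x = h x"
  proof
    fix x assume x: "x \<in> insert y T"
    show "?u x = h x"
    proof (cases "x = y")
      case False
      then have "x \<in> T" using x by blast
      then show ?thesis using False u(2) w(3) insert.hyps(2)[of x] by simp
    qed (use w(2) in simp)
  qed
  ultimately show ?case by (intro bexI[of _ ?u])
qed

text \<open>In passing from \<open>u\<close> to \<open>u + c * w\<close>, a point with
  \<open>w x \<noteq> 0\<close> excludes a single scalar \<open>c\<close>, and an infinite field has
  others left. A point with \<open>w x = 0\<close> keeps the nonzero value of
  \<open>u\<close>.\<close>

lemma nonvanishing_combination: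
  fixes W :: "('x \<Rightarrow> 'k::field) set"
  assumes inf: "infinite (UNIV :: 'k set)" and zero: "(\<lambda>_. 0) \<in> W"
    and lin: "\<And>u w c. u \<in> W \<Longrightarrow> w \<in> W \<Longrightarrow> (\<lambda>x. u x + c * w x) \<in> W"
    and "finite T" and "\<And>y. y \<in> T \<Longrightarrow> \<exists>u\<in>W. u y \<noteq> 0"
  shows "\<exists>u\<in>W. \<forall>x\<in>T. u x \<noteq> 0"
  using assms(4,5)
proof (induction T rule: finite_induct)
  case empty
  then show ?case using zero by blast
next
  case (insert y T)
  obtain u where u: "u \<in> W" "\<forall>x\<in>T. u x \<noteq> 0" using insert.IH insert.prems by blast
  obtain w where w: "w \<in> W" "w y \<noteq> 0" using insert.prems by blast
  have "finite ((\<lambda>x. - u x / w x) ` insert y T)" using insert.hyps(1) by simp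
  then obtain c where c: "c \<notin> (\<lambda>x. - u x / w x) ` insert y T \<union> {0}"
    using inf ex_new_if_finite[OF inf, of "(\<lambda>x. - u x / w x) ` insert y T \<union> {0}"] by auto
  have "u x + c * w x \<noteq> 0" if x: "x \<in> insert y T" for x
  proof (cases "w x = 0")
    case True
    then show ?thesis using u(2) w(2) x by auto
  next
    case False
    then have "c \<noteq> - u x / w x" using c x by blast
    then show ?thesis using False by (auto simp: field_simps add_eq_0_iff)
  qed
  then show ?case by (intro bexI[OF _ lin[OF u(1) w(1), of c]]) simp
qed

section \<open>Forms on a grid\<close>

lemma forms_prod: "(\<And>x. x \<in> A \<Longrightarrow> f x \<in> forms n (e x)) \<Longrightarrow> prod f A \<in> forms n (sum e A)"
  by (induction A rule: infinite_finite_induct) (auto intro: forms_mult)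

text \<open>The sum runs over the index set, so the family may have repetitions.\<close>

lemma span_image_finite:
  assumes "finite J" "x \<in> poly_vs.span (v ` J)"
  obtains a where "x = (\<Sum>j\<in>J. smult_poly (a j) (v j))"
proof -
  let ?V = "{\<Sum>j\<in>J. smult_poly (a j) (v j) |a. True}"
  have "poly_vs.subspace ?V"
    unfolding poly_vs.subspace_def
  proof (intro conjI ballI allI)
    show "0 \<in> ?V" by (intro CollectI exI[of _ "\<lambda>_. 0"]) simp
  next
    fix x y assume "x \<in> ?V" "y \<in> ?V"
    then obtain a b where "x = (\<Sum>j\<in>J. smult_poly (a j) (v j))" "y = (\<Sum>j\<in>J. smult_poly (b j) (v j))"
      by blast
    then show "x + y \<in> ?V"
      by (intro CollectI exI[of _ "\<lambda>j. a j + b j"]) (simp add: poly_vs.scale_left_distrib sum.distrib)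
  next
    fix c x assume "x \<in> ?V"
    then obtain a where "x = (\<Sum>j\<in>J. smult_poly (a j) (v j))" by blast
    then show "smult_poly c x \<in> ?V"
      by (intro CollectI exI[of _ "\<lambda>j. c * a j"]) (simp add: poly_vs.scale_sum_right)
  qed
  moreover have "v ` J \<subseteq> ?V"
  proof
    fix y assume "y \<in> v ` J"
    then obtain i where i: "i \<in> J" "y = v i" by blast
    have "(\<Sum>j\<in>J. smult_poly (if j = i then 1 else 0) (v j)) = y"
      using assms(1) i by (simp add: if_distrib[of "\<lambda>t. smult_poly t _"] cong: if_cong)
    then show "y \<in> ?V" by (intro CollectI exI[of _ "\<lambda>j. if j = i then 1 else 0"]) simp
  qed
  ultimately have "poly_vs.span (v ` J) \<subseteq> ?V" by (intro poly_vs.span_minimal)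
  then have "x \<in> ?V" by (rule subsetD) (rule assms(2))
  then show thesis using that by blast
qed

text \<open>In the application \<open>N = n - 1\<close>, and the last variable, of index
  \<open>Suc N\<close>, equals 1 on the grid. The distinct scalars \<open>c 0\<close>,
  \<open>c 1\<close>, ... serve as coordinates in every direction; \<open>d (Suc N)\<close> and
  \<open>d (Suc (Suc N))\<close> are the degrees of the two further generators.\<close>

locale grid =
  fixes N :: nat and d :: "nat \<Rightarrow> nat" and c :: "nat \<Rightarrow> 'k::field"
  assumes inj_c: "inj c" and d_pos: "\<And>k. k \<in> {1..N} \<Longrightarrow> 0 < d k"
begin

text \<open>Used twice: as index set of the grid points, and as exponents of the monomials that
  represent functions on the grid.\<close>

definition box :: "nat monomial set" where
  "box = {\<alpha>. Poly_Mapping.keys \<alpha> \<subseteq> {1..N} \<and> (\<forall>k\<in>{1..N}. Poly_Mapping.lookup \<alpha> k < d k)}"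

text \<open>Grid points are indexed by monomials; setting \<open>x\<^sub>N\<^sub>+\<^sub>1 = 1\<close> dehomogenizes.\<close>

definition pt :: "nat monomial \<Rightarrow> nat \<Rightarrow> 'k" where
  "pt \<alpha> k = (if k = Suc N then 1 else c (Poly_Mapping.lookup \<alpha> k))"

text \<open>The largest degree in \<open>box\<close>: the socle degree of the quotient of the ring
  in N variables by the powers x_k^(d k). It is later identified with
  \<open>delta d N\<close>.\<close>

definition socle :: nat where
  "socle = (\<Sum>k=1..N. d k - 1)"

definition reflect :: "nat monomial \<Rightarrow> nat monomial" where
  "reflect \<alpha> = (\<Sum>k\<in>{1..N}. Poly_Mapping.single k (d k - 1 - Poly_Mapping.lookup \<alpha> k))"

definition linear_factor :: "nat \<Rightarrow> nat \<Rightarrow> (nat, 'k) mpoly" where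
  "linear_factor k j = var k - smult_poly (c j) (var (Suc N))"

text \<open>Newton products: \<open>A k\<close> lists the grid hyperplanes in direction
  \<open>k\<close> on which the form is to vanish.\<close>

definition grid_product :: "(nat \<Rightarrow> nat set) \<Rightarrow> (nat, 'k) mpoly" where
  "grid_product A = (\<Prod>k=1..N. \<Prod>j\<in>A k. linear_factor k j)"

definition homog :: "nat \<Rightarrow> nat monomial \<Rightarrow> (nat, 'k) mpoly" where
  "homog t \<beta> = Poly_Mapping.single (\<beta> + Poly_Mapping.single (Suc N) (t - mon_deg \<beta>)) 1"

section \<open>Degrees and reflection in the box\<close>

lemma mon_deg_box: "\<alpha> \<in> box \<Longrightarrow> mon_deg \<alpha> = (\<Sum>k=1..N. Poly_Mapping.lookup \<alpha> k)"
  unfolding box_def by (intro mon_deg_superset) auto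

lemma mon_deg_le_socle: "\<alpha> \<in> box \<Longrightarrow> mon_deg \<alpha> \<le> socle"
proof -
  assume \<alpha>: "\<alpha> \<in> box"
  have "Poly_Mapping.lookup \<alpha> k \<le> d k - 1" if "k \<in> {1..N}" for k
    using \<alpha> that unfolding box_def by fastforce
  then show ?thesis
    unfolding mon_deg_box[OF \<alpha>] socle_def by (rule sum_mono)
qed

lemma finite_box: "finite box"
proof -
  have "box \<subseteq> (\<Union>t\<le>socle. monomials N t)"
    using mon_deg_le_socle by (auto simp: monomials_def box_def)
  then show ?thesis by (rule finite_subset) (simp add: finite_monomials)
qed

lemma box_eqI:
  assumes "\<alpha> \<in> box" "\<beta> \<in> box" "\<And>k. k \<in> {1..N} \<Longrightarrow> Poly_Mapping.lookup \<alpha> k = Poly_Mapping.lookup \<beta> k"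
  shows "\<alpha> = \<beta>"
proof (rule poly_mapping_eqI)
  fix k
  show "Poly_Mapping.lookup \<alpha> k = Poly_Mapping.lookup \<beta> k"
  proof (cases "k \<in> {1..N}")
    case False
    then have "k \<notin> Poly_Mapping.keys \<alpha>" "k \<notin> Poly_Mapping.keys \<beta>"
      using assms(1,2) by (auto simp: box_def)
    then show ?thesis by (simp add: in_keys_iff)
  qed (rule assms)
qed

text \<open>Makes the degree usable as rank in \<open>triangular_interpolation\<close>: a Newton
  product for \<beta> is nonzero only at points above \<beta>, and of these only \<beta> itself has
  no larger degree. The mirrored products use the same fact with the roles exchanged.\<close>

lemma box_antisym:
  assumes "\<alpha> \<in> box" "\<beta> \<in> box" "\<And>k. k \<in> {1..N} \<Longrightarrow> Poly_Mapping.lookup \<beta> k \<le> Poly_Mapping.lookup \<alpha> k"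
    and "mon_deg \<alpha> \<le> mon_deg \<beta>"
  shows "\<alpha> = \<beta>"
proof (rule box_eqI[OF assms(1,2)], rule ccontr)
  fix k assume k: "k \<in> {1..N}" "Poly_Mapping.lookup \<alpha> k \<noteq> Poly_Mapping.lookup \<beta> k"
  then have "Poly_Mapping.lookup \<beta> k < Poly_Mapping.lookup \<alpha> k" using assms(3)[of k] by simp
  then have "mon_deg \<beta> < mon_deg \<alpha>"
    unfolding mon_deg_box[OF assms(1)] mon_deg_box[OF assms(2)]
    using k(1) assms(3) by (intro sum_strict_mono_ex1) auto
  then show False using assms(4) by simp
qed

lemma lookup_reflect:
  "Poly_Mapping.lookup (reflect \<alpha>) k = (if k \<in> {1..N} then d k - 1 - Poly_Mapping.lookup \<alpha> k else 0)"
  by (simp add: reflect_def lookup_sum lookup_single when_def)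

lemma reflect_box: "\<alpha> \<in> box \<Longrightarrow> reflect \<alpha> \<in> box"
proof -
  have "d k - 1 - Poly_Mapping.lookup \<alpha> k < d k" if "k \<in> {1..N}" for k
    using d_pos[OF that] by linarith
  moreover have "Poly_Mapping.keys (reflect \<alpha>) \<subseteq> {1..N}"
    by (auto simp: in_keys_iff lookup_reflect split: if_splits)
  ultimately show ?thesis by (simp add: box_def lookup_reflect)
qed

lemma reflect_reflect: "\<alpha> \<in> box \<Longrightarrow> reflect (reflect \<alpha>) = \<alpha>"
proof (rule box_eqI)
  fix k assume "\<alpha> \<in> box" "k \<in> {1..N}"
  moreover from this have "Poly_Mapping.lookup \<alpha> k < d k" by (simp add: box_def)
  ultimately show "Poly_Mapping.lookup (reflect (reflect \<alpha>)) k = Poly_Mapping.lookup \<alpha> k"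
    by (simp add: lookup_reflect)
qed (simp_all add: reflect_box)

lemma mon_deg_reflect: "\<alpha> \<in> box \<Longrightarrow> mon_deg (reflect \<alpha>) + mon_deg \<alpha> = socle"
proof -
  assume \<alpha>: "\<alpha> \<in> box"
  have "mon_deg (reflect \<alpha>) + mon_deg \<alpha> =
      (\<Sum>k=1..N. (d k - 1 - Poly_Mapping.lookup \<alpha> k) + Poly_Mapping.lookup \<alpha> k)"
    unfolding mon_deg_box[OF \<alpha>] mon_deg_box[OF reflect_box[OF \<alpha>]] sum.distrib[symmetric]
    by (rule sum.cong) (auto simp: lookup_reflect)
  also have "\<dots> = socle"
    unfolding socle_def
  proof (rule sum.cong)
    fix k assume "k \<in> {1..N}"
    then have "Poly_Mapping.lookup \<alpha> k < d k" using \<alpha> by (simp add: box_def)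
    then show "d k - 1 - Poly_Mapping.lookup \<alpha> k + Poly_Mapping.lookup \<alpha> k = d k - 1" by simp
  qed simp
  finally show ?thesis .
qed

text \<open>Reflection carries the first set to the points of degree at least \<open>q\<close>, the
  complement of the second.\<close>

lemma card_box_split:
  "card {\<alpha>\<in>box. mon_deg \<alpha> + q \<le> socle} + card {\<alpha>\<in>box. mon_deg \<alpha> < q} = card box"
proof -
  have "bij_betw reflect {\<alpha>\<in>box. mon_deg \<alpha> + q \<le> socle} {\<alpha>\<in>box. q \<le> mon_deg \<alpha>}"
  proof (rule bij_betw_byWitness[where f' = reflect])
    show "reflect ` {\<alpha>\<in>box. mon_deg \<alpha> + q \<le> socle} \<subseteq> {\<alpha>\<in>box. q \<le> mon_deg \<alpha>}"
      using mon_deg_reflect reflect_box by fastforce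
    show "reflect ` {\<alpha>\<in>box. q \<le> mon_deg \<alpha>} \<subseteq> {\<alpha>\<in>box. mon_deg \<alpha> + q \<le> socle}"
      using mon_deg_reflect reflect_box by fastforce
  qed (auto simp: reflect_reflect)
  then have "card {\<alpha>\<in>box. mon_deg \<alpha> + q \<le> socle} = card {\<alpha>\<in>box. q \<le> mon_deg \<alpha>}"
    by (rule bij_betw_same_card)
  moreover have "card box = card ({\<alpha>\<in>box. q \<le> mon_deg \<alpha>} \<union> {\<alpha>\<in>box. mon_deg \<alpha> < q})"
    by (rule arg_cong[where f = card]) auto
  moreover have "\<dots> = card {\<alpha>\<in>box. q \<le> mon_deg \<alpha>} + card {\<alpha>\<in>box. mon_deg \<alpha> < q}"
    using finite_box by (intro card_Un_disjoint) auto
  ultimately show ?thesis by simp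
qed

section \<open>Newton products and interpolation on the grid\<close>

lemma linear_factor_form: "k \<in> {1..N} \<Longrightarrow> linear_factor k j \<in> forms (Suc N) 1"
  unfolding linear_factor_def by (intro forms_diff forms_smult var_in_forms) auto

lemma eval_linear_factor: "k \<in> {1..N} \<Longrightarrow> eval_poly (pt \<alpha>) (linear_factor k j) = c (Poly_Mapping.lookup \<alpha> k) - c j"
  by (simp add: linear_factor_def eval_poly_diff eval_poly_smult pt_def)

lemma grid_product_form: "grid_product A \<in> forms (Suc N) (\<Sum>k=1..N. card (A k))"
proof -
  have "(\<Prod>j\<in>A k. linear_factor k j) \<in> forms (Suc N) (\<Sum>j\<in>A k. 1)" if "k \<in> {1..N}" for k
    using that by (intro forms_prod linear_factor_form)
  then show ?thesis unfolding grid_product_def by (intro forms_prod) simp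
qed

lemma grid_product_eval:
  assumes "\<And>k. k \<in> {1..N} \<Longrightarrow> finite (A k)"
  shows "eval_poly (pt \<alpha>) (grid_product A) \<noteq> 0 \<longleftrightarrow> (\<forall>k\<in>{1..N}. Poly_Mapping.lookup \<alpha> k \<notin> A k)"
proof -
  have "eval_poly (pt \<alpha>) (grid_product A) = (\<Prod>k=1..N. \<Prod>j\<in>A k. c (Poly_Mapping.lookup \<alpha> k) - c j)"
    by (simp add: grid_product_def eval_poly_prod eval_linear_factor)
  also have "\<dots> \<noteq> 0 \<longleftrightarrow> (\<forall>k\<in>{1..N}. Poly_Mapping.lookup \<alpha> k \<notin> A k)"
    using assms inj_c by (auto simp: inj_eq)
  finally show ?thesis .
qed

text \<open>The last coordinate of every grid point is 1, so powers of the last variable raise the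
  degree without changing values.\<close>

lemma pad_form:
  assumes "p \<in> forms (Suc N) s" "s \<le> t"
  obtains p' where "p' \<in> forms (Suc N) t" "\<And>\<alpha>. eval_poly (pt \<alpha>) p' = eval_poly (pt \<alpha>) p"
proof
  have v: "var (Suc N) ^ (t - s) \<in> forms (Suc N) ((t - s) * 1)"
    by (intro forms_power var_in_forms) simp
  then show "var (Suc N) ^ (t - s) * p \<in> forms (Suc N) t"
    using forms_mult[OF v assms(1)] assms(2) by simp
qed (simp add: eval_poly_mult eval_poly_power pt_def)

definition grid_values :: "nat \<Rightarrow> (nat monomial \<Rightarrow> 'k) set" where
  "grid_values s = {\<lambda>\<alpha>. eval_poly (pt \<alpha>) p |p. p \<in> forms (Suc N) s}"

lemma grid_values_zero: "(\<lambda>_. 0) \<in> grid_values s"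
  unfolding grid_values_def by (intro CollectI exI[of _ 0]) simp

lemma grid_values_lin:
  assumes "u \<in> grid_values s" "w \<in> grid_values s"
  shows "(\<lambda>x. u x + a * w x) \<in> grid_values s"
proof -
  obtain p q where "p \<in> forms (Suc N) s" "q \<in> forms (Suc N) s"
    "u = (\<lambda>\<alpha>. eval_poly (pt \<alpha>) p)" "w = (\<lambda>\<alpha>. eval_poly (pt \<alpha>) q)"
    using assms unfolding grid_values_def by blast
  then show ?thesis unfolding grid_values_def
    by (intro CollectI exI[of _ "p + smult_poly a q"])
      (simp add: forms_add forms_smult eval_poly_add eval_poly_smult)
qed

lemma newton_values:
  assumes "(\<Sum>k=1..N. card (A k)) \<le> s" "\<And>k. k \<in> {1..N} \<Longrightarrow> finite (A k)"
  obtains u where "u \<in> grid_values s" "\<forall>\<alpha>. u \<alpha> \<noteq> 0 \<longleftrightarrow> (\<forall>k\<in>{1..N}. Poly_Mapping.lookup \<alpha> k \<notin> A k)"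
proof -
  obtain p where p: "p \<in> forms (Suc N) s" "\<And>\<alpha>. eval_poly (pt \<alpha>) p = eval_poly (pt \<alpha>) (grid_product A)"
    using pad_form[OF grid_product_form assms(1)] by blast
  show thesis
  proof (rule that)
    show "(\<lambda>\<alpha>. eval_poly (pt \<alpha>) p) \<in> grid_values s"
      unfolding grid_values_def using p(1) by blast
    show "\<forall>\<alpha>. eval_poly (pt \<alpha>) p \<noteq> 0 \<longleftrightarrow> (\<forall>k\<in>{1..N}. Poly_Mapping.lookup \<alpha> k \<notin> A k)"
      unfolding p(2) using grid_product_eval[of A] assms(2) by blast
  qed
qed

text \<open>For \<beta> take the Newton product with zeros at all smaller coordinates in each
  direction. Its degree is that of \<beta>, and it is nonzero only at points that dominate \<beta>
  componentwise.\<close>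

lemma interpolation_low:
  "\<exists>u\<in>grid_values s. \<forall>\<alpha>\<in>{\<alpha>\<in>box. mon_deg \<alpha> \<le> s}. u \<alpha> = h \<alpha>"
proof (rule triangular_interpolation[where rank = mon_deg])
  fix \<beta> assume \<beta>: "\<beta> \<in> {\<alpha>\<in>box. mon_deg \<alpha> \<le> s}"
  then have le: "(\<Sum>k=1..N. card {..<Poly_Mapping.lookup \<beta> k}) \<le> s"
    using mon_deg_box[of \<beta>] by simp
  obtain u where u: "u \<in> grid_values s" "\<forall>\<alpha>. u \<alpha> \<noteq> 0 \<longleftrightarrow> (\<forall>k\<in>{1..N}. Poly_Mapping.lookup \<alpha> k \<notin> {..<Poly_Mapping.lookup \<beta> k})"
    using newton_values[OF le] by blast
  moreover have "u \<alpha> = 0" if "\<alpha> \<in> box" "mon_deg \<alpha> \<le> mon_deg \<beta>" "\<alpha> \<noteq> \<beta>" for \<alpha>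
    using box_antisym[of \<alpha> \<beta>] that \<beta> spec[OF u(2), of \<alpha>] by (auto simp: not_less)
  ultimately show "\<exists>u\<in>grid_values s. u \<beta> \<noteq> 0 \<and>
      (\<forall>\<alpha>\<in>{\<alpha>\<in>box. mon_deg \<alpha> \<le> s}. mon_deg \<alpha> \<le> mon_deg \<beta> \<and> \<alpha> \<noteq> \<beta> \<longrightarrow> u \<alpha> = 0)"
    by (intro bexI[of _ u]) auto
qed (use grid_values_zero grid_values_lin finite_box in auto)

text \<open>The mirror image of \<open>interpolation_low\<close>: the zeros are placed above \<beta>
  in each direction, so the degree is that of \<open>reflect \<beta>\<close>, and the points are
  processed from the top degree downwards.\<close>

lemma interpolation_high:
  "\<exists>u\<in>grid_values s. \<forall>\<alpha>\<in>{\<alpha>\<in>box. socle \<le> mon_deg \<alpha> + s}. u \<alpha> = h \<alpha>"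
proof (rule triangular_interpolation[where rank = "\<lambda>\<alpha>. socle - mon_deg \<alpha>"])
  fix \<beta> assume \<beta>: "\<beta> \<in> {\<alpha>\<in>box. socle \<le> mon_deg \<alpha> + s}"
  let ?A = "\<lambda>k. {Poly_Mapping.lookup \<beta> k<..<d k}"
  have "(\<Sum>k=1..N. card (?A k)) = mon_deg (reflect \<beta>)"
    using \<beta> by (simp add: mon_deg_box[OF reflect_box] lookup_reflect)
  then have "(\<Sum>k=1..N. card (?A k)) \<le> s" using mon_deg_reflect[of \<beta>] \<beta> by simp
  then obtain u where u: "u \<in> grid_values s" "\<forall>\<alpha>. u \<alpha> \<noteq> 0 \<longleftrightarrow> (\<forall>k\<in>{1..N}. Poly_Mapping.lookup \<alpha> k \<notin> ?A k)"
    using newton_values[of ?A s] by auto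
  moreover have "u \<alpha> = 0" if \<alpha>: "\<alpha> \<in> box" "socle - mon_deg \<alpha> \<le> socle - mon_deg \<beta>" "\<alpha> \<noteq> \<beta>" for \<alpha>
  proof (rule ccontr)
    assume "u \<alpha> \<noteq> 0"
    then have "\<forall>k\<in>{1..N}. Poly_Mapping.lookup \<alpha> k \<notin> ?A k" using u(2) by blast
    then have "Poly_Mapping.lookup \<alpha> k \<le> Poly_Mapping.lookup \<beta> k" if "k \<in> {1..N}" for k
      using that \<alpha>(1) by (fastforce simp: box_def not_less)
    moreover have "mon_deg \<beta> \<le> mon_deg \<alpha>"
      using \<alpha>(2) mon_deg_le_socle[of \<beta>] \<beta> mon_deg_le_socle[OF \<alpha>(1)] by simp
    ultimately show False using box_antisym[of \<beta> \<alpha>] \<alpha> \<beta> by simp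
  qed
  ultimately show "\<exists>u\<in>grid_values s. u \<beta> \<noteq> 0 \<and> (\<forall>\<alpha>\<in>{\<alpha>\<in>box. socle \<le> mon_deg \<alpha> + s}.
      socle - mon_deg \<alpha> \<le> socle - mon_deg \<beta> \<and> \<alpha> \<noteq> \<beta> \<longrightarrow> u \<alpha> = 0)"
    by (intro bexI[of _ u]) auto
qed (use grid_values_zero grid_values_lin finite_box in auto)

lemma sub_exponents:
  assumes "Poly_Mapping.keys \<alpha> \<subseteq> {1..N}" "q \<le> mon_deg \<alpha>"
  obtains b :: "nat \<Rightarrow> nat" where "\<And>k. b k \<le> Poly_Mapping.lookup \<alpha> k" "(\<Sum>k=1..N. b k) = q"
proof -
  have "\<exists>b. (\<forall>k. b k \<le> Poly_Mapping.lookup \<alpha> k) \<and> (\<Sum>k=1..N. b k) = q"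
    using assms(2)
  proof (induction q rule: inc_induct)
    case base
    show ?case
      using mon_deg_superset[OF _ assms(1)] by (intro exI[of _ "Poly_Mapping.lookup \<alpha>"]) simp
  next
    case (step q)
    then obtain b where b: "\<forall>k. b k \<le> Poly_Mapping.lookup \<alpha> k" "(\<Sum>k=1..N. b k) = Suc q" by blast
    then obtain i where i: "i \<in> {1..N}" "b i \<noteq> 0"
      using sum.not_neutral_contains_not_neutral[of b "{1..N}"] by auto
    have "(\<Sum>k=1..N. (b(i := b i - 1)) k) = b i - 1 + (\<Sum>k\<in>{1..N} - {i}. b k)"
      by (subst sum.remove[of "{1..N}" i]) (use i in \<open>auto intro!: sum.cong\<close>)
    moreover have "Suc q = b i + (\<Sum>k\<in>{1..N} - {i}. b k)"
      using b(2) i by (subst (asm) sum.remove[of "{1..N}" i]) auto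
    ultimately have "(\<Sum>k=1..N. (b(i := b i - 1)) k) = q" using i(2) by simp
    then show ?case using b(1) by (intro exI[of _ "b(i := b i - 1)"]) (auto intro: le_trans[OF diff_le_self])
  qed
  then show thesis using that by blast
qed

text \<open>For a point \<alpha> of degree at least \<open>q\<close>, an exponent vector of degree
  \<open>q\<close> below \<alpha> gives a Newton product that is nonzero at \<alpha> and vanishes at
  all points of degree below \<open>q\<close>. Over an infinite field these combine into one form
  that serves all such \<alpha> at once.\<close>

lemma exists_cutting_form:
  assumes inf: "infinite (UNIV :: 'k set)" and "q \<le> a"
  obtains \<phi> where "\<phi> \<in> forms (Suc N) a" "\<And>\<alpha>. \<alpha> \<in> box \<Longrightarrow> eval_poly (pt \<alpha>) \<phi> = 0 \<longleftrightarrow> mon_deg \<alpha> < q"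
proof -
  let ?W = "{u\<in>grid_values a. \<forall>\<alpha>\<in>box. mon_deg \<alpha> < q \<longrightarrow> u \<alpha> = 0}"
  have "\<exists>u\<in>?W. \<forall>\<alpha>\<in>{\<alpha>\<in>box. q \<le> mon_deg \<alpha>}. u \<alpha> \<noteq> 0"
  proof (rule nonvanishing_combination[OF inf])
    fix \<alpha> assume \<alpha>: "\<alpha> \<in> {\<alpha>\<in>box. q \<le> mon_deg \<alpha>}"
    then obtain b :: "nat \<Rightarrow> nat" where b: "\<And>k. b k \<le> Poly_Mapping.lookup \<alpha> k" "(\<Sum>k=1..N. b k) = q"
      using sub_exponents[of \<alpha> q] by (auto simp: box_def)
    obtain u where u: "u \<in> grid_values a" "\<forall>\<alpha>. u \<alpha> \<noteq> 0 \<longleftrightarrow> (\<forall>k\<in>{1..N}. Poly_Mapping.lookup \<alpha> k \<notin> {..<b k})"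
      using newton_values[of "\<lambda>k. {..<b k}" a] b(2) assms(2) by auto
    have "u \<beta> = 0" if \<beta>: "\<beta> \<in> box" "mon_deg \<beta> < q" for \<beta>
    proof (rule ccontr)
      assume "u \<beta> \<noteq> 0"
      then have "\<forall>k\<in>{1..N}. b k \<le> Poly_Mapping.lookup \<beta> k" using u(2) by (simp add: not_less)
      then have "q \<le> mon_deg \<beta>" unfolding mon_deg_box[OF \<beta>(1)] b(2)[symmetric] by (intro sum_mono) simp
      then show False using \<beta>(2) by simp
    qed
    moreover have "u \<alpha> \<noteq> 0" using u(2) b(1) by (simp add: not_less)
    ultimately show "\<exists>u\<in>?W. u \<alpha> \<noteq> 0" using u(1) by blast
  qed (use grid_values_zero grid_values_lin finite_box in auto)
  then obtain u where u: "u \<in> ?W" "\<forall>\<alpha>\<in>{\<alpha>\<in>box. q \<le> mon_deg \<alpha>}. u \<alpha> \<noteq> 0" by blast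
  then obtain \<phi> where \<phi>: "\<phi> \<in> forms (Suc N) a" "u = (\<lambda>\<alpha>. eval_poly (pt \<alpha>) \<phi>)"
    unfolding grid_values_def by blast
  show thesis
  proof (rule that[OF \<phi>(1)])
    fix \<alpha> assume "\<alpha> \<in> box"
    then show "eval_poly (pt \<alpha>) \<phi> = 0 \<longleftrightarrow> mon_deg \<alpha> < q"
      using u \<phi>(2) by (cases "mon_deg \<alpha> < q") auto
  qed
qed

section \<open>Division modulo the grid ideal\<close>

definition grid_gen :: "nat \<Rightarrow> (nat, 'k) mpoly" where
  "grid_gen k = (\<Prod>j<d k. linear_factor k j)"

abbreviation monomial_value :: "nat monomial \<Rightarrow> nat monomial \<Rightarrow> 'k" where
  "monomial_value \<alpha> \<beta> \<equiv> mon_val (pt \<alpha>) \<beta>"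

lemma homog_form: "\<beta> \<in> box \<Longrightarrow> mon_deg \<beta> \<le> t \<Longrightarrow> homog t \<beta> \<in> forms (Suc N) t"
  unfolding homog_def by (intro forms_single) (auto simp: monomials_def box_def keys_add_nat)

lemma eval_homog: "eval_poly (pt \<alpha>) (homog t \<beta>) = monomial_value \<alpha> \<beta>"
  by (simp add: homog_def mon_val_add) (simp add: mon_val_def pt_def)

lemma grid_gen_form: "k \<in> {1..N} \<Longrightarrow> grid_gen k \<in> forms (Suc N) (d k)"
proof -
  assume "k \<in> {1..N}"
  then have "(\<Prod>j<d k. linear_factor k j) \<in> forms (Suc N) (\<Sum>j<d k. 1)"
    by (intro forms_prod linear_factor_form)
  then show ?thesis by (simp add: grid_gen_def)
qed

lemma grid_gen_vanishes: "k \<in> {1..N} \<Longrightarrow> \<alpha> \<in> box \<Longrightarrow> eval_poly (pt \<alpha>) (grid_gen k) = 0"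
  by (auto simp: grid_gen_def eval_poly_prod eval_linear_factor box_def)

lemma grid_ideal_vanishes:
  assumes "p \<in> ideal_gen n N grid_gen" "\<alpha> \<in> box"
  shows "eval_poly (pt \<alpha>) p = 0"
proof -
  obtain g where "p = (\<Sum>i=1..N. g i * grid_gen i)"
    using assms(1) unfolding ideal_gen_def by blast
  then show ?thesis
    using assms(2) by (simp add: eval_poly_sum eval_poly_mult grid_gen_vanishes)
qed

lemma grid_gen_leading:
  assumes k: "k \<in> {1..N}"
  obtains w where "w \<in> forms (Suc N) (d k - 1)" "grid_gen k = var k ^ d k + var (Suc N) * w"
proof -
  \<comment> \<open>At \<open>e = 0\<close> the degree \<open>e - 1\<close> is truncated to 0; the
    clause \<open>w = 0\<close> keeps the product with the next factor in degree
    \<open>e\<close>.\<close>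
  have "\<exists>w\<in>forms (Suc N) (e - 1). (\<Prod>j<e. linear_factor k j) = var k ^ e + var (Suc N) * w
      \<and> (e = 0 \<longrightarrow> w = 0)" for e
  proof (induction e)
    case 0
    show ?case by (intro bexI[of _ 0]) auto
  next
    case (Suc e)
    then obtain w where w: "w \<in> forms (Suc N) (e - 1)" "e = 0 \<longrightarrow> w = 0"
      "(\<Prod>j<e. linear_factor k j) = var k ^ e + var (Suc N) * w" by blast
    let ?w = "w * linear_factor k e - smult_poly (c e) (var k ^ e)"
    have "w * linear_factor k e \<in> forms (Suc N) e"
      using forms_mult[OF w(1) linear_factor_form[OF k]] w(2) by (cases e) auto
    moreover have "var k ^ e \<in> forms (Suc N) e"
      using forms_power[OF var_in_forms[of k "Suc N"], of e] k by simp
    ultimately have "?w \<in> forms (Suc N) e"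
      by (intro forms_diff forms_smult)
    moreover have "(\<Prod>j<Suc e. linear_factor k j) = var k ^ Suc e + var (Suc N) * ?w"
    proof -
      have "(\<Prod>j<Suc e. linear_factor k j) = var k ^ e * linear_factor k e + var (Suc N) * (w * linear_factor k e)"
        by (simp add: w(3) algebra_simps)
      also have "var k ^ e * linear_factor k e = var k ^ Suc e - var (Suc N) * smult_poly (c e) (var k ^ e)"
        by (simp add: linear_factor_def right_diff_distrib smult_poly_mult_right mult.commute)
      finally show ?thesis by (simp add: right_diff_distrib)
    qed
    ultimately show ?case by (intro bexI[of _ ?w]) auto
  qed
  then show thesis using that unfolding grid_gen_def by blast
qed

text \<open>Modulo \<open>grid_gen k\<close>, the power x_k^(d k) is a multiple of the last
  variable, so a factor of that variable comes out and the cofactor has one degree less, where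
  induction applies. Monomials free of such powers and of the last variable lie in
  \<open>box\<close>.\<close>

lemma division:
  "forms (Suc N) t \<subseteq> poly_vs.span
     (homog t ` {\<beta>\<in>box. mon_deg \<beta> \<le> t} \<union> (ideal_gen (Suc N) N grid_gen \<inter> forms (Suc N) t))"
proof (induction t)
  case 0
  have "monomials (Suc N) 0 \<subseteq> {0}"
    by (auto simp: monomials_def mon_deg_def) (metis in_keys_iff keys_eq_empty subset_empty subsetI)
  moreover have "0 \<in> box" using d_pos by (simp add: box_def)
  moreover have "homog 0 0 = Poly_Mapping.single 0 1" by (simp add: homog_def)
  ultimately show ?case
    by (intro forms_subset_spanI poly_vs.span_base) (auto intro!: image_eqI[of _ _ 0])
next
  case (Suc t)
  let ?I = "ideal_gen (Suc N) N grid_gen"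
  let ?S = "\<lambda>t. homog t ` {\<beta>\<in>box. mon_deg \<beta> \<le> t} \<union> (?I \<inter> forms (Suc N) t)"
  have var_n: "var (Suc N) \<in> forms (Suc N) 1" by (rule var_in_forms) simp
  \<comment> \<open>Multiplication by the last variable carries a representation in degree
    \<open>t\<close> to one in degree \<open>Suc t\<close>: it pads the monomials and preserves the
    ideal.\<close>
  have mult_var: "var (Suc N) * p \<in> poly_vs.span (?S (Suc t))" if p: "p \<in> forms (Suc N) t" for p
  proof -
    let ?V = "{p. var (Suc N) * p \<in> poly_vs.span (?S (Suc t))}"
    have "poly_vs.subspace ?V"
      unfolding poly_vs.subspace_def
      by (auto simp: distrib_left smult_poly_mult_right poly_vs.span_zero
          intro: poly_vs.span_add poly_vs.span_scale)
    moreover have "?S t \<subseteq> ?V"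
    proof
      fix q assume "q \<in> ?S t"
      then consider \<beta> where "\<beta> \<in> box" "mon_deg \<beta> \<le> t" "q = homog t \<beta>"
        | "q \<in> ?I" "q \<in> forms (Suc N) t" by blast
      then show "q \<in> ?V"
      proof cases
        case 1
        have "var (Suc N) * q = homog (Suc t) \<beta>"
          using 1 by (simp add: homog_def var_def mult_single Suc_diff_le add_ac flip: single_add)
        moreover have "homog (Suc t) \<beta> \<in> ?S (Suc t)" using 1 by simp
        ultimately show ?thesis by (metis (mono_tags) mem_Collect_eq poly_vs.span_base)
      next
        case 2
        have "var (Suc N) * q \<in> ?I"
          using var_n forms_subset_polys 2(1) by (blast intro: ideal_gen_mult_closed)
        moreover have "var (Suc N) * q \<in> forms (Suc N) (Suc t)"
          using forms_mult[OF var_n 2(2)] by simp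
        ultimately have "var (Suc N) * q \<in> ?S (Suc t)" by simp
        then show ?thesis by (metis (mono_tags) mem_Collect_eq poly_vs.span_base)
      qed
    qed
    ultimately have "poly_vs.span (?S t) \<subseteq> ?V" by (intro poly_vs.span_minimal)
    moreover have "p \<in> poly_vs.span (?S t)" using Suc p by (rule subsetD)
    ultimately have "p \<in> ?V" by (rule subsetD)
    then show ?thesis by (rule CollectD)
  qed
  show ?case
  proof (rule forms_subset_spanI)
    fix m assume m: "m \<in> monomials (Suc N) (Suc t)"
    show "Poly_Mapping.single m (1::'k) \<in> poly_vs.span (?S (Suc t))"
    proof (cases "1 \<le> Poly_Mapping.lookup m (Suc N)")
      case True
      obtain m' where m': "m = m' + Poly_Mapping.single (Suc N) 1" "m' \<in> monomials (Suc N) (Suc t - 1)"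
        by (rule monomials_shift[OF _ m True]) simp
      have "Poly_Mapping.single m (1::'k) = var (Suc N) * Poly_Mapping.single m' 1"
        by (simp add: m'(1) var_def mult_single add.commute)
      then show ?thesis using mult_var[OF forms_single, of m' 1] m'(2) by simp
    next
      case False
      then have "Suc N \<notin> Poly_Mapping.keys m" by (simp add: in_keys_iff)
      moreover have "Poly_Mapping.keys m \<subseteq> {1..Suc N}" using m by (simp add: monomials_def)
      ultimately have keys: "Poly_Mapping.keys m \<subseteq> {1..N}" by (auto simp: atLeastAtMostSuc_conv)
      show ?thesis
      proof (cases "m \<in> box")
        case True
        moreover have "mon_deg m = Suc t" using m by (simp add: monomials_def)
        moreover from this have "homog (Suc t) m = Poly_Mapping.single m 1" by (simp add: homog_def)
        ultimately have "Poly_Mapping.single m 1 \<in> ?S (Suc t)"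
          by (intro UnI1 image_eqI[of _ _ m]) auto
        then show ?thesis by (rule poly_vs.span_base)
      next
        case False
        then obtain k where k: "k \<in> {1..N}" "d k \<le> Poly_Mapping.lookup m k"
          using keys by (auto simp: box_def not_less)
        obtain m' where m': "m = m' + Poly_Mapping.single k (d k)" "m' \<in> monomials (Suc N) (Suc t - d k)" "d k \<le> Suc t"
          by (rule monomials_shift[OF _ m k(2)]) (use k(1) in simp)
        obtain w where w: "w \<in> forms (Suc N) (d k - 1)" "grid_gen k = var k ^ d k + var (Suc N) * w"
          by (rule grid_gen_leading[OF k(1)])
        let ?m = "Poly_Mapping.single m' (1::'k)"
        have m'f: "?m \<in> forms (Suc N) (Suc t - d k)" by (rule forms_single[OF m'(2)])
        have "?m * w \<in> forms (Suc N) (Suc t - d k + (d k - 1))" by (rule forms_mult[OF m'f w(1)])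
        then have "?m * w \<in> forms (Suc N) t" using d_pos[OF k(1)] m'(3) by simp
        then have 1: "var (Suc N) * (?m * w) \<in> poly_vs.span (?S (Suc t))" by (rule mult_var)
        have "?m * grid_gen k \<in> ?I"
          using m'f forms_subset_polys k(1) by (blast intro: ideal_gen_mult)
        moreover have "?m * grid_gen k \<in> forms (Suc N) (Suc t)"
          using forms_mult[OF m'f grid_gen_form[OF k(1)]] m'(3) by simp
        ultimately have "?m * grid_gen k \<in> ?S (Suc t)" by simp
        then have 2: "?m * grid_gen k \<in> poly_vs.span (?S (Suc t))" by (rule poly_vs.span_base)
        have "Poly_Mapping.single m (1::'k) = ?m * var k ^ d k"
          by (simp add: m'(1) var_power mult_single)
        also have "\<dots> = ?m * grid_gen k - var (Suc N) * (?m * w)"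
          by (simp add: w(2) algebra_simps)
        finally show ?thesis using poly_vs.span_diff[OF 2 1] by simp
      qed
    qed
  qed
qed

lemma division_expansion:
  assumes "p \<in> forms (Suc N) t"
  obtains a i where "i \<in> ideal_gen (Suc N) N grid_gen"
    "p = (\<Sum>\<beta>\<in>{\<beta>\<in>box. mon_deg \<beta> \<le> t}. smult_poly (a \<beta>) (homog t \<beta>)) + i"
    "\<forall>\<alpha>\<in>box. eval_poly (pt \<alpha>) p = (\<Sum>\<beta>\<in>{\<beta>\<in>box. mon_deg \<beta> \<le> t}. a \<beta> * monomial_value \<alpha> \<beta>)"
proof -
  let ?B = "{\<beta>\<in>box. mon_deg \<beta> \<le> t}" and ?I = "ideal_gen (Suc N) N grid_gen \<inter> forms (Suc N) t"
  have "p \<in> poly_vs.span (homog t ` ?B \<union> ?I)" using division assms by (rule subsetD)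
  then obtain x i where x: "p = x + i" "x \<in> poly_vs.span (homog t ` ?B)" "i \<in> poly_vs.span ?I"
    unfolding poly_vs.span_Un by blast
  have "poly_vs.subspace ?I" by (intro poly_vs.subspace_inter ideal_gen_subspace subspace_forms)
  then have i: "i \<in> ?I" using x(3) poly_vs.span_minimal[OF order_refl] by blast
  have fB: "finite ?B" using finite_box by simp
  obtain a where a: "x = (\<Sum>\<beta>\<in>?B. smult_poly (a \<beta>) (homog t \<beta>))"
    by (rule span_image_finite[OF fB x(2)])
  show thesis
  proof (rule that)
    show "i \<in> ideal_gen (Suc N) N grid_gen" using i by simp
    show "p = (\<Sum>\<beta>\<in>?B. smult_poly (a \<beta>) (homog t \<beta>)) + i" using x(1) a by simp
    show "\<forall>\<alpha>\<in>box. eval_poly (pt \<alpha>) p = (\<Sum>\<beta>\<in>?B. a \<beta> * monomial_value \<alpha> \<beta>)"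
      using grid_ideal_vanishes[of i "Suc N"] i
      by (simp add: x(1) a eval_poly_add eval_poly_sum eval_poly_smult eval_homog)
  qed
qed

section \<open>The cutting form and functions on the grid\<close>

lemma cutting_form_spans:
  assumes \<phi>: "\<And>\<alpha>. \<alpha> \<in> box \<Longrightarrow> eval_poly (pt \<alpha>) \<phi> = 0 \<longleftrightarrow> mon_deg \<alpha> < q" and q: "q \<le> socle"
  obtains u v where "u \<in> forms (Suc N) (socle - q)" "v \<in> forms (Suc N) (q - 1)" "q = 0 \<longrightarrow> v = 0"
    "\<forall>\<alpha>\<in>box. h \<alpha> = eval_poly (pt \<alpha>) \<phi> * eval_poly (pt \<alpha>) u + eval_poly (pt \<alpha>) v"
proof -
  \<comment> \<open>\<phi> contributes nothing at the points of degree below \<open>q\<close>, so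
    \<open>v\<close> must take the right values there. For \<open>q = 0\<close> there are no such
    points, and \<open>v = 0\<close> avoids the truncated degree \<open>q - 1\<close>.\<close>
  obtain v where v: "v \<in> forms (Suc N) (q - 1)" "q = 0 \<longrightarrow> v = 0"
    "\<forall>\<alpha>\<in>box. mon_deg \<alpha> < q \<longrightarrow> eval_poly (pt \<alpha>) v = h \<alpha>"
  proof (cases "q = 0")
    case True
    then show thesis by (intro that[of 0]) auto
  next
    case False
    obtain w where w: "w \<in> grid_values (q - 1)" "\<forall>\<alpha>\<in>{\<alpha>\<in>box. mon_deg \<alpha> \<le> q - 1}. w \<alpha> = h \<alpha>"
      using interpolation_low by blast
    then obtain v where "v \<in> forms (Suc N) (q - 1)" "w = (\<lambda>\<alpha>. eval_poly (pt \<alpha>) v)"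
      unfolding grid_values_def by blast
    then show thesis using w(2) False by (intro that[of v]) auto
  qed
  \<comment> \<open>The bound on \<alpha> says that its degree is at least \<open>q\<close>. There
    \<phi> is nonzero, so what \<open>v\<close> leaves over can be divided by \<phi>.\<close>
  obtain w where w: "w \<in> grid_values (socle - q)"
    "\<forall>\<alpha>\<in>{\<alpha>\<in>box. socle \<le> mon_deg \<alpha> + (socle - q)}. w \<alpha> = (h \<alpha> - eval_poly (pt \<alpha>) v) / eval_poly (pt \<alpha>) \<phi>"
    using interpolation_high[of "socle - q" "\<lambda>\<alpha>. (h \<alpha> - eval_poly (pt \<alpha>) v) / eval_poly (pt \<alpha>) \<phi>"] by blast
  then obtain u where u: "u \<in> forms (Suc N) (socle - q)" "w = (\<lambda>\<alpha>. eval_poly (pt \<alpha>) u)"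
    unfolding grid_values_def by blast
  have "h \<alpha> = eval_poly (pt \<alpha>) \<phi> * eval_poly (pt \<alpha>) u + eval_poly (pt \<alpha>) v" if \<alpha>: "\<alpha> \<in> box" for \<alpha>
  proof (cases "mon_deg \<alpha> < q")
    case True
    then show ?thesis using \<phi>[OF \<alpha>] v(3) \<alpha> by simp
  next
    case False
    then have "eval_poly (pt \<alpha>) u = (h \<alpha> - eval_poly (pt \<alpha>) v) / eval_poly (pt \<alpha>) \<phi>"
      using w(2) u(2) \<alpha> q by simp
    then show ?thesis using \<phi>[OF \<alpha>] False by simp
  qed
  then show thesis using u(1) v(1,2) that by blast
qed

text \<open>
  The products of \<open>\<phi>\<close> with the monomials of degree at most \<open>socle - q\<close>, together with the monomials of degree
  below \<open>q\<close>, span all functions on the grid and are exactly as many as its points.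
\<close>

lemma cutting_form_independent:
  assumes \<phi>: "\<And>\<alpha>. \<alpha> \<in> box \<Longrightarrow> eval_poly (pt \<alpha>) \<phi> = 0 \<longleftrightarrow> mon_deg \<alpha> < q" and q: "q \<le> socle"
    and zero: "\<forall>\<alpha>\<in>box. eval_poly (pt \<alpha>) \<phi> * (\<Sum>\<beta>\<in>{\<beta>\<in>box. mon_deg \<beta> + q \<le> socle}. a \<beta> * monomial_value \<alpha> \<beta>)
      + (\<Sum>\<beta>\<in>{\<beta>\<in>box. mon_deg \<beta> < q}. b \<beta> * monomial_value \<alpha> \<beta>) = 0"
  shows "(\<forall>\<beta>\<in>{\<beta>\<in>box. mon_deg \<beta> + q \<le> socle}. a \<beta> = 0) \<and> (\<forall>\<beta>\<in>{\<beta>\<in>box. mon_deg \<beta> < q}. b \<beta> = 0)"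
proof -
  let ?A = "{\<beta>\<in>box. mon_deg \<beta> + q \<le> socle}" and ?B = "{\<beta>\<in>box. mon_deg \<beta> < q}"
  have fin: "finite ?A" "finite ?B" using finite_box by simp_all
  define v where "v j \<alpha> = (case j of Inl \<beta> \<Rightarrow> eval_poly (pt \<alpha>) \<phi> * monomial_value \<alpha> \<beta> | Inr \<beta> \<Rightarrow> monomial_value \<alpha> \<beta>)"
    for j :: "nat monomial + nat monomial" and \<alpha>
  have sum_v: "(\<Sum>j\<in>?A <+> ?B. e j * v j \<alpha>) =
      eval_poly (pt \<alpha>) \<phi> * (\<Sum>\<beta>\<in>?A. e (Inl \<beta>) * monomial_value \<alpha> \<beta>) + (\<Sum>\<beta>\<in>?B. e (Inr \<beta>) * monomial_value \<alpha> \<beta>)"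
    for e \<alpha>
    by (simp add: sum.Plus[OF fin] v_def sum_distrib_left mult.left_commute)
  have "\<forall>j\<in>?A <+> ?B. case_sum a b j = 0"
  proof (rule spanning_functions_independent[where G = box and v = v])
    show "card (?A <+> ?B) \<le> card box"
      using card_box_split[of q] by (simp add: card_Plus[OF fin])
    show "\<forall>\<alpha>\<in>box. (\<Sum>j\<in>?A <+> ?B. case_sum a b j * v j \<alpha>) = 0"
      using zero by (simp add: sum_v)
    fix h
    obtain u w where uw: "u \<in> forms (Suc N) (socle - q)" "w \<in> forms (Suc N) (q - 1)" "q = 0 \<longrightarrow> w = 0"
      "\<forall>\<alpha>\<in>box. h \<alpha> = eval_poly (pt \<alpha>) \<phi> * eval_poly (pt \<alpha>) u + eval_poly (pt \<alpha>) w"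
      using cutting_form_spans[OF \<phi> q] by blast
    \<comment> \<open>Division replaces the interpolating form, on the grid, by a combination of the
      box monomials that \<open>card_box_split\<close> counts.\<close>
    obtain e where e: "\<forall>\<alpha>\<in>box. eval_poly (pt \<alpha>) u = (\<Sum>\<beta>\<in>{\<beta>\<in>box. mon_deg \<beta> \<le> socle - q}. e \<beta> * monomial_value \<alpha> \<beta>)"
      using division_expansion[OF uw(1)] by blast
    have A: "{\<beta>\<in>box. mon_deg \<beta> \<le> socle - q} = ?A" using q by auto
    obtain e' where e': "\<forall>\<alpha>\<in>box. eval_poly (pt \<alpha>) w = (\<Sum>\<beta>\<in>?B. e' \<beta> * monomial_value \<alpha> \<beta>)"
    proof (cases "q = 0")
      case True
      then show thesis using uw(3) that by simp
    next
      case False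
      then have B: "{\<beta>\<in>box. mon_deg \<beta> \<le> q - 1} = ?B" by auto
      obtain e' where "\<forall>\<alpha>\<in>box. eval_poly (pt \<alpha>) w = (\<Sum>\<beta>\<in>{\<beta>\<in>box. mon_deg \<beta> \<le> q - 1}. e' \<beta> * monomial_value \<alpha> \<beta>)"
        using division_expansion[OF uw(2)] by blast
      then show thesis unfolding B by (rule that)
    qed
    show "\<exists>a. \<forall>\<alpha>\<in>box. h \<alpha> = (\<Sum>j\<in>?A <+> ?B. a j * v j \<alpha>)"
      by (intro exI[of _ "case_sum e e'"] ballI) (simp add: sum_v uw(4) e[unfolded A] e')
  qed (use fin finite_box in auto)
  then show ?thesis by (simp add: Plus_def ball_Un)
qed

text \<open>Division leaves a combination of box monomials to be shown zero. For
  \<open>q = 0\<close> the cutting form vanishes nowhere on the grid, so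
  \<open>cutting_form_independent\<close> says that these monomials are independent as
  functions.\<close>

lemma grid_kernel:
  assumes inf: "infinite (UNIV :: 'k set)" and p: "p \<in> forms (Suc N) t"
    and zero: "\<forall>\<alpha>\<in>box. eval_poly (pt \<alpha>) p = 0"
  shows "p \<in> ideal_gen (Suc N) N grid_gen"
proof -
  let ?B = "{\<beta>\<in>box. mon_deg \<beta> \<le> t}"
  obtain a i where ai: "i \<in> ideal_gen (Suc N) N grid_gen"
    "p = (\<Sum>\<beta>\<in>?B. smult_poly (a \<beta>) (homog t \<beta>)) + i"
    "\<forall>\<alpha>\<in>box. eval_poly (pt \<alpha>) p = (\<Sum>\<beta>\<in>?B. a \<beta> * monomial_value \<alpha> \<beta>)"
    using division_expansion[OF p] by blast
  obtain \<phi> where \<phi>: "\<And>\<alpha>. \<alpha> \<in> box \<Longrightarrow> eval_poly (pt \<alpha>) \<phi> = 0 \<longleftrightarrow> mon_deg \<alpha> < 0"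
    using exists_cutting_form[OF inf order_refl[of 0]] by blast
  define e where "e \<beta> = (if mon_deg \<beta> \<le> t then a \<beta> else 0)" for \<beta>
  have box: "{\<beta>\<in>box. mon_deg \<beta> + 0 \<le> socle} = box" using mon_deg_le_socle by auto
  have "(\<Sum>\<beta>\<in>box. e \<beta> * monomial_value \<alpha> \<beta>) = (\<Sum>\<beta>\<in>?B. a \<beta> * monomial_value \<alpha> \<beta>)" for \<alpha>
    by (rule sum.mono_neutral_cong_right) (use finite_box in \<open>auto simp: e_def\<close>)
  then have "\<forall>\<alpha>\<in>box. (\<Sum>\<beta>\<in>box. e \<beta> * monomial_value \<alpha> \<beta>) = 0"
    using ai(3) zero by simp
  then have "\<forall>\<beta>\<in>box. e \<beta> = 0"
    using cutting_form_independent[OF \<phi>, of e "\<lambda>_. 0"] unfolding box by simp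
  then have "\<forall>\<beta>\<in>?B. a \<beta> = 0" by (auto simp: e_def)
  then have "p = i" using ai(2) by simp
  then show ?thesis using ai(1) by simp
qed

section \<open>Special generators: the grid forms, \<phi> and a power of the last variable\<close>

definition gens :: "(nat, 'k) mpoly \<Rightarrow> nat \<Rightarrow> (nat, 'k) mpoly" where
  "gens \<phi> i = (if i \<le> N then grid_gen i else if i = Suc N then \<phi> else var (Suc N) ^ d i)"

lemma gens_form:
  assumes "\<phi> \<in> forms (Suc N) (d (Suc N))" "i \<ge> 1"
  shows "gens \<phi> i \<in> forms (Suc N) (d i)"
  using assms grid_gen_form[of i] forms_power[OF var_in_forms[of "Suc N" "Suc N"], of "d i"]
  by (auto simp: gens_def)

lemma grid_ideal_subset: "ideal_gen (Suc N) N grid_gen \<subseteq> ideal_gen (Suc N) (Suc (Suc N)) (gens \<phi>)"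
proof -
  have "ideal_gen (Suc N) N grid_gen = ideal_gen (Suc N) N (gens \<phi>)"
    by (rule ideal_gen_cong) (simp add: gens_def)
  also have "\<dots> \<subseteq> ideal_gen (Suc N) (Suc (Suc N)) (gens \<phi>)"
    by (rule ideal_gen_mono) simp
  finally show ?thesis .
qed

text \<open>Every function on the grid is a multiple of \<phi> plus the values of a form of degree
  below \<open>q\<close>. The degree bounds leave room to pad both up to degree \<open>t\<close>
  inside the ideal, and what remains vanishes on the grid, hence lies in the grid ideal.\<close>

lemma gens_surjective:
  assumes inf: "infinite (UNIV :: 'k set)" and \<phi>f: "\<phi> \<in> forms (Suc N) (d (Suc N))"
    and \<phi>: "\<And>\<alpha>. \<alpha> \<in> box \<Longrightarrow> eval_poly (pt \<alpha>) \<phi> = 0 \<longleftrightarrow> mon_deg \<alpha> < q" and q: "q \<le> socle"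
    and t1: "socle - q + d (Suc N) \<le> t" and t2: "q = 0 \<or> q - 1 + d (Suc (Suc N)) \<le> t"
  shows "hilbert_function (Suc N) (ideal_gen (Suc N) (Suc (Suc N)) (gens \<phi>)) t = 0"
  unfolding hilbert_function_eq_0_iff
proof
  let ?n = "Suc N" and ?a = "d (Suc N)" and ?b = "d (Suc (Suc N))"
  let ?I = "ideal_gen ?n (Suc ?n) (gens \<phi>)"
  fix p :: "(nat, 'k) mpoly" assume p: "p \<in> forms ?n t"
  obtain u v where uv: "u \<in> forms ?n (socle - q)" "v \<in> forms ?n (q - 1)" "q = 0 \<longrightarrow> v = 0"
    "\<forall>\<alpha>\<in>box. eval_poly (pt \<alpha>) p = eval_poly (pt \<alpha>) \<phi> * eval_poly (pt \<alpha>) u + eval_poly (pt \<alpha>) v"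
    by (rule cutting_form_spans[OF \<phi> q, of "\<lambda>\<alpha>. eval_poly (pt \<alpha>) p"])
  have le_u: "socle - q \<le> t - ?a" using t1 by simp
  obtain u' where u': "u' \<in> forms ?n (t - ?a)" "\<And>\<alpha>. eval_poly (pt \<alpha>) u' = eval_poly (pt \<alpha>) u"
    using pad_form[OF uv(1) le_u] by blast
  have x_n: "var ?n ^ ?b \<in> forms ?n ?b"
    using forms_power[OF var_in_forms[of ?n ?n], of ?b] by simp
  \<comment> \<open>The power of the last variable is 1 on the grid, so \<open>v\<close> has the
    same values as a multiple of that generator.\<close>
  obtain w where w: "w \<in> forms ?n t" "w \<in> ?I" "\<And>\<alpha>. eval_poly (pt \<alpha>) w = eval_poly (pt \<alpha>) v"
  proof (cases "q = 0")
    case True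
    then show thesis
      using that[of 0] uv(3) poly_vs.subspace_0[OF ideal_gen_subspace[of ?n "Suc ?n" "gens \<phi>"]] by auto
  next
    case False
    then have le: "q - 1 \<le> t - ?b" "?b \<le> t" using t2 by auto
    obtain v' where v': "v' \<in> forms ?n (t - ?b)" "\<And>\<alpha>. eval_poly (pt \<alpha>) v' = eval_poly (pt \<alpha>) v"
      using pad_form[OF uv(2) le(1)] by blast
    have "v' * var ?n ^ ?b \<in> forms ?n t"
      using forms_mult[OF v'(1) x_n] le(2) by simp
    moreover have "v' * gens \<phi> (Suc ?n) \<in> ?I"
      by (rule ideal_gen_mult_form[OF v'(1)]) simp
    moreover have "gens \<phi> (Suc ?n) = var ?n ^ ?b" by (simp add: gens_def)
    ultimately show thesis
      using that[of "v' * var ?n ^ ?b"] v'(2) by (simp add: eval_poly_mult eval_poly_power pt_def)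
  qed
  have "u' * \<phi> \<in> forms ?n t" using forms_mult[OF u'(1) \<phi>f] t1 by simp
  then have "p - u' * \<phi> - w \<in> forms ?n t" by (intro forms_diff p w)
  moreover have "\<forall>\<alpha>\<in>box. eval_poly (pt \<alpha>) (p - u' * \<phi> - w) = 0"
    by (simp add: eval_poly_diff eval_poly_mult uv(4) u'(2) w(3))
  ultimately have "p - u' * \<phi> - w \<in> ?I"
    using grid_kernel[OF inf] grid_ideal_subset by blast
  moreover have "u' * gens \<phi> ?n \<in> ?I"
    by (rule ideal_gen_mult_form[OF u'(1)]) simp
  then have "u' * \<phi> \<in> ?I" by (simp add: gens_def)
  ultimately have "(p - u' * \<phi> - w) + u' * \<phi> + w \<in> ?I"
    using w(2) by (intro poly_vs.subspace_add[OF ideal_gen_subspace])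
  then show "p \<in> ?I" by simp
qed

text \<open>The grid ideal vanishes on the grid, while the multiples of \<phi> and of the power of
  the last variable by box monomials are independent there, by
  \<open>cutting_form_independent\<close>. Together with a basis of the grid ideal they bound the
  dimension of the new ideal from below.\<close>

lemma gens_injective:
  assumes inf: "infinite (UNIV :: 'k set)" and \<phi>f: "\<phi> \<in> forms (Suc N) (d (Suc N))"
    and \<phi>: "\<And>\<alpha>. \<alpha> \<in> box \<Longrightarrow> eval_poly (pt \<alpha>) \<phi> = 0 \<longleftrightarrow> mon_deg \<alpha> < q" and q: "q \<le> socle"
    and t1: "\<And>\<beta>. \<beta> \<in> box \<Longrightarrow> mon_deg \<beta> + d (Suc N) \<le> t \<Longrightarrow> mon_deg \<beta> + q \<le> socle"
    and t2: "\<And>\<beta>. \<beta> \<in> box \<Longrightarrow> mon_deg \<beta> + d (Suc (Suc N)) \<le> t \<Longrightarrow> mon_deg \<beta> < q"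
  shows "hilbert_function (Suc N) (ideal_gen (Suc N) (Suc (Suc N)) (gens \<phi>)) t
      + card {\<beta>\<in>box. mon_deg \<beta> + d (Suc N) \<le> t} + card {\<beta>\<in>box. mon_deg \<beta> + d (Suc (Suc N)) \<le> t}
    \<le> card {\<beta>\<in>box. mon_deg \<beta> \<le> t}"
proof -
  let ?n = "Suc N" and ?a = "d (Suc N)" and ?b = "d (Suc (Suc N))"
  let ?I = "ideal_gen ?n (Suc ?n) (gens \<phi>) \<inter> forms ?n t"
  let ?K = "ideal_gen ?n N grid_gen \<inter> forms ?n t"
  let ?E1 = "{\<beta>\<in>box. mon_deg \<beta> + ?a \<le> t}" and ?E2 = "{\<beta>\<in>box. mon_deg \<beta> + ?b \<le> t}"
  have fE: "finite ?E1" "finite ?E2" using finite_box by simp_all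
  obtain S :: "(nat, 'k) mpoly set" where S: "finite S" "?K \<subseteq> poly_vs.span S"
    by (rule ideal_forms_finite_span)
  obtain S' :: "(nat, 'k) mpoly set" where S': "finite S'" "?I \<subseteq> poly_vs.span S'"
    by (rule ideal_forms_finite_span)
  obtain B where B: "finite B" "B \<subseteq> ?K" "poly_vs.independent B" "?K \<subseteq> poly_vs.span B" "card B = poly_vs.dim ?K"
    by (rule poly_vs.finite_spanned_subset_basis[OF S])
  have x_n: "var ?n ^ ?b \<in> forms ?n ?b"
    using forms_power[OF var_in_forms[of ?n ?n], of ?b] by simp
  define v where "v = case_sum (\<lambda>x. x) (case_sum (\<lambda>\<beta>. homog (t - ?a) \<beta> * \<phi>) (\<lambda>\<beta>. homog (t - ?b) \<beta> * var ?n ^ ?b))"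
  have "card (B <+> (?E1 <+> ?E2)) \<le> poly_vs.dim ?I"
  proof (rule poly_vs.family_card_le_dim[OF _ S'])
    show "finite (B <+> (?E1 <+> ?E2))" using B(1) fE by simp
  next
    fix j assume "j \<in> B <+> (?E1 <+> ?E2)"
    then consider x where "j = Inl x" "x \<in> B" | \<beta> where "j = Inr (Inl \<beta>)" "\<beta> \<in> ?E1" | \<beta> where "j = Inr (Inr \<beta>)" "\<beta> \<in> ?E2"
      by (auto simp: Plus_def)
    then show "v j \<in> ?I"
    proof cases
      case 1
      then show ?thesis using B(2) grid_ideal_subset[of \<phi>] by (auto simp: v_def)
    next
      case 2
      then have h: "homog (t - ?a) \<beta> \<in> forms ?n (t - ?a)" by (intro homog_form) auto
      then have "homog (t - ?a) \<beta> * gens \<phi> ?n \<in> ideal_gen ?n (Suc ?n) (gens \<phi>)"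
        by (rule ideal_gen_mult_form) simp
      then show ?thesis using forms_mult[OF h \<phi>f] 2 by (simp add: v_def gens_def)
    next
      case 3
      then have h: "homog (t - ?b) \<beta> \<in> forms ?n (t - ?b)" by (intro homog_form) auto
      then have "homog (t - ?b) \<beta> * gens \<phi> (Suc ?n) \<in> ideal_gen ?n (Suc ?n) (gens \<phi>)"
        by (rule ideal_gen_mult_form) simp
      then show ?thesis using forms_mult[OF h x_n] 3 by (simp add: v_def gens_def)
    qed
  next
    fix e assume e: "(\<Sum>j\<in>B <+> (?E1 <+> ?E2). smult_poly (e j) (v j)) = 0"
    have sum_eq: "(\<Sum>x\<in>B. smult_poly (e (Inl x)) x)
        + ((\<Sum>\<beta>\<in>?E1. smult_poly (e (Inr (Inl \<beta>))) (homog (t - ?a) \<beta> * \<phi>))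
          + (\<Sum>\<beta>\<in>?E2. smult_poly (e (Inr (Inr \<beta>))) (homog (t - ?b) \<beta> * var ?n ^ ?b))) = 0"
      using e B(1) fE by (simp add: sum.Plus v_def)
    \<comment> \<open>Extension by zero to the index sets of
      \<open>cutting_form_independent\<close>, which contain \<open>?E1\<close> and
      \<open>?E2\<close> by the assumptions on \<open>t\<close>.\<close>
    define a where "a \<beta> = (if mon_deg \<beta> + ?a \<le> t then e (Inr (Inl \<beta>)) else 0)" for \<beta>
    define b where "b \<beta> = (if mon_deg \<beta> + ?b \<le> t then e (Inr (Inr \<beta>)) else 0)" for \<beta>
    have "eval_poly (pt \<alpha>) \<phi> * (\<Sum>\<beta>\<in>{\<beta>\<in>box. mon_deg \<beta> + q \<le> socle}. a \<beta> * monomial_value \<alpha> \<beta>)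
      + (\<Sum>\<beta>\<in>{\<beta>\<in>box. mon_deg \<beta> < q}. b \<beta> * monomial_value \<alpha> \<beta>) = 0" if \<alpha>: "\<alpha> \<in> box" for \<alpha>
    proof -
      have "eval_poly (pt \<alpha>) x = 0" if "x \<in> B" for x
        using B(2) that grid_ideal_vanishes[OF _ \<alpha>] by blast
      then have "eval_poly (pt \<alpha>) \<phi> * (\<Sum>\<beta>\<in>?E1. e (Inr (Inl \<beta>)) * monomial_value \<alpha> \<beta>)
          + (\<Sum>\<beta>\<in>?E2. e (Inr (Inr \<beta>)) * monomial_value \<alpha> \<beta>) = 0"
        using arg_cong[OF sum_eq, of "eval_poly (pt \<alpha>)"]
        by (simp add: eval_poly_add eval_poly_sum eval_poly_smult eval_poly_mult eval_poly_power eval_homog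
            pt_def[of _ "Suc N"] sum_distrib_left mult_ac)
      moreover have "(\<Sum>\<beta>\<in>{\<beta>\<in>box. mon_deg \<beta> + q \<le> socle}. a \<beta> * monomial_value \<alpha> \<beta>)
          = (\<Sum>\<beta>\<in>?E1. e (Inr (Inl \<beta>)) * monomial_value \<alpha> \<beta>)"
        by (rule sum.mono_neutral_cong_right) (use finite_box t1 in \<open>auto simp: a_def\<close>)
      moreover have "(\<Sum>\<beta>\<in>{\<beta>\<in>box. mon_deg \<beta> < q}. b \<beta> * monomial_value \<alpha> \<beta>)
          = (\<Sum>\<beta>\<in>?E2. e (Inr (Inr \<beta>)) * monomial_value \<alpha> \<beta>)"
        by (rule sum.mono_neutral_cong_right) (use finite_box t2 in \<open>auto simp: b_def\<close>)
      ultimately show ?thesis by simp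
    qed
    then have ab: "(\<forall>\<beta>\<in>{\<beta>\<in>box. mon_deg \<beta> + q \<le> socle}. a \<beta> = 0) \<and> (\<forall>\<beta>\<in>{\<beta>\<in>box. mon_deg \<beta> < q}. b \<beta> = 0)"
      by (intro cutting_form_independent[OF \<phi> q]) auto
    have e1: "e (Inr (Inl \<beta>)) = 0" if "\<beta> \<in> ?E1" for \<beta>
      using ab that t1 by (auto simp: a_def)
    have e2: "e (Inr (Inr \<beta>)) = 0" if "\<beta> \<in> ?E2" for \<beta>
      using ab that t2 by (auto simp: b_def)
    have "(\<Sum>x\<in>B. smult_poly (e (Inl x)) x) = 0"
      using sum_eq e1 e2 by simp
    then have "\<forall>x\<in>B. e (Inl x) = 0"
      using B(1,3) poly_vs.independent_explicit_finite_subsets[of B]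
      by (metis (no_types) order_refl)
    then show "\<forall>j\<in>B <+> (?E1 <+> ?E2). e j = 0" using e1 e2 by (auto simp: Plus_def)
  qed
  then have "poly_vs.dim ?K + card ?E1 + card ?E2 \<le> poly_vs.dim ?I"
    using B(1,5) fE by (simp add: card_Plus)
  \<comment> \<open>This bounds the grid ideal from below in degree \<open>t\<close>, hence the
    Hilbert function of the larger ideal from above.\<close>
  moreover have "hilbert_function ?n (ideal_gen ?n N grid_gen) t \<le> card (homog t ` {\<beta>\<in>box. mon_deg \<beta> \<le> t})"
    by (rule hilbert_function_le_card) (use finite_box division in auto)
  moreover have "card (homog t ` {\<beta>\<in>box. mon_deg \<beta> \<le> t}) \<le> card {\<beta>\<in>box. mon_deg \<beta> \<le> t}"
    using finite_box by (intro card_image_le) simp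
  ultimately show ?thesis
    using hilbert_function_add_dim[OF ideal_gen_subspace[of ?n N grid_gen], of ?n t]
      hilbert_function_add_dim[OF ideal_gen_subspace[of ?n "Suc ?n" "gens \<phi>"], of ?n t] by linarith
qed

text \<open>Filling up with the last variable to degree \<open>t\<close> turns box monomials into
  reduced monomials in N + 1 variables.\<close>

lemma card_box_le: "of_nat (card {\<beta>\<in>box. mon_deg \<beta> \<le> t}) = fps_nth (froberg_series (Suc N) N d) t"
proof -
  let ?f = "\<lambda>\<beta>. \<beta> + Poly_Mapping.single (Suc N) (t - mon_deg \<beta>)"
  have "bij_betw ?f {\<beta>\<in>box. mon_deg \<beta> \<le> t} (reduced_monomials (Suc N) N d t)"
  proof (rule bij_betwI')
    fix \<beta> \<beta>' assume \<beta>: "\<beta> \<in> {\<beta>\<in>box. mon_deg \<beta> \<le> t}" "\<beta>' \<in> {\<beta>\<in>box. mon_deg \<beta> \<le> t}"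
    show "?f \<beta> = ?f \<beta>' \<longleftrightarrow> \<beta> = \<beta>'"
    proof
      assume eq: "?f \<beta> = ?f \<beta>'"
      show "\<beta> = \<beta>'"
      proof (rule box_eqI)
        fix k assume "k \<in> {1..N}"
        then show "Poly_Mapping.lookup \<beta> k = Poly_Mapping.lookup \<beta>' k"
          using arg_cong[OF eq, of "\<lambda>m. Poly_Mapping.lookup m k"] by (simp add: lookup_add lookup_single)
      qed (use \<beta> in auto)
    qed simp
  next
    fix \<beta> assume "\<beta> \<in> {\<beta>\<in>box. mon_deg \<beta> \<le> t}"
    then show "?f \<beta> \<in> reduced_monomials (Suc N) N d t"
      by (auto simp: reduced_monomials_def monomials_def box_def keys_add_nat lookup_add lookup_single when_def)
  next
    fix m assume m: "m \<in> reduced_monomials (Suc N) N d t"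
    then have mm: "m \<in> monomials (Suc N) t" by (simp add: reduced_monomials_def)
    have kn: "Suc N \<in> {1..Suc N}" by simp
    obtain \<beta> where \<beta>: "m = \<beta> + Poly_Mapping.single (Suc N) (Poly_Mapping.lookup m (Suc N))"
      by (rule monomials_shift[OF kn mm order_refl])
    have "Poly_Mapping.lookup \<beta> (Suc N) = 0"
      using arg_cong[OF \<beta>, of "\<lambda>m. Poly_Mapping.lookup m (Suc N)"] by (simp add: lookup_add)
    then have "Suc N \<notin> Poly_Mapping.keys \<beta>" by (simp add: in_keys_iff)
    moreover have "Poly_Mapping.keys \<beta> \<subseteq> {1..Suc N}"
      using mm arg_cong[OF \<beta>, of Poly_Mapping.keys] by (auto simp: monomials_def keys_add_nat)
    ultimately have keys: "Poly_Mapping.keys \<beta> \<subseteq> {1..N}" by (auto simp: atLeastAtMostSuc_conv)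
    have "Poly_Mapping.lookup \<beta> k < d k" if "k \<in> {1..N}" for k
    proof -
      have "Poly_Mapping.lookup m k = Poly_Mapping.lookup \<beta> k"
        using arg_cong[OF \<beta>, of "\<lambda>m. Poly_Mapping.lookup m k"] that by (simp add: lookup_add lookup_single)
      moreover have "Poly_Mapping.lookup m k < d k" using m that by (simp add: reduced_monomials_def)
      ultimately show ?thesis by simp
    qed
    then have "\<beta> \<in> box" using keys by (simp add: box_def)
    moreover have "t = mon_deg \<beta> + Poly_Mapping.lookup m (Suc N)"
      using mm arg_cong[OF \<beta>, of mon_deg] by (simp add: monomials_def)
    ultimately show "\<exists>\<beta>\<in>{\<beta>\<in>box. mon_deg \<beta> \<le> t}. m = ?f \<beta>"
      using \<beta> by (intro bexI[of _ \<beta>]) auto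
  qed
  then have "card {\<beta>\<in>box. mon_deg \<beta> \<le> t} = card (reduced_monomials (Suc N) N d t)"
    by (rule bij_betw_same_card)
  then show ?thesis by (simp add: card_reduced_monomials)
qed

lemma card_box_shift:
  "of_nat (card {\<beta>\<in>box. mon_deg \<beta> + e \<le> t}) = (if e \<le> t then fps_nth (froberg_series (Suc N) N d) (t - e) else 0)"
proof (cases "e \<le> t")
  case True
  then have "{\<beta>\<in>box. mon_deg \<beta> + e \<le> t} = {\<beta>\<in>box. mon_deg \<beta> \<le> t - e}" by auto
  then show ?thesis using True card_box_le by simp
next
  case False
  then have "{\<beta>\<in>box. mon_deg \<beta> + e \<le> t} = {}" by auto
  then show ?thesis using False by (metis (lifting) card.empty of_nat_0)
qed

lemma exists_surjective_gens:
  assumes inf: "infinite (UNIV :: 'k set)" and ab: "d (Suc N) \<le> d (Suc (Suc N))" "socle \<le> d (Suc N) + d (Suc (Suc N))"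
    and pos: "0 < d (Suc N)"
    and t: "socle + d (Suc N) + d (Suc (Suc N)) \<le> 2 * t + 1"
  shows "\<exists>\<phi>\<in>forms (Suc N) (d (Suc N)). hilbert_function (Suc N) (ideal_gen (Suc N) (Suc (Suc N)) (gens \<phi>)) t = 0"
proof -
  \<comment> \<open>The smallest \<open>q\<close> with \<open>socle - q + d (Suc N) \<le> t\<close>.
    The bound on \<open>t\<close> leaves enough room for the other multipliers, and together with
    \<open>socle \<le> d (Suc N) + d (Suc (Suc N))\<close> it forces \<open>socle \<le> t\<close>,
    hence \<open>q \<le> d (Suc N)\<close>.\<close>
  define q where "q = socle + d (Suc N) - t"
  have q: "q \<le> d (Suc N)" "q \<le> socle" using ab pos t by (auto simp: q_def)
  obtain \<phi> where \<phi>: "\<phi> \<in> forms (Suc N) (d (Suc N))"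
    "\<And>\<alpha>. \<alpha> \<in> box \<Longrightarrow> eval_poly (pt \<alpha>) \<phi> = 0 \<longleftrightarrow> mon_deg \<alpha> < q"
    using exists_cutting_form[OF inf q(1)] by blast
  have "hilbert_function (Suc N) (ideal_gen (Suc N) (Suc (Suc N)) (gens \<phi>)) t = 0"
    by (rule gens_surjective[OF inf \<phi> q(2)]) (use ab pos t in \<open>auto simp: q_def\<close>)
  then show ?thesis using \<phi>(1) by blast
qed

lemma exists_injective_gens:
  assumes inf: "infinite (UNIV :: 'k set)" and ab: "d (Suc N) \<le> d (Suc (Suc N))" "socle \<le> d (Suc N) + d (Suc (Suc N))"
    and t: "2 * t + 1 \<le> socle + d (Suc N) + d (Suc (Suc N))"
  shows "\<exists>\<phi>\<in>forms (Suc N) (d (Suc N)). of_nat (hilbert_function (Suc N) (ideal_gen (Suc N) (Suc (Suc N)) (gens \<phi>)) t)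
    \<le> fps_nth (froberg_series (Suc N) (Suc (Suc N)) d) t"
proof -
  let ?a = "d (Suc N)" and ?b = "d (Suc (Suc N))"
  \<comment> \<open>The smallest \<open>q\<close> such that every degree \<open>e\<close> with
    \<open>e + ?b \<le> t\<close> is below \<open>q\<close>. The requirement
    \<open>q \<le> ?a\<close> amounts to \<open>t < ?a + ?b\<close>.\<close>
  define q where "q = t + 1 - ?b"
  have q: "q \<le> ?a" "q \<le> socle" using ab t by (auto simp: q_def)
  obtain \<phi> where \<phi>: "\<phi> \<in> forms (Suc N) ?a"
    "\<And>\<alpha>. \<alpha> \<in> box \<Longrightarrow> eval_poly (pt \<alpha>) \<phi> = 0 \<longleftrightarrow> mon_deg \<alpha> < q"
    using exists_cutting_form[OF inf q(1)] by blast
  let ?h = "hilbert_function (Suc N) (ideal_gen (Suc N) (Suc (Suc N)) (gens \<phi>)) t"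
  have "?h + card {\<beta>\<in>box. mon_deg \<beta> + ?a \<le> t} + card {\<beta>\<in>box. mon_deg \<beta> + ?b \<le> t} \<le> card {\<beta>\<in>box. mon_deg \<beta> \<le> t}"
  proof (rule gens_injective[OF inf \<phi> q(2)])
    fix \<beta> assume "\<beta> \<in> box" "mon_deg \<beta> + ?a \<le> t"
    then show "mon_deg \<beta> + q \<le> socle" using mon_deg_le_socle[of \<beta>] t by (auto simp: q_def)
  next
    fix \<beta> assume "\<beta> \<in> box" "mon_deg \<beta> + ?b \<le> t"
    then show "mon_deg \<beta> < q" by (auto simp: q_def)
  qed
  then have "(of_nat ?h :: rat) + of_nat (card {\<beta>\<in>box. mon_deg \<beta> + ?a \<le> t}) + of_nat (card {\<beta>\<in>box. mon_deg \<beta> + ?b \<le> t})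
      \<le> of_nat (card {\<beta>\<in>box. mon_deg \<beta> \<le> t})"
    by (simp only: of_nat_add[symmetric] of_nat_le_iff)
  \<comment> \<open>In this range the term z^(a + b) of (1 - z^a)(1 - z^b) does not contribute, so
    the coefficient is the plain difference of the three counts.\<close>
  moreover have "t < ?a + ?b" using ab t by linarith
  ultimately have "of_nat ?h \<le> fps_nth (froberg_series (Suc N) (Suc (Suc N)) d) t"
    unfolding card_box_le card_box_shift by (auto simp: froberg_series_nth_Suc)
  then show ?thesis using \<phi>(1) by blast
qed

end

section \<open>Numerical conditions\<close>

lemma delta_eq_sum:
  assumes "\<forall>k\<in>{1..i}. 0 < d k"
  shows "delta d i = (\<Sum>k=1..i. d k - 1)"
proof -
  have "(\<Sum>k=1..i. d k) = (\<Sum>k=1..i. (d k - 1) + 1)"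
    by (rule sum.cong) (use assms in auto)
  also have "\<dots> = (\<Sum>k=1..i. d k - 1) + i"
    by (subst sum.distrib) simp
  finally show ?thesis by (simp add: delta_def)
qed

lemma delta_Suc:
  assumes "\<forall>k\<in>{1..Suc i}. 0 < d k"
  shows "delta d (Suc i) = delta d i + (d (Suc i) - 1)"
  using assms by (simp add: delta_eq_sum)

lemma delta_0: "delta d 0 = 0"
  by (simp add: delta_def)

text \<open>For \<open>N \<le> 2\<close> the sum has at most two terms, each below the degrees on
  the right, called a and b here. Otherwise the condition at \<open>Suc N\<close> gives
  \<open>delta d N\<close> \<le> 2a + 1, whichever term attains the minimum, and the condition at
  \<open>Suc (Suc N)\<close> gives \<open>delta d N\<close> \<le> b or \<open>delta d N\<close> + a
  \<le> 2b + 2. The first bound suffices for a < b, the second for a = b \<ge> 2.\<close>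

lemma delta_le_next_degrees:
  assumes pos: "\<forall>k\<in>{1..Suc (Suc N)}. 0 < d k" and mono: "mono_on {1..Suc (Suc N)} d"
    and sig: "\<forall>i\<in>{4..Suc (Suc N)}. sigma d (i - 1) \<le> d i"
  shows "delta d N \<le> d (Suc N) + d (Suc (Suc N))"
proof -
  let ?a = "d (Suc N)" and ?b = "d (Suc (Suc N))"
  have le: "d k \<le> ?a" if "k \<in> {1..Suc N}" for k
    using mono_onD[OF mono, of k "Suc N"] that by simp
  have ab: "?a \<le> ?b" using mono_onD[OF mono, of "Suc N" "Suc (Suc N)"] by simp
  have a0: "0 < ?a" using pos by simp
  consider "N = 0" | "N = 1" | "N = 2" | "3 \<le> N" by linarith
  then show ?thesis
  proof cases
    case 1
    then show ?thesis by (simp add: delta_0)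
  next
    case 2
    then show ?thesis using le[of 1] by (simp add: delta_eq_sum pos)
  next
    case 3
    then have "delta d N = (d 1 - 1) + (d 2 - 1)"
      using pos by (simp add: delta_eq_sum numeral_2_eq_2)
    then show ?thesis using 3 le[of 1] le[of 2] ab by simp
  next
    case 4
    then obtain M where M: "N = Suc M" by (cases N) auto
    have dN: "delta d N = delta d M + (d N - 1)" "delta d (Suc N) = delta d N + (?a - 1)"
      using delta_Suc[of M d] delta_Suc[of N d] pos by (auto simp: M)
    have "d N \<le> ?a" using le[of N] 4 by simp
    have "min (delta d M) (delta d N div 2) \<le> ?a"
      using sig[rule_format, of "Suc N"] 4 by (simp add: sigma_def M)
    then have s1: "delta d N \<le> 2 * ?a + 1"
      using \<open>d N \<le> ?a\<close> dN(1) by linarith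
    have "min (delta d N) (delta d (Suc N) div 2) \<le> ?b"
      using sig[rule_format, of "Suc (Suc N)"] 4 by (simp add: sigma_def)
    then have s2: "delta d N \<le> ?b \<or> delta d N + ?a \<le> 2 * ?b + 2"
      using dN(2) a0 by linarith
    \<comment> \<open>The case \<open>?a = ?b = 1\<close> escapes \<open>s1\<close> and
      \<open>s2\<close>; there all degrees up to \<open>N\<close> are 1.\<close>
    have "delta d N = 0" if "?a = 1"
    proof -
      have "d k - 1 = 0" if "k \<in> {1..N}" for k using le[of k] that \<open>?a = 1\<close> by simp
      then show ?thesis using pos by (simp add: delta_eq_sum)
    qed
    then show ?thesis using s1 s2 ab a0 by linarith
  qed
qed

text \<open>Applied with \<open>r = n + 1\<close>: every \<open>t\<close> above the degree of the
  last form satisfies \<open>delta d r < 2 * t\<close>, the vanishing criterion for the first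
  \<open>n + 1\<close> forms. For \<open>r \<ge> 3\<close> either term of the minimum in
  \<open>sigma\<close> gives the bound.\<close>

lemma delta_le_twice_last_degree:
  assumes pos: "\<forall>k\<in>{1..Suc r}. 0 < d k" and mono: "mono_on {1..Suc r} d" and r: "2 \<le> r"
    and sig: "\<forall>i\<in>{4..Suc r}. sigma d (i - 1) \<le> d i"
  shows "delta d r \<le> 2 * d (Suc r) + 1"
proof -
  have le: "d k \<le> d (Suc r)" if "k \<in> {1..Suc r}" for k
    using mono_onD[OF mono, of k "Suc r"] that by simp
  obtain s where s: "r = Suc s" using r by (cases r) auto
  show ?thesis
  proof (cases "r = 2")
    case True
    then have "delta d r = (d 1 - 1) + (d 2 - 1)"
      using pos by (simp add: delta_eq_sum numeral_2_eq_2)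
    then show ?thesis using True le[of 1] le[of 2] by simp
  next
    case False
    have "delta d r = delta d s + (d r - 1)"
      using delta_Suc[of s d] pos by (auto simp: s)
    moreover have "d r \<le> d (Suc r)" using le[of r] r by simp
    moreover have "min (delta d s) (delta d r div 2) \<le> d (Suc r)"
      using sig[rule_format, of "Suc r"] r False by (simp add: sigma_def s)
    ultimately show ?thesis by linarith
  qed
qed

section \<open>The truncated series\<close>

text \<open>As long as the new coefficients are positive, the lower bound from \<open>ge\<close> and
  the upper bound \<open>up\<close> meet. At a nonpositive coefficient \<open>up\<close> forces the
  value 0, and \<open>van\<close> keeps it 0 from there on, just as the truncation does.\<close>

lemma fps_ceil_step:
  fixes A :: "rat fps" and h h' :: "nat \<Rightarrow> nat"
  assumes h: "\<And>t. of_nat (h t) = fps_nth (fps_ceil A) t"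
    and low: "\<And>t. t < e \<Longrightarrow> h' t = h t"
    and ge: "\<And>t. e \<le> t \<Longrightarrow> h t \<le> h' t + h (t - e)"
    and up: "\<And>t. h' t = 0 \<or> of_nat (h' t) \<le> fps_nth (A * (1 - fps_X ^ e)) t"
    and van: "\<And>s t. h' s = 0 \<Longrightarrow> s \<le> t \<Longrightarrow> h' t = 0"
    and e: "0 < e"
  shows "of_nat (h' t) = fps_nth (fps_ceil (A * (1 - fps_X ^ e))) t"
proof -
  let ?A = "A * (1 - fps_X ^ e)"
  have A_nth: "fps_nth ?A t = fps_nth A t - (if e \<le> t then fps_nth A (t - e) else 0)" for t
    by (rule fps_nth_mult_one_minus_X_power)
  show ?thesis
  proof (cases "\<forall>j\<le>t. 0 < fps_nth ?A j")
    case True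
    \<comment> \<open>The old coefficient in degree \<open>j\<close> is the new one plus, if
      \<open>e \<le> j\<close>, the old one in degree \<open>j - e\<close>. So positivity passes to
      the old series, which is then not truncated up to \<open>t\<close>.\<close>
    have A_pos: "0 < fps_nth A j" if "j \<le> t" for j
      using that
    proof (induction j rule: less_induct)
      case (less j)
      have "0 < fps_nth A (j - e)" if "e \<le> j" using less that e by auto
      moreover have "0 < fps_nth ?A j" using True less.prems by blast
      ultimately show ?case unfolding A_nth by (auto split: if_splits)
    qed
    then have hA: "of_nat (h j) = fps_nth A j" if "j \<le> t" for j
      using that by (simp add: h fps_ceil_def)
    have "fps_nth ?A t \<le> of_nat (h' t)"
    proof (cases "e \<le> t")
      case True
      then have "(of_nat (h t) :: rat) \<le> of_nat (h' t) + of_nat (h (t - e))"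
        using ge[OF True] by (simp flip: of_nat_add)
      then show ?thesis using True hA[of t] hA[of "t - e"] by (simp add: A_nth)
    next
      case False
      then show ?thesis using low[of t] hA[of t] by (simp add: A_nth)
    qed
    moreover have "0 < fps_nth ?A t" using True by blast
    ultimately have "of_nat (h' t) = fps_nth ?A t" using up[of t] by force
    then show ?thesis using True by (simp add: fps_ceil_def)
  next
    case False
    then obtain j where j: "j \<le> t" "fps_nth ?A j \<le> 0" by (auto simp: not_less)
    then have "(of_nat (h' j) :: rat) \<le> 0" using up[of j] by auto
    then have "h' j = 0" by simp
    then have "h' t = 0" using van j(1) by blast
    then show ?thesis using False by (auto simp: fps_ceil_def)
  qed
qed

lemma froberg_series_nth_0:
  assumes "\<forall>i\<in>{1..r}. 0 < d i"
  shows "fps_nth (froberg_series n r d) 0 = 1"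
  using assms
proof (induction r)
  case 0
  have "monomials n 0 = {0}"
    by (auto simp: monomials_def mon_deg_def) (metis in_keys_iff keys_eq_empty subset_empty subsetI)
  then show ?case by (simp add: froberg_series_eq)
next
  case (Suc r)
  then show ?case by (simp add: froberg_series_nth_Suc)
qed

lemma hilbert_function_no_generators:
  fixes f :: "nat \<Rightarrow> (nat, 'k::field) mpoly"
  shows "hilbert_function n (ideal_gen n 0 f) t = card (monomials n t)"
proof (rule antisym)
  have "forms n t \<subseteq> poly_vs.span ((\<lambda>m. Poly_Mapping.single m (1::'k)) ` monomials n t \<union> (ideal_gen n 0 f \<inter> forms n t))"
    by (rule subset_trans[OF forms_span poly_vs.span_mono]) blast
  then have "hilbert_function n (ideal_gen n 0 f) t \<le> card ((\<lambda>m. Poly_Mapping.single m (1::'k)) ` monomials n t)"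
    by (intro hilbert_function_le_card) (use finite_monomials in auto)
  also have "\<dots> \<le> card (monomials n t)" by (rule card_image_le[OF finite_monomials])
  finally show "hilbert_function n (ideal_gen n 0 f) t \<le> card (monomials n t)" .
next
  have "card (monomials n t) \<le> poly_vs.dim (forms n t :: (nat, 'k) mpoly set)"
  proof (rule poly_vs.family_card_le_dim[OF finite_monomials _ forms_span])
    fix a assume z: "(\<Sum>m\<in>monomials n t. smult_poly (a m) (Poly_Mapping.single m (1::'k))) = 0"
    show "\<forall>m\<in>monomials n t. a m = 0"
    proof
      fix m assume m: "m \<in> monomials n t"
      have "(\<Sum>m'\<in>monomials n t. Poly_Mapping.lookup (Poly_Mapping.single m' (a m')) m) = 0"
        using arg_cong[OF z, of "\<lambda>p. Poly_Mapping.lookup p m"] by (simp add: lookup_sum)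
      then show "a m = 0"
        using m finite_monomials by (simp add: lookup_single when_def)
    qed
  qed (use finite_monomials forms_single in auto)
  moreover have "ideal_gen n 0 f \<inter> forms n t = poly_vs.span {}"
    using ideal_forms_eq_span[of 0 f n d t for d] by (simp add: gen_index_def)
  then have "poly_vs.dim (ideal_gen n 0 f \<inter> forms n t) \<le> card ({} :: (nat, 'k) mpoly set)"
    by (intro poly_vs.dim_le_card) auto
  ultimately show "card (monomials n t) \<le> hilbert_function n (ideal_gen n 0 f) t"
    using hilbert_function_add_dim[OF ideal_gen_subspace[of n 0 f], of n t] by simp
qed

text \<open>A monomial that is not reduced is a multiple of one of the powers, so the reduced ones
  span modulo the ideal.\<close>

lemma var_powers_hilbert_function_le:
  assumes "r \<le> n"
  shows "of_nat (hilbert_function n (ideal_gen n r (\<lambda>k. var k ^ d k :: (nat, 'k::field) mpoly)) t)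
    \<le> fps_nth (froberg_series n r d) t"
proof -
  let ?f = "\<lambda>k. var k ^ d k :: (nat, 'k) mpoly"
  let ?T = "(\<lambda>m. Poly_Mapping.single m (1::'k)) ` reduced_monomials n r d t"
  have "forms n t \<subseteq> poly_vs.span (?T \<union> (ideal_gen n r ?f \<inter> forms n t))"
  proof (rule forms_subset_spanI, rule poly_vs.span_base)
    fix m assume m: "m \<in> monomials n t"
    show "Poly_Mapping.single m 1 \<in> ?T \<union> (ideal_gen n r ?f \<inter> forms n t)"
    proof (cases "m \<in> reduced_monomials n r d t")
      case False
      then obtain k where k: "k \<in> {1..r}" "d k \<le> Poly_Mapping.lookup m k"
        using m by (auto simp: reduced_monomials_def not_less)
      then have "k \<in> {1..n}" using assms by simp
      then obtain m' where m': "m = m' + Poly_Mapping.single k (d k)" "m' \<in> monomials n (t - d k)"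
        using monomials_shift[OF _ m k(2)] by blast
      have "Poly_Mapping.single m' 1 * ?f k \<in> ideal_gen n r ?f"
        by (rule ideal_gen_mult_form[OF forms_single[OF m'(2)] k(1)])
      moreover have "Poly_Mapping.single m 1 = Poly_Mapping.single m' 1 * ?f k"
        by (simp add: m'(1) var_power mult_single)
      ultimately have "Poly_Mapping.single m 1 \<in> ideal_gen n r ?f" by simp
      then show ?thesis using forms_single[OF m] by blast
    qed simp
  qed
  then have "hilbert_function n (ideal_gen n r ?f) t \<le> card ?T"
    by (intro hilbert_function_le_card) (use finite_reduced_monomials in auto)
  also have "\<dots> \<le> card (reduced_monomials n r d t)"
    by (rule card_image_le[OF finite_reduced_monomials])
  finally have "(of_nat (hilbert_function n (ideal_gen n r ?f) t) :: rat) \<le> of_nat (card (reduced_monomials n r d t))"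
    by simp
  then show ?thesis by (simp only: card_reduced_monomials[OF assms])
qed

section \<open>Generic forms\<close>

text \<open>Fixes the generators themselves, since the induction on \<open>r\<close> passes to an
  initial segment of them.\<close>

definition generic_family :: "'k::field set \<Rightarrow> nat \<Rightarrow> nat \<Rightarrow> (nat \<Rightarrow> nat) \<Rightarrow> (nat \<Rightarrow> (nat, 'k) mpoly) \<Rightarrow> bool" where
  "generic_family F n r d f \<longleftrightarrow> (\<forall>i\<in>{1..r}. f i \<in> forms n (d i)) \<and>
     alg_independent F (SIGMA i:{1..r}. monomials n (d i)) (\<lambda>(i, m). Poly_Mapping.lookup (f i) m)"

lemma generic_family_antimono:
  assumes "generic_family F n r d f" "s \<le> r"
  shows "generic_family F n s d f"
proof -
  have "(SIGMA i:{1..s}. monomials n (d i)) \<subseteq> (SIGMA i:{1..r}. monomials n (d i))"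
    using assms(2) by auto
  then show ?thesis
    using assms unfolding generic_family_def alg_independent_def by (meson atLeastAtMost_iff le_trans subset_trans)
qed

lemma generic_family_hilbert_function_le:
  fixes f g :: "nat \<Rightarrow> (nat, 'k::field) mpoly"
  assumes "is_subfield F" "generic_family F n r d f" "\<And>i. i \<in> {1..r} \<Longrightarrow> g i \<in> forms n (d i)"
  shows "hilbert_function n (ideal_gen n r f) t \<le> hilbert_function n (ideal_gen n r g) t"
  by (rule hilbert_function_generic_le[where F = F and d = d])
    (use assms in \<open>auto simp: generic_family_def\<close>)

context
  fixes F :: "'k::field set" and n :: nat and d :: "nat \<Rightarrow> nat" and f :: "nat \<Rightarrow> (nat, 'k) mpoly"
  assumes inf: "infinite (UNIV :: 'k set)" and F: "is_subfield F"
begin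

lemma generic_le_froberg_complete_intersection:
  assumes "generic_family F n r d f" "r \<le> n"
  shows "of_nat (hilbert_function n (ideal_gen n r f) t) \<le> fps_nth (froberg_series n r d) t"
proof -
  have "hilbert_function n (ideal_gen n r f) t \<le> hilbert_function n (ideal_gen n r (\<lambda>k. var k ^ d k :: (nat, 'k) mpoly)) t"
  proof (rule generic_family_hilbert_function_le[OF F assms(1)])
    fix i assume "i \<in> {1..r}"
    then show "(var i ^ d i :: (nat, 'k) mpoly) \<in> forms n (d i)"
      using forms_power[OF var_in_forms[of i n], of "d i"] assms(2) by simp
  qed
  then have "(of_nat (hilbert_function n (ideal_gen n r f) t) :: rat)
      \<le> of_nat (hilbert_function n (ideal_gen n r (\<lambda>k. var k ^ d k :: (nat, 'k) mpoly)) t)"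
    by simp
  also have "\<dots> \<le> fps_nth (froberg_series n r d) t"
    by (rule var_powers_hilbert_function_le[OF assms(2)])
  finally show ?thesis .
qed

text \<open>The threshold separates the two kinds of special example:
  \<open>delta d (Suc n) + 2\<close> is the sum of \<open>socle\<close>, \<open>d n\<close> and
  \<open>d (Suc n)\<close>, so \<open>delta d (Suc n) < 2 * t\<close> is the range of
  \<open>exists_surjective_gens\<close>, and the other degrees lie in that of
  \<open>exists_injective_gens\<close>.\<close>

lemma generic_almost_complete_intersection:
  assumes gen: "generic_family F n (Suc n) d f" and n: "1 \<le> n"
    and pos: "\<forall>k\<in>{1..Suc n}. 0 < d k" and mono: "mono_on {1..Suc n} d"
    and sig: "\<forall>i\<in>{4..Suc n}. sigma d (i - 1) \<le> d i"
  shows "if delta d (Suc n) < 2 * t then hilbert_function n (ideal_gen n (Suc n) f) t = 0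
    else of_nat (hilbert_function n (ideal_gen n (Suc n) f) t) \<le> fps_nth (froberg_series n (Suc n) d) t"
proof -
  obtain N where N: "n = Suc N" using n by (cases n) auto
  obtain c :: "nat \<Rightarrow> 'k" where c: "inj c"
    using inf infinite_countable_subset by blast
  interpret grid N d c
    by unfold_locales (use c pos in \<open>auto simp: N\<close>)
  have ab: "d (Suc N) \<le> d (Suc (Suc N))"
    using mono_onD[OF mono, of n "Suc n"] by (simp add: N)
  have a0: "0 < d (Suc N)" "0 < d (Suc (Suc N))" using pos by (auto simp: N)
  have soc: "socle = delta d N" using pos by (simp add: socle_def delta_eq_sum N)
  have del: "delta d (Suc n) + 2 = socle + d (Suc N) + d (Suc (Suc N))"
  proof -
    have "delta d (Suc N) = delta d N + (d (Suc N) - 1)"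
      by (rule delta_Suc) (use pos in \<open>simp add: N\<close>)
    moreover have "delta d (Suc (Suc N)) = delta d (Suc N) + (d (Suc (Suc N)) - 1)"
      by (rule delta_Suc) (use pos in \<open>simp add: N\<close>)
    ultimately show ?thesis using a0 unfolding N soc by linarith
  qed
  have sab: "socle \<le> d (Suc N) + d (Suc (Suc N))"
    unfolding soc by (rule delta_le_next_degrees) (use pos mono sig in \<open>simp_all add: N\<close>)
  have le: "hilbert_function n (ideal_gen n (Suc n) f) t \<le> hilbert_function n (ideal_gen n (Suc n) (gens \<phi>)) t"
    if "\<phi> \<in> forms n (d n)" for \<phi>
    by (rule generic_family_hilbert_function_le[OF F gen]) (use gens_form[of \<phi>] that in \<open>auto simp: N\<close>)
  show ?thesis
  proof (cases "delta d (Suc n) < 2 * t")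
    case True
    then have "socle + d (Suc N) + d (Suc (Suc N)) \<le> 2 * t + 1" using del by simp
    then obtain \<phi> where "\<phi> \<in> forms n (d n)" "hilbert_function n (ideal_gen n (Suc n) (gens \<phi>)) t = 0"
      using exists_surjective_gens[OF inf ab sab a0(1)] unfolding N by blast
    then show ?thesis using le[of \<phi>] True by simp
  next
    case False
    then have "2 * t + 1 \<le> socle + d (Suc N) + d (Suc (Suc N))" using del by simp
    then obtain \<phi> where \<phi>: "\<phi> \<in> forms n (d n)"
      "of_nat (hilbert_function n (ideal_gen n (Suc n) (gens \<phi>)) t) \<le> fps_nth (froberg_series n (Suc n) d) t"
      using exists_injective_gens[OF inf ab sab] unfolding N by blast
    have "(of_nat (hilbert_function n (ideal_gen n (Suc n) f) t) :: rat)
        \<le> of_nat (hilbert_function n (ideal_gen n (Suc n) (gens \<phi>)) t)"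
      using le[OF \<phi>(1)] by simp
    then show ?thesis using \<phi>(2) False by simp
  qed
qed

text \<open>Only degree \<open>d (Suc r)\<close> needs an argument: below it the last form has no
  multiples, above it the quotient is already zero. In that degree the expected coefficient drops by
  exactly 1, the constant term of the series.\<close>

lemma generic_last_form_le:
  assumes gen: "generic_family F n (Suc r) d f" and pos: "\<forall>k\<in>{1..Suc r}. 0 < d k"
    and IH: "\<And>t. of_nat (hilbert_function n (ideal_gen n r f) t) = fps_nth (fps_ceil (froberg_series n r d)) t"
    and van: "\<And>t. d (Suc r) < t \<Longrightarrow> hilbert_function n (ideal_gen n r f) t = 0"
  shows "hilbert_function n (ideal_gen n (Suc r) f) t = 0
    \<or> of_nat (hilbert_function n (ideal_gen n (Suc r) f) t) \<le> fps_nth (froberg_series n (Suc r) d) t"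
proof -
  let ?d = "d (Suc r)" and ?h = "\<lambda>r f t. hilbert_function n (ideal_gen n r f) t"
  have f: "\<And>i. i \<in> {1..Suc r} \<Longrightarrow> f i \<in> forms n (d i)" using gen by (auto simp: generic_family_def)
  have zero: "?h (Suc r) f t = 0" if "?h r f t = 0"
    using that ideal_gen_mono[of r "Suc r" n f] unfolding hilbert_function_eq_0_iff by auto
  have ceil: "?h r f t = 0 \<or> of_nat (?h r f t) = fps_nth (froberg_series n r d) t"
    using IH[of t] by (auto simp: fps_ceil_def split: if_splits)
  show ?thesis
  proof (cases "?h r f t = 0")
    case False
    then have eq: "of_nat (?h r f t) = fps_nth (froberg_series n r d) t" using ceil by simp
    have "t \<le> ?d" using van[of t] False by (rule_tac leI) blast
    then consider "t < ?d" | "t = ?d" by linarith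
    then show ?thesis
    proof cases
      case 1
      then show ?thesis
        using hilbert_function_Suc_low_degree[of r f n d t, OF f] eq by (simp add: froberg_series_nth_Suc)
    next
      case 2
      obtain p where p: "p \<in> forms n t" "p \<notin> ideal_gen n r f"
        using False unfolding hilbert_function_eq_0_iff by blast
      \<comment> \<open>Keeps the generic first forms and changes only the last one; semicontinuity
        covers this because the special coefficients may be any elements of the field.\<close>
      define g where "g = f(Suc r := p)"
      have "?h (Suc r) f t \<le> ?h (Suc r) g t"
        by (rule generic_family_hilbert_function_le[OF F gen]) (use f p 2 in \<open>auto simp: g_def le_Suc_eq\<close>)
      moreover have "?h (Suc r) g t + 1 \<le> ?h r f t"
      proof -
        have "ideal_gen n r f = ideal_gen n r g" by (rule ideal_gen_cong) (simp add: g_def)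
        then have sub: "ideal_gen n r f \<subseteq> ideal_gen n (Suc r) g"
          using ideal_gen_mono[of r "Suc r" n g] by simp
        have "1 * g (Suc r) \<in> ideal_gen n (Suc r) g"
          by (rule ideal_gen_mult_form[OF forms_1]) simp
        then have pg: "p \<in> ideal_gen n (Suc r) g" by (simp add: g_def)
        obtain S :: "(nat, 'k) mpoly set" where S: "finite S" "ideal_gen n (Suc r) g \<inter> forms n t \<subseteq> poly_vs.span S"
          by (rule ideal_forms_finite_span)
        have "poly_vs.dim (ideal_gen n r f \<inter> forms n t) + 1 \<le> poly_vs.dim (ideal_gen n (Suc r) g \<inter> forms n t)"
          by (rule poly_vs.dim_Suc_le[OF _ _ S, where p = p])
            (use sub p pg in \<open>auto intro!: poly_vs.subspace_inter ideal_gen_subspace subspace_forms\<close>)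
        then show ?thesis
          using hilbert_function_add_dim[OF ideal_gen_subspace[of n r f], of n t]
            hilbert_function_add_dim[OF ideal_gen_subspace[of n "Suc r" g], of n t] by linarith
      qed
      ultimately have "(of_nat (?h (Suc r) f t + 1) :: rat) \<le> of_nat (?h r f t)"
        by (simp only: of_nat_le_iff)
      moreover have "fps_nth (froberg_series n r d) 0 = 1"
        by (rule froberg_series_nth_0) (use pos in auto)
      ultimately show ?thesis using eq 2 by (simp add: froberg_series_nth_Suc)
    qed
  qed (use zero in simp)
qed

lemma generic_hilbert_function:
  assumes "generic_family F n r d f" and n: "1 \<le> n" and "r \<le> n + 2"
    and "\<forall>k\<in>{1..r}. 0 < d k" and "mono_on {1..r} d"
    and "\<forall>i\<in>{4..r}. sigma d (i - 1) \<le> d i"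
  shows "of_nat (hilbert_function n (ideal_gen n r f) t) = fps_nth (fps_ceil (froberg_series n r d)) t"
  using assms(1,3-)
proof (induction r arbitrary: t)
  case 0
  \<comment> \<open>Since \<open>n \<ge> 1\<close>, every degree contains a power of the first
    variable, so nothing is truncated.\<close>
  have "0 < card (monomials n j)" for j
  proof -
    have "Poly_Mapping.single 1 j \<in> monomials n j" using n by (auto simp: monomials_def)
    then show ?thesis using finite_monomials card_gt_0_iff by blast
  qed
  then show ?case
    by (simp add: hilbert_function_no_generators fps_ceil_def froberg_series_eq)
next
  case (Suc r)
  note gen = Suc.prems(1) and r = Suc.prems(2) and pos = Suc.prems(3) and mono = Suc.prems(4) and sig = Suc.prems(5)
  let ?h = "\<lambda>r t. hilbert_function n (ideal_gen n r f) t"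
  have f: "\<And>i. i \<in> {1..Suc r} \<Longrightarrow> f i \<in> forms n (d i)" using gen by (auto simp: generic_family_def)
  have gen_r: "generic_family F n r d f" by (rule generic_family_antimono[OF gen]) simp
  have mono_r: "mono_on {1..r} d" by (rule mono_on_subset[OF mono]) simp
  have IH: "of_nat (?h r t) = fps_nth (fps_ceil (froberg_series n r d)) t" for t
    by (rule Suc.IH[OF gen_r _ _ mono_r]) (use r pos sig in auto)
  have up: "?h (Suc r) t = 0 \<or> of_nat (?h (Suc r) t) \<le> fps_nth (froberg_series n (Suc r) d) t" for t
  proof -
    consider "Suc r \<le> n" | "r = n" | "r = Suc n" using r by linarith
    then show ?thesis
    proof cases
      case 1
      then show ?thesis using generic_le_froberg_complete_intersection[OF gen] by blast
    next
      case 2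
      then show ?thesis
        using generic_almost_complete_intersection[of t] gen n pos mono sig by (auto split: if_splits)
    next
      case 3
      \<comment> \<open>Hence the first \<open>n + 1\<close> forms leave nothing in degrees above
        \<open>d (Suc r)\<close>, as \<open>generic_last_form_le\<close> requires.\<close>
      have "delta d r \<le> 2 * d (Suc r) + 1"
        by (rule delta_le_twice_last_degree[OF pos mono _ sig]) (use 3 n in simp)
      then have "?h r s = 0" if "d (Suc r) < s" for s
        using generic_almost_complete_intersection[of s] gen_r n pos mono_r sig that 3
        by (auto split: if_splits)
      then show ?thesis by (rule generic_last_form_le[OF gen pos IH])
    qed
  qed
  show ?case
    unfolding froberg_series_Suc
  proof (rule fps_ceil_step[OF IH])
    show "0 < d (Suc r)" using pos by simp
    show "?h (Suc r) t = ?h r t" if "t < d (Suc r)" for t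
      using hilbert_function_Suc_low_degree[of r f n d t, OF f] that by simp
    show "?h r t \<le> ?h (Suc r) t + ?h r (t - d (Suc r))" if "d (Suc r) \<le> t" for t
      using hilbert_function_Suc_ge[of r f n d t, OF f] that by simp
    show "?h (Suc r) t = 0 \<or> of_nat (?h (Suc r) t) \<le> fps_nth (froberg_series n r d * (1 - fps_X ^ d (Suc r))) t" for t
      using up[of t] by (simp only: froberg_series_Suc)
    show "?h (Suc r) t = 0" if "?h (Suc r) s = 0" "s \<le> t" for s t
      by (rule hilbert_function_eq_0_mono[OF that])
  qed
qed

end

theorem theorem2:
  fixes F :: "'k::field set" and n r :: nat and d :: "nat \<Rightarrow> nat"
    and I :: "(nat, 'k) mpoly set"
  assumes "infinite (UNIV :: 'k set)"
    and "is_subfield F"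
    and "n \<ge> 1" and "r \<le> n + 2"
    and "\<forall>i\<in>{1..r}. d i > 0" and "mono_on {1..r} d"
    and "generic_homogeneous_ideal F n r d I"
    and "r \<le> 3 \<or> (r \<ge> 4 \<and> (\<forall>i\<in>{4..r}. d i \<ge> sigma d (i - 1)))"
  shows "hilbert_series n I =
    fps_ceil ((\<Prod>i=1..r. 1 - fps_X ^ d i) / (1 - fps_X) ^ n)"
proof -
  obtain f where f: "generic_family F n r d f" "I = ideal_gen n r f"
    using assms(7) unfolding generic_homogeneous_ideal_def generic_family_def generic_form_def by blast
  \<comment> \<open>For \<open>r \<le> 3\<close> the index range is empty.\<close>
  have sig: "\<forall>i\<in>{4..r}. sigma d (i - 1) \<le> d i"
    using assms(8) by auto
  have "of_nat (hilbert_function n I t) = fps_nth (fps_ceil (froberg_series n r d)) t" for t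
    unfolding f(2) by (rule generic_hilbert_function[OF assms(1,2) f(1) assms(3-6) sig])
  then show ?thesis
    by (intro fps_ext) (simp add: hilbert_series_def froberg_series_def)
qed

end
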